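(* Let $n\ge 1$, let $A=(a_{ij})\in M_n(\mathbb{Z})$ be a skew-symmetric matrix, let $R=\mathbb{C}[X_1,\ldots,X_n]$ be the Poisson algebra with $\{X_i,X_j\}=a_{ij}X_iX_j$, and let $M$ be the Poisson $R$-module which is $R$ as a vector space, with the usual product as $R$-action and with external bracket $\{\cdot,\cdot\}_M$ determined by $\{m,X_i\}_M=-\{X_i,m\}+\left(\sum_{l=1}^n a_{il}\right)X_im$ for all $m\in M$ and $1\le i\le n$. Then for all $k\in\mathbb{N}$ there is an isomorphism of vector spaces $$HP_k(R,M)\simeq HP^{n-k}(R),$$ where $HP_*(R,M)$ is the Poisson homology of $R$ with values in $M$ and $HP^*(R)$ is the Poisson cohomology of $R$.
   Context: A Poisson algebra is a commutative $\mathbb{C}$-algebra $R$ with a Lie bracket $\{\cdot,\cdot\}$ such that each $\{r,\cdot\}$ is a $\mathbb{C}$-linear derivation of $R$. A Poisson module over $R$ is a $\mathbb{C}$-vector space $M$ with two bilinear maps $\cdot: M\times R\to M$ and $\{\cdot,\cdot\}_M:M\times R\to M$ such that: (1) $(M,\cdot)$ is a (right) module over the commutative algebra $R$; (2) $(M,\{\cdot,\cdot\}_M)$ is a right module over the Lie algebra $(R,\{\cdot,\cdot\})$; (3) $x\cdot\{a,b\}=\{x,a\}_M\cdot b-\{x\cdot b,a\}_M$; (4) $\{x,ab\}_M=\{x,a\}_M\cdot b+\{x,b\}_M\cdot a$, for all $a,b\in R$, $x\in M$. For the module $M$ of the claim, $\{m,a\}_M$ for general $a\in R$ is determined by the values on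 generators together with (4); equivalently $\{X_1^{\alpha_1}\cdots X_n^{\alpha_n},X_i\}_M=-\sum_j a_{ij}(\alpha_j-1)\,X_i X_1^{\alpha_1}\cdots X_n^{\alpha_n}$. Poisson homology: $HP_*(R,M)$ is the homology of the complex $C_k=M\otimes_R\Omega^k(R)$, where $\Omega^k(R)$ is the module of Kähler differential $k$-forms of $R$ over $\mathbb{C}$, with boundary $\partial_k:C_k\to C_{k-1}$, $$\partial_k(m\otimes da_1\wedge\cdots\wedge da_k)=\sum_{i=1}^k(-1)^{i+1}\{m,a_i\}_M\otimes da_1\wedge\cdots\widehat{da_i}\cdots\wedge da_k+\sum_{1\le i<j\le k}(-1)^{i+j}m\otimes d\{a_i,a_j\}\wedge da_1\wedge\cdots\widehat{da_i}\cdots\widehat{da_j}\cdots\wedge da_k .$$ Poisson cohomology: $HP^*(R)$ is the cohomology of the complex $\chi^k(R)$ of skew-symmetric $k$-linear (over $\mathbb{C}$) maps $R^k\to R$ that are derivations in each argument, with coboundary $\delta_k:\chi^k(R)\to\chi^{k+1}(R)$, $$\delta_k(P)(f_0,\ldots,f_k)=\sum_{i=0}^k(-1)^i\{f_i,P(f_0,\ldots,\widehat{f_i},\ldots,f_k)\}+\sum_{0\le i<j\le k}(-1)^{i+j}P(\{f_i,f_j\},f_0,\ldots,\widehat{f_i},\ldots,\widehat{f_j},\ldots,f_k).$$ Hats denote omitted terms; (co)homology in negative degree is zero. *)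

theory Defs
  imports
    "HOL-Analysis.Finite_Cartesian_Product"
    "HOL-Library.Poly_Mapping"
    "HOL-Algebra.AbelCoset"
    "HOL-Algebra.Module"
begin

text \<open>
  Modules over a commutative ring given as a type are encoded by the record
  \<^type>\<open>module\<close> of HOL-Algebra, all elements of the scalar type being scalars.
  Only the fields \<open>carrier\<close>, \<open>zero\<close>, \<open>add\<close> and \<open>smult\<close> carry information; the
  multiplicative fields inherited from rings are junk.
\<close>

definition mk_module ::
    "'v set \<Rightarrow> 'v \<Rightarrow> ('v \<Rightarrow> 'v \<Rightarrow> 'v) \<Rightarrow> ('k \<Rightarrow> 'v \<Rightarrow> 'v) \<Rightarrow> ('k, 'v) module" where
  "mk_module V z p s =
     \<lparr>carrier = V, monoid.mult = undefined, one = undefined, zero = z, add = p, smult = s\<rparr>"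

definition linear_map :: "('k, 'v) module \<Rightarrow> ('k, 'w) module \<Rightarrow> ('v \<Rightarrow> 'w) \<Rightarrow> bool" where
  "linear_map V W f \<longleftrightarrow>
     f \<in> carrier V \<rightarrow> carrier W \<and>
     (\<forall>x\<in>carrier V. \<forall>y\<in>carrier V. f (x \<oplus>\<^bsub>V\<^esub> y) = f x \<oplus>\<^bsub>W\<^esub> f y) \<and>
     (\<forall>c. \<forall>x\<in>carrier V. f (c \<odot>\<^bsub>V\<^esub> x) = c \<odot>\<^bsub>W\<^esub> f x)"

definition isomorphic_modules :: "('k, 'v) module \<Rightarrow> ('k, 'w) module \<Rightarrow> bool" where
  "isomorphic_modules V W \<longleftrightarrow> (\<exists>f. linear_map V W f \<and> bij_betw f (carrier V) (carrier W))"

definition quotient_module :: "('k, 'v) module \<Rightarrow> 'v set \<Rightarrow> ('k, 'v set) module" where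
  "quotient_module V N =
     mk_module (a_rcosets\<^bsub>V\<^esub> N) N (\<lambda>S T. S <+>\<^bsub>V\<^esub> T)
       (\<lambda>c S. N <+>\<^bsub>V\<^esub> ((\<lambda>x. c \<odot>\<^bsub>V\<^esub> x) ` S))"

definition restrict_scalars :: "('l \<Rightarrow> 'k) \<Rightarrow> ('k, 'v) module \<Rightarrow> ('l, 'v) module" where
  "restrict_scalars \<iota> V =
     mk_module (carrier V) \<zero>\<^bsub>V\<^esub> (\<lambda>x y. x \<oplus>\<^bsub>V\<^esub> y) (\<lambda>c x. \<iota> c \<odot>\<^bsub>V\<^esub> x)"

text \<open>Homology at \<open>V\<close> of a sequence \<open>U \<rightarrow> V \<rightarrow> W\<close>.\<close>

definition homology_module ::
    "('k, 'u) module \<Rightarrow> ('u \<Rightarrow> 'v) \<Rightarrow> ('k, 'v) module \<Rightarrow> ('v \<Rightarrow> 'w) \<Rightarrow> ('k, 'w) module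
      \<Rightarrow> ('k, 'v set) module" where
  "homology_module U f V g W =
     quotient_module (V\<lparr>carrier := {x \<in> carrier V. g x = \<zero>\<^bsub>W\<^esub>}\<rparr>) (f ` carrier U)"

definition pm_scale :: "'k \<Rightarrow> ('x \<Rightarrow>\<^sub>0 'k) \<Rightarrow> ('x \<Rightarrow>\<^sub>0 'k::semiring_0)" where
  "pm_scale c f = Poly_Mapping.map ((*) c) f"

definition free_module :: "'x set \<Rightarrow> ('k::comm_ring_1, 'x \<Rightarrow>\<^sub>0 'k) module" where
  "free_module X = mk_module {f. Poly_Mapping.keys f \<subseteq> X} 0 (+) pm_scale"

abbreviation gen :: "'x \<Rightarrow> ('x \<Rightarrow>\<^sub>0 'k::comm_ring_1)" where
  "gen x \<equiv> Poly_Mapping.single x 1"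

text \<open>The module with generators \<open>X\<close> and relations \<open>S\<close>, and the class of a generator in it.\<close>

definition presented_module ::
    "'x set \<Rightarrow> ('x \<Rightarrow>\<^sub>0 'k::comm_ring_1) set \<Rightarrow> ('k, ('x \<Rightarrow>\<^sub>0 'k) set) module" where
  "presented_module X S = quotient_module (free_module X) (module.span pm_scale S)"

definition generator_class ::
    "'x set \<Rightarrow> ('x \<Rightarrow>\<^sub>0 'k::comm_ring_1) set \<Rightarrow> 'x \<Rightarrow> ('x \<Rightarrow>\<^sub>0 'k) set" where
  "generator_class X S x =
     module.span pm_scale S +>\<^bsub>free_module X\<^esub> gen x"

definition tensor_relations ::
    "('k::comm_ring_1, 'v) module \<Rightarrow> ('k, 'w) module \<Rightarrow> ('v \<times> 'w \<Rightarrow>\<^sub>0 'k) set" where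
  "tensor_relations V W =
     {gen (x \<oplus>\<^bsub>V\<^esub> x', y) - gen (x, y) - gen (x', y) | x x' y.
        x \<in> carrier V \<and> x' \<in> carrier V \<and> y \<in> carrier W} \<union>
     {gen (x, y \<oplus>\<^bsub>W\<^esub> y') - gen (x, y) - gen (x, y') | x y y'.
        x \<in> carrier V \<and> y \<in> carrier W \<and> y' \<in> carrier W} \<union>
     {gen (r \<odot>\<^bsub>V\<^esub> x, y) - pm_scale r (gen (x, y)) | r x y. x \<in> carrier V \<and> y \<in> carrier W} \<union>
     {gen (x, r \<odot>\<^bsub>W\<^esub> y) - pm_scale r (gen (x, y)) | r x y. x \<in> carrier V \<and> y \<in> carrier W}"

definition tensor_product ::
    "('k::comm_ring_1, 'v) module \<Rightarrow> ('k, 'w) module \<Rightarrow> ('k, ('v \<times> 'w \<Rightarrow>\<^sub>0 'k) set) module" where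
  "tensor_product V W = presented_module (carrier V \<times> carrier W) (tensor_relations V W)"

definition tensor ::
    "('k::comm_ring_1, 'v) module \<Rightarrow> ('k, 'w) module \<Rightarrow> 'v \<Rightarrow> 'w \<Rightarrow> ('v \<times> 'w \<Rightarrow>\<^sub>0 'k) set" where
  "tensor V W x y = generator_class (carrier V \<times> carrier W) (tensor_relations V W) (x, y)"

text \<open>
  Degrees are integers, and a tuple of degree \<open>k\<close> is a list whose length is \<open>k\<close>. For \<open>k < 0\<close>
  there are none, so that everything indexed by tuples vanishes in negative degree.
\<close>

definition tuples :: "'v set \<Rightarrow> int \<Rightarrow> 'v list set" where
  "tuples V k = {xs \<in> lists V. int (length xs) = k}"

definition exterior_relations ::
    "('k::comm_ring_1, 'v) module \<Rightarrow> int \<Rightarrow> ('v list \<Rightarrow>\<^sub>0 'k) set" where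
  "exterior_relations V k =
     {gen (xs[i := x \<oplus>\<^bsub>V\<^esub> y]) - gen (xs[i := x]) - gen (xs[i := y]) | xs i x y.
        xs \<in> tuples (carrier V) k \<and> i < length xs \<and> x \<in> carrier V \<and> y \<in> carrier V} \<union>
     {gen (xs[i := r \<odot>\<^bsub>V\<^esub> x]) - pm_scale r (gen (xs[i := x])) | xs i r x.
        xs \<in> tuples (carrier V) k \<and> i < length xs \<and> x \<in> carrier V} \<union>
     {gen xs | xs. xs \<in> tuples (carrier V) k \<and> \<not> distinct xs}"

definition exterior_power ::
    "('k::comm_ring_1, 'v) module \<Rightarrow> int \<Rightarrow> ('k, ('v list \<Rightarrow>\<^sub>0 'k) set) module" where
  "exterior_power V k = presented_module (tuples (carrier V) k) (exterior_relations V k)"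

definition wedge :: "('k::comm_ring_1, 'v) module \<Rightarrow> 'v list \<Rightarrow> ('v list \<Rightarrow>\<^sub>0 'k) set" where
  "wedge V xs = generator_class (tuples (carrier V) (int (length xs)))
     (exterior_relations V (int (length xs))) xs"

locale poisson_algebra = vector_space sc
  for sc :: "complex \<Rightarrow> 'r::comm_ring_1 \<Rightarrow> 'r" +
  fixes br :: "'r \<Rightarrow> 'r \<Rightarrow> 'r"
  assumes sc_mult: "sc c (a * b) = sc c a * b"
    and br_add_left: "br (a + b) x = br a x + br b x"
    and br_scale_left: "br (sc c a) x = sc c (br a x)"
    and br_add_right: "br x (a + b) = br x a + br x b"
    and br_scale_right: "br x (sc c a) = sc c (br x a)"
    and br_self: "br a a = 0"
    and br_jacobi: "br a (br b x) + br b (br x a) + br x (br a b) = 0"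
    and br_leibniz: "br x (a * b) = br x a * b + a * br x b"

locale poisson_module = poisson_algebra sc br + M: vector_space scM
  for sc :: "complex \<Rightarrow> 'r::comm_ring_1 \<Rightarrow> 'r" and br :: "'r \<Rightarrow> 'r \<Rightarrow> 'r"
    and scM :: "complex \<Rightarrow> 'm::ab_group_add \<Rightarrow> 'm" +
  fixes act :: "'m \<Rightarrow> 'r \<Rightarrow> 'm" and mbr :: "'m \<Rightarrow> 'r \<Rightarrow> 'm"
  assumes act_add_left: "act (x + y) a = act x a + act y a"
    and act_scale_left: "act (scM c x) a = scM c (act x a)"
    and act_add_right: "act x (a + b) = act x a + act x b"
    and act_scale_right: "act x (sc c a) = scM c (act x a)"
    and act_one: "act x 1 = x"
    and act_mult: "act x (a * b) = act (act x a) b"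
    and mbr_add_left: "mbr (x + y) a = mbr x a + mbr y a"
    and mbr_scale_left: "mbr (scM c x) a = scM c (mbr x a)"
    and mbr_add_right: "mbr x (a + b) = mbr x a + mbr x b"
    and mbr_scale_right: "mbr x (sc c a) = scM c (mbr x a)"
    and mbr_lie: "mbr x (br a b) = mbr (mbr x a) b - mbr (mbr x b) a"
    and act_br: "act x (br a b) = act (mbr x a) b - mbr (act x b) a"
    and mbr_mult: "mbr x (a * b) = act (mbr x a) b + act (mbr x b) a"

text \<open>
  \<open>R\<close> is the type \<^typ>\<open>'r\<close>, with \<open>\<complex>\<close>-algebra structure given by the scalar multiplication \<open>sc\<close>.
\<close>

definition kaehler_relations ::
    "(complex \<Rightarrow> 'r::comm_ring_1 \<Rightarrow> 'r) \<Rightarrow> ('r \<Rightarrow>\<^sub>0 'r) set" where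
  "kaehler_relations sc =
     {gen (a + b) - gen a - gen b | a b. True} \<union>
     {gen (sc c a) - pm_scale (sc c 1) (gen a) | c a. True} \<union>
     {gen (a * b) - pm_scale a (gen b) - pm_scale b (gen a) | a b. True}"

definition kaehler :: "(complex \<Rightarrow> 'r::comm_ring_1 \<Rightarrow> 'r) \<Rightarrow> ('r, ('r \<Rightarrow>\<^sub>0 'r) set) module" where
  "kaehler sc = presented_module UNIV (kaehler_relations sc)"

definition kaehler_d :: "(complex \<Rightarrow> 'r::comm_ring_1 \<Rightarrow> 'r) \<Rightarrow> 'r \<Rightarrow> ('r \<Rightarrow>\<^sub>0 'r) set" where
  "kaehler_d sc a = generator_class UNIV (kaehler_relations sc) a"

definition kaehler_forms ::
    "(complex \<Rightarrow> 'r::comm_ring_1 \<Rightarrow> 'r) \<Rightarrow> int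
      \<Rightarrow> ('r, (('r \<Rightarrow>\<^sub>0 'r) set list \<Rightarrow>\<^sub>0 'r) set) module" where
  "kaehler_forms sc k = exterior_power (kaehler sc) k"

definition action_module :: "('m::ab_group_add \<Rightarrow> 'r \<Rightarrow> 'm) \<Rightarrow> ('r, 'm) module" where
  "action_module act = mk_module UNIV 0 (+) (\<lambda>r m. act m r)"

type_synonym ('r, 'm) poisson_chain =
  "('m \<times> (('r \<Rightarrow>\<^sub>0 'r) set list \<Rightarrow>\<^sub>0 'r) set \<Rightarrow>\<^sub>0 'r) set"

definition chain_module ::
    "(complex \<Rightarrow> 'r::comm_ring_1 \<Rightarrow> 'r) \<Rightarrow> ('m::ab_group_add \<Rightarrow> 'r \<Rightarrow> 'm) \<Rightarrow> int
      \<Rightarrow> (complex, ('r, 'm) poisson_chain) module" where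
  "chain_module sc act k =
     restrict_scalars (\<lambda>c. sc c 1) (tensor_product (action_module act) (kaehler_forms sc k))"

definition elementary_chain ::
    "(complex \<Rightarrow> 'r::comm_ring_1 \<Rightarrow> 'r) \<Rightarrow> ('m::ab_group_add \<Rightarrow> 'r \<Rightarrow> 'm)
      \<Rightarrow> 'm \<Rightarrow> 'r list \<Rightarrow> ('r, 'm) poisson_chain" where
  "elementary_chain sc act m as =
     tensor (action_module act) (kaehler_forms sc (int (length as)))
       m (wedge (kaehler sc) (map (kaehler_d sc) as))"

text \<open>
  Positions in lists start at \<open>0\<close>, which turns the sign \<open>(-1)\<^sup>i\<^sup>+\<^sup>1\<close> into \<open>(-1)\<^sup>i\<close> and leaves the
  sign \<open>(-1)\<^sup>i\<^sup>+\<^sup>j\<close> unchanged; \<open>nths as (- I)\<close> omits the entries at the positions in \<open>I\<close>.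
\<close>

definition boundary_value ::
    "(complex \<Rightarrow> 'r::comm_ring_1 \<Rightarrow> 'r) \<Rightarrow> ('r \<Rightarrow> 'r \<Rightarrow> 'r)
      \<Rightarrow> ('m::ab_group_add \<Rightarrow> 'r \<Rightarrow> 'm) \<Rightarrow> ('m \<Rightarrow> 'r \<Rightarrow> 'm)
      \<Rightarrow> 'm \<Rightarrow> 'r list \<Rightarrow> ('r, 'm) poisson_chain" where
  "boundary_value sc br act mbr m as =
    (let C = chain_module sc act (int (length as) - 1) in
      (\<Oplus>\<^bsub>C\<^esub>i\<in>{..<length as}.
         (-1) ^ i \<odot>\<^bsub>C\<^esub> elementary_chain sc act (mbr m (as ! i)) (nths as (- {i})))
      \<oplus>\<^bsub>C\<^esub>
      (\<Oplus>\<^bsub>C\<^esub>j\<in>{..<length as}. \<Oplus>\<^bsub>C\<^esub>i\<in>{..<j}.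
         (-1) ^ (i + j) \<odot>\<^bsub>C\<^esub>
           elementary_chain sc act m (br (as ! i) (as ! j) # nths as (- {i, j}))))"

text \<open>
  The boundary is the linear map with the prescribed values on the chains
  \<open>m \<otimes> da\<^sub>1 \<and> \<dots> \<and> da\<^sub>k\<close>. As these span the module of \<open>k\<close>-chains, it is unique there;
  its values elsewhere are irrelevant.
\<close>

definition poisson_boundary ::
    "(complex \<Rightarrow> 'r::comm_ring_1 \<Rightarrow> 'r) \<Rightarrow> ('r \<Rightarrow> 'r \<Rightarrow> 'r)
      \<Rightarrow> ('m::ab_group_add \<Rightarrow> 'r \<Rightarrow> 'm) \<Rightarrow> ('m \<Rightarrow> 'r \<Rightarrow> 'm) \<Rightarrow> int
      \<Rightarrow> ('r, 'm) poisson_chain \<Rightarrow> ('r, 'm) poisson_chain" where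
  "poisson_boundary sc br act mbr k =
     (SOME D. linear_map (chain_module sc act k) (chain_module sc act (k - 1)) D \<and>
        (\<forall>m as. int (length as) = k \<longrightarrow>
           D (elementary_chain sc act m as) = boundary_value sc br act mbr m as))"

definition poisson_homology ::
    "(complex \<Rightarrow> 'r::comm_ring_1 \<Rightarrow> 'r) \<Rightarrow> ('r \<Rightarrow> 'r \<Rightarrow> 'r)
      \<Rightarrow> ('m::ab_group_add \<Rightarrow> 'r \<Rightarrow> 'm) \<Rightarrow> ('m \<Rightarrow> 'r \<Rightarrow> 'm) \<Rightarrow> int
      \<Rightarrow> (complex, ('r, 'm) poisson_chain set) module" where
  "poisson_homology sc br act mbr k =
     homology_module
       (chain_module sc act (k + 1)) (poisson_boundary sc br act mbr (k + 1))
       (chain_module sc act k) (poisson_boundary sc br act mbr k)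
       (chain_module sc act (k - 1))"

text \<open>A \<open>k\<close>-linear map is a function on lists that vanishes on lists of the wrong length.\<close>

definition skew_multiderivations ::
    "(complex \<Rightarrow> 'r::comm_ring_1 \<Rightarrow> 'r) \<Rightarrow> int \<Rightarrow> ('r list \<Rightarrow> 'r) set" where
  "skew_multiderivations sc k =
     {P. (\<forall>fs. int (length fs) \<noteq> k \<longrightarrow> P fs = 0) \<and>
         (\<forall>fs i. int (length fs) = k \<and> i < length fs \<longrightarrow>
            (\<forall>a b. P (fs[i := a + b]) = P (fs[i := a]) + P (fs[i := b])) \<and>
            (\<forall>c a. P (fs[i := sc c a]) = sc c (P (fs[i := a]))) \<and>
            (\<forall>a b. P (fs[i := a * b]) = P (fs[i := a]) * b + a * P (fs[i := b]))) \<and>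
         (\<forall>fs i j. int (length fs) = k \<and> i < j \<and> j < length fs \<longrightarrow>
            P (fs[i := fs ! j, j := fs ! i]) = - P fs)}"

definition cochain_module ::
    "(complex \<Rightarrow> 'r::comm_ring_1 \<Rightarrow> 'r) \<Rightarrow> int \<Rightarrow> (complex, 'r list \<Rightarrow> 'r) module" where
  "cochain_module sc k =
     mk_module (skew_multiderivations sc k) (\<lambda>fs. 0) (\<lambda>P Q fs. P fs + Q fs) (\<lambda>c P fs. sc c (P fs))"

text \<open>
  The degree need not be given: for \<open>P\<close> of degree \<open>k\<close>, all terms vanish unless \<open>fs\<close> has
  length \<open>k + 1\<close>.
\<close>

definition poisson_coboundary ::
    "('r::comm_ring_1 \<Rightarrow> 'r \<Rightarrow> 'r) \<Rightarrow> ('r list \<Rightarrow> 'r) \<Rightarrow> 'r list \<Rightarrow> 'r" where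
  "poisson_coboundary br P fs =
     (\<Sum>i<length fs. (-1) ^ i * br (fs ! i) (P (nths fs (- {i})))) +
     (\<Sum>j<length fs. \<Sum>i<j.
        (-1) ^ (i + j) * P (br (fs ! i) (fs ! j) # nths fs (- {i, j})))"

definition poisson_cohomology ::
    "(complex \<Rightarrow> 'r::comm_ring_1 \<Rightarrow> 'r) \<Rightarrow> ('r \<Rightarrow> 'r \<Rightarrow> 'r) \<Rightarrow> int
      \<Rightarrow> (complex, ('r list \<Rightarrow> 'r) set) module" where
  "poisson_cohomology sc br k =
     homology_module
       (cochain_module sc (k - 1)) (poisson_coboundary br)
       (cochain_module sc k) (poisson_coboundary br)
       (cochain_module sc (k + 1))"

text \<open>
  \<open>\<complex>[X\<^sub>1, \<dots>, X\<^sub>n]\<close> with the variables indexed by a finite type \<^typ>\<open>'n\<close>. Its scalar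
  multiplication is \<^const>\<open>pm_scale\<close>.
\<close>

type_synonym 'n cpoly = "('n \<Rightarrow>\<^sub>0 nat) \<Rightarrow>\<^sub>0 complex"

definition pvar :: "'n \<Rightarrow> 'n cpoly" where
  "pvar i = Poly_Mapping.single (Poly_Mapping.single i 1) 1"

end

theory Submission
  imports "Jordan_Normal_Form.Determinant" Defs
begin

text \<open>
  The isomorphism is induced by an isomorphism of complexes up to sign. Let
  \<open>J(c\<^sub>1, \<dots>, c\<^sub>n)\<close> be the Jacobian determinant of \<open>n\<close> polynomials. Contraction with the volume form
  sends \<open>m \<otimes> da\<^sub>1 \<and> \<dots> \<and> da\<^sub>k\<close> to the multiderivation \<open>(b\<^sub>1, \<dots>, b\<^sub>n\<^sub>-\<^sub>k) \<mapsto> m J(a, b)\<close>. It is bijective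
  because chains are combinations of the forms \<open>dX\<^sub>I\<close>, multiderivations are determined by their values
  on variables, and \<open>J(X\<^sub>I, X\<^sub>L)\<close> is \<open>\<plusminus>1\<close> if \<open>L\<close> is the complement of \<open>I\<close>, and \<open>0\<close> otherwise.
  It intertwines \<open>\<partial>\<close> with \<open>(-1)\<^sup>k \<delta>\<close> by three identities: for \<open>n + 1\<close> polynomials \<open>c\<close> and a derivation \<open>D\<close>,
  \<open>\<Sum>\<^sub>p (-1)\<^sup>p D(c\<^sub>p) J(c \<setminus> c\<^sub>p) = 0\<close>; for a derivation \<open>D\<close>,
  \<open>D(J(c)) = \<Sum>\<^sub>r J(\<dots>, D(c\<^sub>r), \<dots>) - div(D) J(c)\<close>; and
  \<open>\<Sum>\<^sub>i\<^sub><\<^sub>j (-1)\<^sup>i\<^sup>+\<^sup>j J({c\<^sub>i, c\<^sub>j}, c \<setminus> c\<^sub>i, c\<^sub>j) = 0\<close>. The twist of the bracket of the module is exactly the divergence of the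
  Hamiltonian derivation: \<open>{m, f}\<^sub>M = -{f, m} + div({f, \<cdot>}) m\<close>.
\<close>

section \<open>Lists and determinants of lists of vectors\<close>

text \<open>The boundary is specified only as some linear map with prescribed values on the chains m
  \<otimes> da_1 \<and> ... \<and> da_k. These satisfy many relations, so the existence of such a
  map has to be proved. Instead of testing the formula against every relation, contraction is shown
  to be bijective beforehand; the signed coboundary, pulled back along it, then has the prescribed
  values. In the same way the uniqueness of the coefficients of the forms dX_I is read off from the
  contracted chain. The orderings of variables are arbitrary choices, so the signs of the J(X_I,
  X_L) are never computed: it is enough that they square to 1. The third identity comes from the
  other two. Expanding each summand by the second identity leaves minus twice the sum over pairs,
  together with an instance of the first identity for the map f \<mapsto> div({f, .}), which is
  itself a derivation.\<close>

lemma nths_delete_Cons_0 [simp]: "nths (x # xs) (- {0}) = xs"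
  by (simp add: nths_Cons nths_all)

lemma nths_delete_Cons_Suc [simp]: "nths (x # xs) (- {Suc i}) = x # nths xs (- {i})"
proof -
  have "{j. Suc j \<in> - {Suc i}} = - {i}" by auto
  then show ?thesis by (simp add: nths_Cons)
qed

lemma nths_delete_conv: "nths xs (- {i}) = take i xs @ drop (Suc i) xs"
proof (induction xs arbitrary: i)
  case (Cons x xs)
  then show ?case by (cases i) auto
qed simp

lemma length_nths_delete: "i < length xs \<Longrightarrow> length (nths xs (- {i})) = length xs - 1"
  by (simp add: nths_delete_conv)

lemma nth_nths_delete:
  "r < length xs - 1 \<Longrightarrow> nths xs (- {i}) ! r = (if r < i then xs ! r else xs ! Suc r)"
  by (auto simp: nths_delete_conv nth_append)

lemma nths_delete2:
  assumes "i < j"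
  shows "nths xs (- {i, j}) = nths (nths xs (- {j})) (- {i})"
  using assms
proof (induction xs arbitrary: i j)
  case (Cons x xs)
  obtain j' where j: "j = Suc j'" using Cons.prems by (cases j) auto
  show ?case
  proof (cases i)
    case 0
    have "{l. Suc l \<in> - {0, Suc j'}} = - {j'}" by auto
    then show ?thesis by (simp add: j 0 nths_Cons nths_all)
  next
    case (Suc i')
    have "{l. Suc l \<in> - {Suc i', Suc j'}} = - {i', j'}" by auto
    then show ?thesis using Cons Suc j by (simp add: nths_Cons Compl_eq)
  qed
qed simp

text \<open>Removing the smaller position first moves the larger one down by one. Both orders of
  removal occur: in \<open>br_jacobian\<close> the position p goes first, and the other one may lie
  on either side of it.\<close>

lemma nths_delete2':
  assumes "i < j"
  shows "nths xs (- {i, j}) = nths (nths xs (- {i})) (- {j - 1})"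
  using assms
proof (induction xs arbitrary: i j)
  case (Cons x xs)
  obtain j' where j: "j = Suc j'" using Cons.prems by (cases j) auto
  show ?case
  proof (cases i)
    case 0
    have "{l. Suc l \<in> - {0, Suc j'}} = - {j'}" by auto
    then show ?thesis by (simp add: j 0 nths_Cons nths_all)
  next
    case (Suc i')
    have "{l. Suc l \<in> - {Suc i', Suc j'}} = - {i', j'}" by auto
    moreover obtain j'' where "j' = Suc j''" using Cons.prems Suc j by (cases j') auto
    ultimately show ?thesis using Cons.IH[of i' j'] Cons.prems Suc j by (simp add: nths_Cons Compl_eq)
  qed
qed simp

lemma length_nths_delete2:
  "i < j \<Longrightarrow> j < length xs \<Longrightarrow> length (nths xs (- {i, j})) = length xs - 2"
  by (simp add: nths_delete2 length_nths_delete)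

lemma nths_delete_append1: "i < length xs \<Longrightarrow> nths (xs @ ys) (- {i}) = nths xs (- {i}) @ ys"
  by (simp add: nths_delete_conv)

lemma nths_delete_append2: "nths (xs @ ys) (- {length xs + i}) = xs @ nths ys (- {i})"
  by (simp add: nths_delete_conv)

text \<open>Every rearrangement is a product of transpositions. This brings lists of distinct
  variables into the fixed order given by \<open>list_of\<close>, for properties that survive a
  change of sign.\<close>

lemma swap_closed_mset:
  assumes mset: "mset xs = mset ys" and base: "Q ys"
    and swap: "\<And>zs i j. length zs = length ys \<Longrightarrow> i < j \<Longrightarrow> j < length zs \<Longrightarrow> Q zs
      \<Longrightarrow> Q (zs[i := zs ! j, j := zs ! i])"
  shows "Q xs"
proof -
  obtain p where p: "p permutes {..<length ys}" "permute_list p ys = xs"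
    using mset_eq_permutation[OF mset] .
  have "Q (permute_list p ys)"
    using finite_lessThan p(1)
  proof (induction rule: permutes_rev_induct)
    case id
    then show ?case using base by simp
  next
    case (swap a b p)
    let ?zs = "permute_list p ys"
    have ab: "a < length ys" "b < length ys" using swap by auto
    have "permute_list (p \<circ> Transposition.transpose a b) ys = permute_list (Transposition.transpose a b) ?zs"
      by (rule permute_list_compose) (use ab in \<open>auto intro!: permutes_swap_id\<close>)
    also have "\<dots> = ?zs[a := ?zs ! b, b := ?zs ! a]"
      using ab \<open>a \<noteq> b\<close>
      by (intro nth_equalityI) (auto simp: permute_list_def nth_list_update Transposition.transpose_def)
    also have "\<dots> = ?zs[min a b := ?zs ! max a b, max a b := ?zs ! min a b]"
      using \<open>a \<noteq> b\<close> by (auto simp: min_def max_def list_update_swap)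
    finally have *: "permute_list (p \<circ> Transposition.transpose a b) ys
      = ?zs[min a b := ?zs ! max a b, max a b := ?zs ! min a b]" .
    have "Q (?zs[min a b := ?zs ! max a b, max a b := ?zs ! min a b])"
      by (rule assms(3)) (use ab \<open>a \<noteq> b\<close> swap in \<open>auto simp: min_def max_def\<close>)
    then show ?case by (simp only: *)
  qed
  then show ?thesis using p by simp
qed

text \<open>Induction on the number of entries outside B, replacing one of them at a time. It turns
  linearity or the derivation rule in each single slot into a reduction of all slots to
  generators.\<close>

lemma lists_extend:
  assumes base: "\<And>zs. zs \<in> lists B \<Longrightarrow> length zs = k \<Longrightarrow> Q zs"
    and step: "\<And>zs i x. zs \<in> lists V \<Longrightarrow> length zs = k \<Longrightarrow> i < k \<Longrightarrow> x \<in> V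
      \<Longrightarrow> (\<And>b. b \<in> B \<Longrightarrow> Q (zs[i := b])) \<Longrightarrow> Q (zs[i := x])"
    and "B \<subseteq> V" "xs \<in> lists V" "length xs = k"
  shows "Q xs"
  using assms(4,5)
proof (induction "card {i. i < k \<and> xs ! i \<notin> B}" arbitrary: xs rule: less_induct)
  case less
  show ?case
  proof (cases "{i. i < k \<and> xs ! i \<notin> B} = {}")
    case True
    then have "xs \<in> lists B" using less.prems by (auto simp: in_set_conv_nth in_lists_conv_set)
    then show ?thesis using base less.prems by blast
  next
    case False
    then obtain i where i: "i < k" "xs ! i \<notin> B" by auto
    have "Q (xs[i := xs ! i])"
    proof (rule step)
      show "xs ! i \<in> V" using less.prems i by (auto simp: in_lists_conv_set)
      fix b assume b: "b \<in> B"
      have "{j. j < k \<and> xs[i := b] ! j \<notin> B} \<subset> {j. j < k \<and> xs ! j \<notin> B}"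
        using i b less.prems by (auto simp: nth_list_update split: if_splits)
      then have "card {j. j < k \<and> xs[i := b] ! j \<notin> B} < card {j. j < k \<and> xs ! j \<notin> B}"
        by (intro psubset_card_mono) auto
      moreover have "xs[i := b] \<in> lists V"
        using less.prems b \<open>B \<subseteq> V\<close> set_update_subset_insert[of xs i b] by (auto simp: in_lists_conv_set)
      ultimately show "Q (xs[i := b])" using less by simp
    qed (use less.prems i in auto)
    then show ?thesis by simp
  qed
qed

text \<open>An arbitrary but fixed enumeration. The signs that depend on this choice occur later
  only through their squares.\<close>

definition list_of :: "'a set \<Rightarrow> 'a list" where
  "list_of S = (SOME xs. set xs = S \<and> distinct xs)"

lemma list_of:
  assumes "finite S"
  shows "set (list_of S) = S" "distinct (list_of S)" "length (list_of S) = card S"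
proof -
  have "set (list_of S) = S \<and> distinct (list_of S)"
    unfolding list_of_def by (rule someI_ex) (use finite_distinct_list[OF assms] in auto)
  then show "set (list_of S) = S" "distinct (list_of S)" "length (list_of S) = card S"
    using distinct_card[of "list_of S"] by auto
qed

section \<open>Determinants of lists of functions on a finite index type\<close>

definition list_det :: "('n::finite \<Rightarrow> 'a::comm_ring_1) list \<Rightarrow> 'a" where
  "list_det gs = det (Matrix.mat CARD('n) CARD('n) (\<lambda>(r, c). (gs ! r) (list_of UNIV ! c)))"

lemma list_det_leibniz:
  fixes gs :: "('n::finite \<Rightarrow> 'a::comm_ring_1) list"
  shows "list_det gs = (\<Sum>p | p permutes {0..<CARD('n)}.
    signof p * (\<Prod>r = 0..<CARD('n). (gs ! r) (list_of UNIV ! p r)))"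
proof -
  have "(\<Prod>r = 0..<CARD('n). Matrix.mat CARD('n) CARD('n) (\<lambda>(r, c). (gs ! r) (list_of UNIV ! c)) $$ (r, p r))
      = (\<Prod>r = 0..<CARD('n). (gs ! r) (list_of UNIV ! p r))"
    if "p permutes {0..<CARD('n)}" for p
    by (rule prod.cong) (use that in \<open>auto simp: permutes_in_image[of _ "{0..<CARD('n)}", simplified]\<close>)
  then show ?thesis
    unfolding list_det_def by (subst det_def'[of _ "CARD('n)"]) (auto intro!: sum.cong)
qed

text \<open>The Leibniz formula with the factor of row i isolated. The right-hand side is visibly
  linear in x, which yields all rules for modifying one row.\<close>

lemma list_det_update:
  fixes gs :: "('n::finite \<Rightarrow> 'a::comm_ring_1) list"
  assumes "length gs = CARD('n)" "i < CARD('n)"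
  shows "list_det (gs[i := x]) = (\<Sum>p | p permutes {0..<CARD('n)}.
    signof p * (x (list_of UNIV ! p i) * (\<Prod>r \<in> {0..<CARD('n)} - {i}. (gs ! r) (list_of UNIV ! p r))))"
  unfolding list_det_leibniz
proof (intro sum.cong refl)
  fix p
  have "(\<Prod>r = 0..<CARD('n). (gs[i := x] ! r) (list_of UNIV ! p r))
      = (gs[i := x] ! i) (list_of UNIV ! p i)
        * (\<Prod>r \<in> {0..<CARD('n)} - {i}. (gs[i := x] ! r) (list_of UNIV ! p r))"
    using assms by (intro prod.remove) auto
  also have "(\<Prod>r \<in> {0..<CARD('n)} - {i}. (gs[i := x] ! r) (list_of UNIV ! p r))
      = (\<Prod>r \<in> {0..<CARD('n)} - {i}. (gs ! r) (list_of UNIV ! p r))"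
    by (rule prod.cong) auto
  finally show "signof p * (\<Prod>r = 0..<CARD('n). (gs[i := x] ! r) (list_of UNIV ! p r)) =
    signof p * (x (list_of UNIV ! p i) * (\<Prod>r \<in> {0..<CARD('n)} - {i}. (gs ! r) (list_of UNIV ! p r)))"
    using assms by simp
qed

lemma list_det_add:
  fixes gs :: "('n::finite \<Rightarrow> 'a::comm_ring_1) list"
  assumes "length gs = CARD('n)" "i < CARD('n)"
  shows "list_det (gs[i := \<lambda>j. x j + y j]) = list_det (gs[i := x]) + list_det (gs[i := y])"
  by (simp add: list_det_update[OF assms] algebra_simps sum.distrib)

lemma list_det_scale:
  fixes gs :: "('n::finite \<Rightarrow> 'a::comm_ring_1) list"
  assumes "length gs = CARD('n)" "i < CARD('n)"
  shows "list_det (gs[i := \<lambda>j. a * x j]) = a * list_det (gs[i := x])"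
  by (simp add: list_det_update[OF assms] algebra_simps sum_distrib_left)

lemma list_det_sum:
  fixes gs :: "('n::finite \<Rightarrow> 'a::comm_ring_1) list"
  assumes "length gs = CARD('n)" "i < CARD('n)"
  shows "list_det (gs[i := \<lambda>j. \<Sum>t\<in>F. x t j]) = (\<Sum>t\<in>F. list_det (gs[i := x t]))"
  unfolding list_det_update[OF assms] sum_distrib_right sum_distrib_left by (rule sum.swap)

text \<open>The product rule on each Leibniz term: every summand differentiates one factor, hence
  one row, and the signs are constants for H.\<close>

lemma list_det_derivation:
  fixes gs :: "('n::finite \<Rightarrow> 'a::comm_ring_1) list"
  assumes len: "length gs = CARD('n)"
    and add: "\<And>a b. H (a + b) = H a + H b" and mult: "\<And>a b. H (a * b) = H a * b + a * H b"
  shows "H (list_det gs) = (\<Sum>r<CARD('n). list_det (gs[r := \<lambda>j. H ((gs ! r) j)]))"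
proof -
  have H0: "H 0 = 0" using add[of 0 0] by simp
  have H1: "H 1 = 0" using mult[of 1 1] by simp
  have Hneg: "H (- a) = - H a" for a using add[of a "- a"] H0 by (simp add: eq_neg_iff_add_eq_0 add.commute)
  have Hsum: "H (sum f F) = (\<Sum>t\<in>F. H (f t))" for f :: "(nat \<Rightarrow> nat) \<Rightarrow> 'a" and F
    by (induction F rule: infinite_finite_induct) (auto simp: H0 add)
  have Hprod: "H (prod f F) = (\<Sum>t\<in>F. H (f t) * prod f (F - {t}))" if "finite F" for f and F :: "nat set"
    using that
  proof (induction F)
    case (insert x F)
    have "H (prod f (insert x F)) = H (f x) * prod f F + f x * (\<Sum>t\<in>F. H (f t) * prod f (F - {t}))"
      using insert by (simp add: mult)
    also have "f x * (\<Sum>t\<in>F. H (f t) * prod f (F - {t}))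
      = (\<Sum>t\<in>F. H (f t) * prod f (insert x F - {t}))"
      unfolding sum_distrib_left
    proof (intro sum.cong refl)
      fix t assume "t \<in> F"
      then have "insert x F - {t} = insert x (F - {t})" using insert by auto
      then show "f x * (H (f t) * prod f (F - {t})) = H (f t) * prod f (insert x F - {t})"
        using insert by (simp add: algebra_simps)
    qed
    finally show ?case using insert by simp
  qed (simp add: H1)
  have Hsign: "H (signof p * a) = signof p * H a" for p :: "nat \<Rightarrow> nat" and a
    by (auto simp: sign_def Hneg)
  have "H (list_det gs) = (\<Sum>p | p permutes {0..<CARD('n)}. signof p *
      (\<Sum>r<CARD('n). H ((gs ! r) (list_of UNIV ! p r)) *
        (\<Prod>s\<in>{0..<CARD('n)} - {r}. (gs ! s) (list_of UNIV ! p s))))"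
    unfolding list_det_leibniz Hsum Hsign by (simp add: Hprod atLeast0LessThan)
  also have "\<dots> = (\<Sum>r<CARD('n). \<Sum>p | p permutes {0..<CARD('n)}. signof p *
      (H ((gs ! r) (list_of UNIV ! p r)) *
        (\<Prod>s\<in>{0..<CARD('n)} - {r}. (gs ! s) (list_of UNIV ! p s))))"
    unfolding sum_distrib_left by (rule sum.swap)
  also have "\<dots> = (\<Sum>r<CARD('n). list_det (gs[r := \<lambda>j. H ((gs ! r) j)]))"
    by (intro sum.cong refl) (simp add: list_det_update[OF len])
  finally show ?thesis .
qed

lemma list_det_eq_0:
  fixes gs :: "('n::finite \<Rightarrow> 'a::comm_ring_1) list"
  assumes "i \<noteq> j" "i < CARD('n)" "j < CARD('n)" "gs ! i = gs ! j"
  shows "list_det gs = 0"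
  unfolding list_det_def
  by (rule det_identical_rows[OF _ assms(1-3)]) (use assms in \<open>auto intro!: eq_vecI\<close>)

lemma list_det_swap:
  fixes gs :: "('n::finite \<Rightarrow> 'a::comm_ring_1) list"
  assumes "length gs = CARD('n)" "i < CARD('n)" "j < CARD('n)" "i \<noteq> j"
  shows "list_det (gs[i := gs ! j, j := gs ! i]) = - list_det gs"
proof -
  let ?A = "Matrix.mat CARD('n) CARD('n) (\<lambda>(r, c). (gs ! r) (list_of UNIV ! c))"
  have "swaprows i j ?A
      = Matrix.mat CARD('n) CARD('n) (\<lambda>(r, c). (gs[i := gs ! j, j := gs ! i] ! r) (list_of UNIV ! c))"
    using assms by (intro eq_matI) (auto simp: nth_list_update)
  then show ?thesis
    unfolding list_det_def using det_swaprows[OF assms(2-4), of ?A] by simp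
qed

text \<open>The new row x climbs to the front by r transpositions of adjacent rows, each of which
  changes the sign.\<close>

lemma list_det_front:
  fixes gs :: "('n::finite \<Rightarrow> 'a::comm_ring_1) list"
  assumes "length gs = CARD('n)" "r < CARD('n)"
  shows "list_det (gs[r := x]) = (-1) ^ r * list_det (x # nths gs (- {r}))"
  using assms
proof (induction r arbitrary: gs)
  case 0
  then show ?case by (cases gs) auto
next
  case (Suc r)
  let ?g = "gs[Suc r := x]"
  let ?h = "?g[r := ?g ! Suc r, Suc r := ?g ! r]"
  have "list_det (gs[Suc r := x]) = - list_det ?h"
    using list_det_swap[of ?g r "Suc r"] Suc.prems by simp
  also have "?h = (gs[Suc r := gs ! r])[r := x]"
    using Suc.prems by (auto simp: list_update_swap)
  also have "list_det \<dots> = (-1) ^ r * list_det (x # nths (gs[Suc r := gs ! r]) (- {r}))"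
    using Suc.IH[of "gs[Suc r := gs ! r]"] Suc.prems by simp
  \<comment> \<open>The swap has put the old row r at position Suc r, so deleting position r now
    leaves the same rows as deleting Suc r before.\<close>
  also have "nths (gs[Suc r := gs ! r]) (- {r}) = nths gs (- {Suc r})"
    using Suc.prems
    by (intro nth_equalityI)
      (auto simp: length_nths_delete nth_nths_delete nth_list_update not_less less_Suc_eq)
  finally show ?case by simp
qed

lemma list_det_move:
  fixes xs ys :: "('n::finite \<Rightarrow> 'a::comm_ring_1) list"
  assumes "length xs + length ys + 1 = CARD('n)"
  shows "list_det (xs @ x # ys) = (-1) ^ length xs * list_det (x # xs @ ys)"
  using list_det_front[of "xs @ x # ys" "length xs" x] assms
  by (simp add: nths_delete_conv)

text \<open>Laplace expansion along the first of two equal columns.\<close>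

lemma list_det_relation:
  fixes cs :: "('n::finite \<Rightarrow> 'a::comm_ring_1) list"
  assumes "length cs = Suc CARD('n)"
  shows "(\<Sum>p<Suc CARD('n). (-1) ^ p * (cs ! p) i * list_det (nths cs (- {p}))) = 0"
proof -
  let ?n = "CARD('n)"
  let ?N = "Matrix.mat (Suc ?n) (Suc ?n)
    (\<lambda>(r, c). (cs ! r) (if c = 0 then i else (list_of UNIV :: 'n list) ! (c - 1)))"
  have "i \<in> set (list_of UNIV)" by (simp add: list_of)
  then obtain c where c: "c < ?n" "(list_of UNIV :: 'n list) ! c = i"
    by (metis in_set_conv_nth list_of(3) finite)
  have "det ?N = 0"
  proof (rule det_identical_columns)
    show "?N \<in> carrier_mat (Suc ?n) (Suc ?n)" by simp
    show "0 \<noteq> Suc c" "0 < Suc ?n" "Suc c < Suc ?n" using c by auto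
    show "col ?N 0 = col ?N (Suc c)" using c by (intro eq_vecI) auto
  qed
  moreover have "det ?N = (\<Sum>p<Suc ?n. ?N $$ (p, 0) * cofactor ?N p 0)"
    by (rule laplace_expansion_column) auto
  moreover have "?N $$ (p, 0) * cofactor ?N p 0 = (-1) ^ p * (cs ! p) i * list_det (nths cs (- {p}))"
    if "p < Suc ?n" for p
  proof -
    have "mat_delete ?N p 0 = Matrix.mat ?n ?n (\<lambda>(r, c). (nths cs (- {p}) ! r) (list_of UNIV ! c))"
      using that assms by (intro eq_matI) (auto simp: mat_delete_def nth_nths_delete)
    then show ?thesis using that by (simp add: cofactor_def list_det_def mult_ac)
  qed
  ultimately show ?thesis by simp
qed

text \<open>This is the linear part in t of det (1 + tB) det g. By linearity in B the coefficient of
  each entry \<open>B l i\<close> can be treated separately, and Cramer's rule shows that only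
  diagonal entries contribute.\<close>

lemma list_det_trace:
  fixes gs :: "('n::finite \<Rightarrow> 'a::comm_ring_1) list"
  assumes "length gs = CARD('n)"
  shows "(\<Sum>r<CARD('n). list_det (gs[r := \<lambda>j. \<Sum>i\<in>UNIV. B j i * (gs ! r) i]))
    = (\<Sum>i\<in>UNIV. B i i) * list_det gs"
proof -
  define e :: "'n \<Rightarrow> 'n \<Rightarrow> 'a" where "e l = (\<lambda>j. if j = l then 1 else 0)" for l
  \<comment> \<open>Cramer's rule, obtained from \<open>list_det_relation\<close> for the n + 1
    vectors \<open>e l # gs\<close> in coordinate i: the first term is
    \<open>e l i * list_det gs\<close>, and in the others \<open>e l\<close> is moved from the front
    back to position r.\<close>
  have *: "(\<Sum>r<CARD('n). (gs ! r) i * list_det (gs[r := e l])) = (if i = l then list_det gs else 0)" for i l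
  proof -
    have "0 = (\<Sum>p<Suc CARD('n). (-1) ^ p * ((e l # gs) ! p) i * list_det (nths (e l # gs) (- {p})))"
      by (subst list_det_relation) (use assms in auto)
    also have "\<dots> = e l i * list_det gs
        - (\<Sum>r<CARD('n). (gs ! r) i * ((-1) ^ r * list_det (e l # nths gs (- {r}))))"
      by (subst sum.lessThan_Suc_shift) (simp add: sum_negf mult_ac)
    also have "(\<Sum>r<CARD('n). (gs ! r) i * ((-1) ^ r * list_det (e l # nths gs (- {r}))))
        = (\<Sum>r<CARD('n). (gs ! r) i * list_det (gs[r := e l]))"
      by (intro sum.cong refl) (simp add: list_det_front assms)
    finally show ?thesis by (auto simp: e_def)
  qed
  have "(\<lambda>j. \<Sum>i\<in>UNIV. B j i * (gs ! r) i) = (\<lambda>j. \<Sum>l\<in>UNIV. (\<Sum>i\<in>UNIV. B l i * (gs ! r) i) * e l j)" for r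
    by (auto simp: e_def if_distrib sum.delta cong: if_cong)
  then have "list_det (gs[r := \<lambda>j. \<Sum>i\<in>UNIV. B j i * (gs ! r) i])
      = (\<Sum>l\<in>UNIV. \<Sum>i\<in>UNIV. B l i * ((gs ! r) i * list_det (gs[r := e l])))" if "r < CARD('n)" for r
    using that assms by (simp only: list_det_sum list_det_scale sum_distrib_right mult.assoc)
  then have "(\<Sum>r<CARD('n). list_det (gs[r := \<lambda>j. \<Sum>i\<in>UNIV. B j i * (gs ! r) i]))
      = (\<Sum>r<CARD('n). \<Sum>l\<in>UNIV. \<Sum>i\<in>UNIV. B l i * ((gs ! r) i * list_det (gs[r := e l])))"
    by (intro sum.cong) auto
  also have "\<dots> = (\<Sum>l\<in>UNIV. \<Sum>i\<in>UNIV. B l i * (\<Sum>r<CARD('n). (gs ! r) i * list_det (gs[r := e l])))"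
    unfolding sum_distrib_left
    by (subst sum.swap, intro sum.cong refl, rule sum.swap)
  also have "\<dots> = (\<Sum>i\<in>UNIV. B i i) * list_det gs"
    unfolding * by (simp add: if_distrib sum.delta sum_distrib_right cong: if_cong)
  finally show ?thesis .
qed

text \<open>The determinant is the sign of the permutation from the chosen enumeration to vs.
  Squaring removes the dependence on that enumeration.\<close>

lemma list_det_unit_square:
  fixes vs :: "'n::finite list"
  assumes "distinct vs" "set vs = UNIV"
  shows "list_det (map (\<lambda>i j. if i = j then 1 else 0) vs) * list_det (map (\<lambda>i j. if i = j then 1 else 0) vs)
    = (1::'a::comm_ring_1)"
proof -
  let ?e = "\<lambda>i j :: 'n. if i = j then 1 else (0::'a)"
  have "mset vs = mset (list_of UNIV)"
    using assms by (simp add: list_of flip: set_eq_iff_mset_eq_distinct)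
  then show ?thesis
  proof (rule swap_closed_mset[where Q = "\<lambda>vs. list_det (map ?e vs) * list_det (map ?e vs) = 1"])
    have "Matrix.mat CARD('n) CARD('n) (\<lambda>(r, c). (map ?e (list_of UNIV) ! r) (list_of UNIV ! c)) = 1\<^sub>m CARD('n)"
      by (intro eq_matI) (auto simp: list_of nth_eq_iff_index_eq)
    then show "list_det (map ?e (list_of UNIV)) * list_det (map ?e (list_of UNIV)) = 1"
      by (simp add: list_det_def)
  next
    fix zs :: "'n list" and i j
    assume *: "length zs = length (list_of (UNIV :: 'n set))" "i < j" "j < length zs"
    then have "list_det (map ?e (zs[i := zs ! j, j := zs ! i])) = - list_det (map ?e zs)"
      using list_det_swap[of "map ?e zs" i j] by (simp add: map_update list_of)
    then show "list_det (map ?e zs) * list_det (map ?e zs) = 1 \<Longrightarrow>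
      list_det (map ?e (zs[i := zs ! j, j := zs ! i])) * list_det (map ?e (zs[i := zs ! j, j := zs ! i])) = 1"
      by simp
  qed
qed

section \<open>Derivations and Jacobians of polynomials\<close>

lemma lookup_pm_scale [simp]: "Poly_Mapping.lookup (pm_scale c f) x = c * Poly_Mapping.lookup f x"
  by (simp add: pm_scale_def Poly_Mapping.map.rep_eq when_def)

interpretation pm: Modules.module "pm_scale :: 'k::comm_ring_1 \<Rightarrow> ('x \<Rightarrow>\<^sub>0 'k) \<Rightarrow> _"
  by unfold_locales (auto intro!: poly_mapping_eqI simp: lookup_add algebra_simps)

lemma pm_scale_single [simp]: "pm_scale c (Poly_Mapping.single x a) = Poly_Mapping.single x (c * a)"
  by (intro poly_mapping_eqI) (simp add: lookup_single when_def)

lemma keys_pm_scale: "Poly_Mapping.keys (pm_scale c f) \<subseteq> Poly_Mapping.keys f"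
  by (auto simp: in_keys_iff)

lemma poly_mapping_additive_induct:
  fixes f :: "'x \<Rightarrow>\<^sub>0 'k::comm_monoid_add"
  assumes "P 0" "\<And>x a. x \<in> Poly_Mapping.keys f \<Longrightarrow> P (Poly_Mapping.single x a)"
    "\<And>g h. P g \<Longrightarrow> P h \<Longrightarrow> P (g + h)"
  shows "P f"
proof -
  have "P (\<Sum>x\<in>F. Poly_Mapping.single x (Poly_Mapping.lookup f x))" if "F \<subseteq> Poly_Mapping.keys f" for F
    using finite_subset[OF that finite_keys] that by (induction F) (auto intro: assms)
  moreover have "f = (\<Sum>x\<in>Poly_Mapping.keys f. Poly_Mapping.single x (Poly_Mapping.lookup f x))"
    by (rule poly_mapping_eqI) (auto simp: lookup_sum lookup_single when_def in_keys_iff)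
  ultimately show ?thesis by (metis order_refl)
qed

lemma pm_scale_mult_left: "pm_scale c (f * g) = pm_scale c f * (g :: 'n cpoly)"
  by (simp add: pm_scale_def mult_map_scale_conv_mult mult.assoc)

lemma pm_scale_mult_right: "pm_scale c (f * g) = f * pm_scale c (g :: 'n cpoly)"
  by (metis pm_scale_mult_left mult.commute)

lemma pm_scale_conv_mult: "pm_scale c f = pm_scale c 1 * (f :: 'n cpoly)"
  by (metis pm_scale_mult_left mult_1)

text \<open>The variables generate the polynomials as an algebra. In contrast to an induction over
  monomials, the cases match the rules that a derivation obeys.\<close>

lemma cpoly_induct [case_names add mult scale one var]:
  fixes f :: "'n cpoly"
  assumes add: "\<And>g h. P g \<Longrightarrow> P h \<Longrightarrow> P (g + h)"
    and mult: "\<And>g h. P g \<Longrightarrow> P h \<Longrightarrow> P (g * h)"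
    and scale: "\<And>c g. P g \<Longrightarrow> P (pm_scale c g)"
    and one: "P 1"
    and var: "\<And>i. P (pvar i)"
  shows "P f"
proof (induction f rule: poly_mapping_additive_induct)
  case 1
  show ?case using scale[OF one, of 0] by simp
next
  case (2 x a)
  have "P (Poly_Mapping.single x 1)"
  proof (induction x rule: poly_mapping_additive_induct)
    case 1
    then show ?case using one by simp
  next
    case (2 i m)
    show ?case
    proof (induction m)
      case 0
      then show ?case using one by simp
    next
      case (Suc m)
      have "Poly_Mapping.single (Poly_Mapping.single i (Suc m)) 1
        = pvar i * Poly_Mapping.single (Poly_Mapping.single i m) (1::complex)"
        by (simp add: pvar_def mult_single flip: single_add)
      then show ?case using mult[OF var Suc] by metis
    qed
  next
    case (3 g h)
    have "Poly_Mapping.single (g + h) 1 = Poly_Mapping.single g 1 * Poly_Mapping.single h (1::complex)"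
      by (simp add: mult_single)
    then show ?case using mult[OF 3] by metis
  qed
  from scale[OF this, of a] show ?case by simp
qed (rule add)

section \<open>Derivations and partial derivatives\<close>

definition is_derivation :: "('n cpoly \<Rightarrow> 'n cpoly) \<Rightarrow> bool" where
  "is_derivation D \<longleftrightarrow> (\<forall>f g. D (f + g) = D f + D g) \<and> (\<forall>c f. D (pm_scale c f) = pm_scale c (D f))
    \<and> (\<forall>f g. D (f * g) = D f * g + f * D g)"

lemma is_derivationD:
  assumes "is_derivation D"
  shows "D (f + g) = D f + D g" "D (pm_scale c f) = pm_scale c (D f)"
    "D (f * g) = D f * g + f * D g" "D 0 = 0" "D 1 = 0" "D (- f) = - D f" "D (f - g) = D f - D g"
    "D (sum h F) = (\<Sum>x\<in>F. D (h x))"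
proof -
  show *: "D (f + g) = D f + D g" for f g using assms by (simp add: is_derivation_def)
  show "D (pm_scale c f) = pm_scale c (D f)" using assms by (simp add: is_derivation_def)
  show **: "D (f * g) = D f * g + f * D g" for f g using assms by (simp add: is_derivation_def)
  show 0: "D 0 = 0" using *[of 0 0] by simp
  show "D 1 = 0" using **[of 1 1] by simp
  show ***: "D (- f) = - D f" for f using *[of f "- f"] 0 by (simp add: eq_neg_iff_add_eq_0 add.commute)
  show "D (f - g) = D f - D g" using *[of f "- g"] by (simp add: ***)
  show "D (sum h F) = (\<Sum>x\<in>F. D (h x))"
    by (induction F rule: infinite_finite_induct) (auto simp: * 0)
qed

text \<open>The subtraction of exponents is truncated at zero. This does no harm: if j does not
  occur in a monomial, the coefficient is zero as well.\<close>

definition pderiv_var :: "'n \<Rightarrow> 'n cpoly \<Rightarrow> 'n cpoly" where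
  "pderiv_var j f = (\<Sum>\<alpha>\<in>Poly_Mapping.keys f.
     Poly_Mapping.single (\<alpha> - Poly_Mapping.single j 1) (of_nat (Poly_Mapping.lookup \<alpha> j) * Poly_Mapping.lookup f \<alpha>))"

lemma pderiv_var_superset:
  assumes "finite F" "Poly_Mapping.keys f \<subseteq> F"
  shows "pderiv_var j f = (\<Sum>\<alpha>\<in>F.
    Poly_Mapping.single (\<alpha> - Poly_Mapping.single j 1) (of_nat (Poly_Mapping.lookup \<alpha> j) * Poly_Mapping.lookup f \<alpha>))"
  unfolding pderiv_var_def using assms by (intro sum.mono_neutral_left) (auto simp: in_keys_iff)

lemma pderiv_var_add: "pderiv_var j (f + g) = pderiv_var j f + pderiv_var j g"
proof -
  let ?F = "Poly_Mapping.keys f \<union> Poly_Mapping.keys g"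
  have "Poly_Mapping.keys (f + g) \<subseteq> ?F" by (rule keys_add)
  then show ?thesis
    by (simp add: pderiv_var_superset[of ?F] lookup_add distrib_left single_add sum.distrib)
qed

lemma pderiv_var_single:
  "pderiv_var j (Poly_Mapping.single \<alpha> c)
    = Poly_Mapping.single (\<alpha> - Poly_Mapping.single j 1) (of_nat (Poly_Mapping.lookup \<alpha> j) * c)"
  by (subst pderiv_var_superset[of "{\<alpha>}"]) auto

lemma pderiv_var_zero: "pderiv_var j 0 = 0"
  by (simp add: pderiv_var_def)

lemma pderiv_var_scale: "pderiv_var j (pm_scale c f) = pm_scale c (pderiv_var j f)"
  by (induction f rule: poly_mapping_additive_induct)
    (auto simp: pderiv_var_add pderiv_var_single pderiv_var_zero pm.scale_right_distrib mult_ac)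

lemma pderiv_var_mult: "pderiv_var j (f * g) = pderiv_var j f * g + f * pderiv_var j g"
proof (induction f rule: poly_mapping_additive_induct)
  case (2 \<alpha> a)
  show ?case
  proof (induction g rule: poly_mapping_additive_induct)
    case (2 \<beta> b)
    \<comment> \<open>Truncated subtraction fails to commute with adding \<delta> only if the
      exponent of j in \<gamma> is zero, and then both monomials have coefficient zero.\<close>
    have *: "Poly_Mapping.single (\<gamma> - Poly_Mapping.single j 1 + \<delta>) (of_nat (Poly_Mapping.lookup \<gamma> j) * c)
       = Poly_Mapping.single (\<gamma> + \<delta> - Poly_Mapping.single j 1) (of_nat (Poly_Mapping.lookup \<gamma> j) * c)"
      for \<gamma> \<delta> :: "'a \<Rightarrow>\<^sub>0 nat" and c :: complex
    proof (cases "Poly_Mapping.lookup \<gamma> j = 0")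
      case False
      then have "\<gamma> - Poly_Mapping.single j 1 + \<delta> = \<gamma> + \<delta> - Poly_Mapping.single j 1"
        by (intro poly_mapping_eqI) (auto simp: lookup_add lookup_minus lookup_single when_def)
      then show ?thesis by simp
    qed simp
    from *[of \<alpha> \<beta> "a * b"] *[of \<beta> \<alpha> "a * b"] show ?case
      by (simp add: pderiv_var_single mult_single lookup_add ring_distribs single_add mult_ac add_ac)
  qed (simp_all add: pderiv_var_add pderiv_var_zero algebra_simps)
qed (simp_all add: pderiv_var_add pderiv_var_zero algebra_simps)

lemma is_derivation_pderiv_var: "is_derivation (pderiv_var j)"
  by (simp add: is_derivation_def pderiv_var_add pderiv_var_scale pderiv_var_mult)

lemma pderiv_var_pvar: "pderiv_var j (pvar i) = (if i = j then 1 else 0)"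
  by (auto simp: pvar_def pderiv_var_single lookup_single when_def)

text \<open>Both sides are derivations in f and agree on the variables.\<close>

lemma derivation_expand:
  fixes D :: "'n::finite cpoly \<Rightarrow> 'n cpoly"
  assumes "is_derivation D"
  shows "D f = (\<Sum>j\<in>UNIV. pderiv_var j f * D (pvar j))"
proof (induction f rule: cpoly_induct)
  case (add g h)
  then show ?case
    by (simp add: is_derivationD[OF assms] pderiv_var_add distrib_right sum.distrib)
next
  case (mult g h)
  then show ?case
    by (simp add: is_derivationD[OF assms] pderiv_var_mult sum.distrib
      sum_distrib_left sum_distrib_right algebra_simps)
next
  case (scale c g)
  then show ?case
    by (simp add: is_derivationD[OF assms] pderiv_var_scale pm.scale_sum_right pm_scale_mult_left)
next
  case one
  then show ?case by (simp add: is_derivationD[OF assms] is_derivationD[OF is_derivation_pderiv_var])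
next
  case (var i)
  then show ?case by (simp add: pderiv_var_pvar if_distrib if_distribR cong: if_cong)
qed

lemma pderiv_var_commute: "pderiv_var i (pderiv_var j f) = pderiv_var j (pderiv_var i f)"
  by (induction f rule: cpoly_induct)
    (auto simp: pderiv_var_add pderiv_var_mult pderiv_var_scale pderiv_var_pvar
      is_derivationD(4,5)[OF is_derivation_pderiv_var])

section \<open>Jacobian determinants\<close>

definition gradient :: "'n cpoly \<Rightarrow> 'n \<Rightarrow> 'n cpoly" where
  "gradient f j = pderiv_var j f"

definition jacobian :: "'n::finite cpoly list \<Rightarrow> 'n cpoly" where
  "jacobian cs = list_det (map gradient cs)"

lemma jacobian_update_add:
  fixes cs :: "'n::finite cpoly list"
  assumes "length cs = CARD('n)" "r < CARD('n)"
  shows "jacobian (cs[r := a + b]) = jacobian (cs[r := a]) + jacobian (cs[r := b])"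
proof -
  have "gradient (a + b) = (\<lambda>j. gradient a j + gradient b j)"
    by (auto simp: gradient_def pderiv_var_add)
  then show ?thesis using assms list_det_add[of "map gradient cs" r] by (simp add: jacobian_def map_update)
qed

lemma jacobian_update_mult:
  fixes cs :: "'n::finite cpoly list"
  assumes "length cs = CARD('n)" "r < CARD('n)"
  shows "jacobian (cs[r := a * b]) = a * jacobian (cs[r := b]) + b * jacobian (cs[r := a])"
proof -
  have "gradient (a * b) = (\<lambda>j. a * gradient b j + b * gradient a j)"
    by (auto simp: gradient_def pderiv_var_mult)
  then show ?thesis
    using assms by (simp add: jacobian_def map_update list_det_add list_det_scale)
qed

lemma jacobian_update_scale:
  fixes cs :: "'n::finite cpoly list"
  assumes "length cs = CARD('n)" "r < CARD('n)"
  shows "jacobian (cs[r := pm_scale c a]) = pm_scale c (jacobian (cs[r := a]))"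
proof -
  have "gradient (pm_scale c a) = (\<lambda>j. pm_scale c 1 * gradient a j)"
    by (simp add: gradient_def fun_eq_iff pderiv_var_scale flip: pm_scale_conv_mult)
  then have "jacobian (cs[r := pm_scale c a]) = pm_scale c 1 * jacobian (cs[r := a])"
    using assms by (simp only: jacobian_def map_update list_det_scale length_map)
  then show ?thesis by (simp flip: pm_scale_conv_mult)
qed

lemma jacobian_swap:
  fixes cs :: "'n::finite cpoly list"
  assumes "length cs = CARD('n)" "i < CARD('n)" "j < CARD('n)" "i \<noteq> j"
  shows "jacobian (cs[i := cs ! j, j := cs ! i]) = - jacobian cs"
  using assms list_det_swap[of "map gradient cs" i j] by (simp add: jacobian_def map_update)

lemma jacobian_front:
  fixes cs :: "'n::finite cpoly list"
  assumes "length cs = CARD('n)" "r < CARD('n)"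
  shows "jacobian (cs[r := x]) = (-1) ^ r * jacobian (x # nths cs (- {r}))"
  using assms list_det_front[of "map gradient cs" r] by (simp add: jacobian_def map_update nths_map)

lemma jacobian_move:
  fixes xs ys :: "'n::finite cpoly list"
  assumes "length xs + length ys + 1 = CARD('n)"
  shows "jacobian (xs @ x # ys) = (-1) ^ length xs * jacobian (x # xs @ ys)"
  using assms list_det_move[of "map gradient xs" "map gradient ys"] by (simp add: jacobian_def)

lemma jacobian_vars_square:
  fixes vs :: "'n::finite list"
  assumes "distinct vs" "set vs = UNIV"
  shows "jacobian (map pvar vs) * jacobian (map pvar vs) = 1"
proof -
  have "gradient (pvar i) = (\<lambda>j. if i = j then 1 else 0)" for i :: 'n
    by (auto simp: gradient_def pderiv_var_pvar)
  then show ?thesis using list_det_unit_square[OF assms] by (simp add: jacobian_def comp_def)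
qed

lemma jacobian_not_distinct:
  fixes cs :: "'n::finite cpoly list"
  assumes "length cs = CARD('n)" "\<not> distinct cs"
  shows "jacobian cs = 0"
proof -
  obtain i j where "i \<noteq> j" "i < CARD('n)" "j < CARD('n)" "cs ! i = cs ! j"
    using assms by (auto simp: distinct_conv_nth)
  then show ?thesis unfolding jacobian_def by (intro list_det_eq_0[of i j]) (use assms in auto)
qed

lemma jacobian_relation_pderiv:
  fixes cs :: "'n::finite cpoly list"
  assumes "length cs = Suc CARD('n)"
  shows "(\<Sum>p<Suc CARD('n). (-1) ^ p * pderiv_var i (cs ! p) * jacobian (nths cs (- {p}))) = 0"
  using list_det_relation[of "map gradient cs" i] assms
  by (simp add: jacobian_def nths_map gradient_def nth_append del: sum.lessThan_Suc cong: sum.cong_simp)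

text \<open>By \<open>derivation_expand\<close> it is a combination of the cases D = \<partial>_i,
  where the sum is a determinant of size n + 1 with a repeated column.\<close>

lemma jacobian_relation:
  fixes cs :: "'n::finite cpoly list"
  assumes "length cs = Suc CARD('n)" "is_derivation D"
  shows "(\<Sum>p<Suc CARD('n). (-1) ^ p * D (cs ! p) * jacobian (nths cs (- {p}))) = 0"
proof -
  have "(\<Sum>p<Suc CARD('n). (-1) ^ p * D (cs ! p) * jacobian (nths cs (- {p})))
    = (\<Sum>p<Suc CARD('n). \<Sum>i\<in>UNIV. D (pvar i) *
        ((-1) ^ p * pderiv_var i (cs ! p) * jacobian (nths cs (- {p}))))"
    by (subst derivation_expand[OF assms(2)])
      (simp add: sum_distrib_left sum_distrib_right mult_ac del: sum.lessThan_Suc)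
  also have "\<dots> = (\<Sum>i\<in>UNIV. D (pvar i) *
      (\<Sum>p<Suc CARD('n). (-1) ^ p * pderiv_var i (cs ! p) * jacobian (nths cs (- {p}))))"
    unfolding sum_distrib_left by (rule sum.swap)
  finally show ?thesis using assms by (simp add: jacobian_relation_pderiv del: sum.lessThan_Suc)
qed

text \<open>The divergence of a vector field with respect to the constant volume form.\<close>

definition divergence :: "('n::finite cpoly \<Rightarrow> 'n cpoly) \<Rightarrow> 'n cpoly" where
  "divergence D = (\<Sum>j\<in>UNIV. pderiv_var j (D (pvar j)))"

text \<open>The Lie derivative of the volume form in coordinates. Differentiating row r gives D of a
  gradient; exchanging D with the partial derivatives yields the gradient of
  \<open>D (cs ! r)\<close> and a correction by a fixed matrix, which contributes its trace.\<close>

lemma jacobian_derivation: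
  fixes cs :: "'n::finite cpoly list"
  assumes len: "length cs = CARD('n)" and D: "is_derivation D"
  shows "D (jacobian cs) = (\<Sum>r<CARD('n). jacobian (cs[r := D (cs ! r)])) - divergence D * jacobian cs"
proof -
  \<comment> \<open>The matrix of the commutators of D with the \<partial>_j: the operator D
    \<partial>_j - \<partial>_j D is the sum over i of \<open>B j i\<close> \<partial>_i. Its trace
    is minus the divergence.\<close>
  define B where "B j i = - pderiv_var j (D (pvar i))" for i j :: 'n
  have DB: "D (pderiv_var j f) = gradient (D f) j + (\<Sum>i\<in>UNIV. B j i * gradient f i)" for f j
  proof -
    have "gradient (D f) j = (\<Sum>i\<in>UNIV. pderiv_var i (pderiv_var j f) * D (pvar i))
        + (\<Sum>i\<in>UNIV. pderiv_var i f * pderiv_var j (D (pvar i)))"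
      by (subst derivation_expand[OF D]) (simp add: gradient_def pderiv_var_mult sum.distrib
         is_derivationD(8)[OF is_derivation_pderiv_var] pderiv_var_commute[of j])
    moreover have "(\<Sum>i\<in>UNIV. pderiv_var i (pderiv_var j f) * D (pvar i)) = D (pderiv_var j f)"
      by (rule derivation_expand[OF D, symmetric])
    ultimately show ?thesis by (simp add: B_def gradient_def sum_negf mult_ac)
  qed
  let ?g = "map gradient cs"
  have "D (jacobian cs) = (\<Sum>r<CARD('n). list_det (?g[r := \<lambda>j. D ((?g ! r) j)]))"
    unfolding jacobian_def by (rule list_det_derivation) (use len in \<open>auto simp: is_derivationD[OF D]\<close>)
  also have "\<dots> = (\<Sum>r<CARD('n). list_det (?g[r := \<lambda>j. gradient (D (cs ! r)) j
      + (\<Sum>i\<in>UNIV. B j i * (?g ! r) i)]))"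
    by (rule sum.cong) (use len in \<open>auto simp: DB gradient_def[of "cs ! _"]\<close>)
  also have "\<dots> = (\<Sum>r<CARD('n). list_det (?g[r := gradient (D (cs ! r))]))
      + (\<Sum>r<CARD('n). list_det (?g[r := \<lambda>j. \<Sum>i\<in>UNIV. B j i * (?g ! r) i]))"
    using len by (simp add: list_det_add sum.distrib cong: sum.cong_simp)
  also have "(\<Sum>r<CARD('n). list_det (?g[r := \<lambda>j. \<Sum>i\<in>UNIV. B j i * (?g ! r) i]))
      = - divergence D * jacobian cs"
    by (subst list_det_trace) (use len in \<open>auto simp: B_def divergence_def jacobian_def sum_negf\<close>)
  finally show ?thesis by (simp add: jacobian_def map_update)
qed

section \<open>The duality identity for Jacobians\<close>

text \<open>Division by 2, on which every argument by antisymmetry below relies.\<close>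

lemma cpoly_add_self_eq_0: "f + f = 0 \<Longrightarrow> f = (0 :: 'n cpoly)"
proof (rule poly_mapping_eqI)
  fix x
  assume "f + f = 0"
  then have "Poly_Mapping.lookup f x + Poly_Mapping.lookup f x = 0"
    by (metis lookup_add lookup_zero)
  then show "Poly_Mapping.lookup f x = Poly_Mapping.lookup 0 x" by simp
qed

lemma sum_triangle_swap:
  fixes T :: "nat \<Rightarrow> nat \<Rightarrow> 'a::comm_monoid_add"
  shows "(\<Sum>p\<in>{k..<N}. \<Sum>q\<in>{Suc p..<N}. T p q) = (\<Sum>q\<in>{k..<N}. \<Sum>p\<in>{k..<q}. T p q)"
proof -
  have "(\<Sum>p\<in>{k..<N}. \<Sum>q\<in>{Suc p..<N}. T p q)
      = (\<Sum>p\<in>{k..<N}. \<Sum>q\<in>{k..<N}. if p < q then T p q else 0)"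
    by (intro sum.cong refl sum.mono_neutral_cong_left) auto
  also have "\<dots> = (\<Sum>q\<in>{k..<N}. \<Sum>p\<in>{k..<N}. if p < q then T p q else 0)"
    by (rule sum.swap)
  also have "\<dots> = (\<Sum>q\<in>{k..<N}. \<Sum>p\<in>{k..<q}. T p q)"
    by (intro sum.cong refl sum.mono_neutral_cong_right) auto
  finally show ?thesis .
qed

locale cpoly_bracket =
  fixes br :: "'n::finite cpoly \<Rightarrow> 'n cpoly \<Rightarrow> 'n cpoly"
  assumes br_derivation: "is_derivation (br f)"
    and br_skew: "br f g = - br g f"
begin

lemma br_derivation_left: "is_derivation (\<lambda>f. br f g)"
  unfolding br_skew[of _ g]
  using br_derivation[of g]
  by (auto simp: is_derivation_def algebra_simps)

text \<open>The terms with second derivatives of f pair a symmetric matrix with the skew matrix of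
  the brackets of variables, so they cancel and only first derivatives of f remain.\<close>

lemma divergence_br: "divergence (br f) = (\<Sum>i\<in>UNIV. pderiv_var i f * divergence (br (pvar i)))"
proof -
  let ?H = "\<lambda>i j. pderiv_var j (pderiv_var i f) * br (pvar i) (pvar j)"
  have skew: "?H i j = - ?H j i" for i j
    by (subst br_skew, subst pderiv_var_commute) simp
  have "br f (pvar j) = (\<Sum>i\<in>UNIV. pderiv_var i f * br (pvar i) (pvar j))" for j
    by (rule derivation_expand[OF br_derivation_left])
  then have "divergence (br f) = (\<Sum>j\<in>UNIV. \<Sum>i\<in>UNIV. ?H i j)
      + (\<Sum>j\<in>UNIV. \<Sum>i\<in>UNIV. pderiv_var i f * pderiv_var j (br (pvar i) (pvar j)))"
    by (simp add: divergence_def is_derivationD(8)[OF is_derivation_pderiv_var] pderiv_var_mult sum.distrib)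
  moreover have "(\<Sum>j\<in>UNIV. \<Sum>i\<in>UNIV. ?H i j) = 0"
  proof (rule cpoly_add_self_eq_0)
    have "(\<Sum>j\<in>UNIV. \<Sum>i\<in>UNIV. ?H i j) = - (\<Sum>j\<in>UNIV. \<Sum>i\<in>UNIV. ?H i j)"
      by (subst sum.swap, subst skew) (simp add: sum_negf)
    then show "(\<Sum>j\<in>UNIV. \<Sum>i\<in>UNIV. ?H i j) + (\<Sum>j\<in>UNIV. \<Sum>i\<in>UNIV. ?H i j) = 0"
      by (simp only: eq_neg_iff_add_eq_0)
  qed
  moreover have "(\<Sum>j\<in>UNIV. \<Sum>i\<in>UNIV. pderiv_var i f * pderiv_var j (br (pvar i) (pvar j)))
      = (\<Sum>i\<in>UNIV. pderiv_var i f * divergence (br (pvar i)))"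
    unfolding divergence_def sum_distrib_left by (rule sum.swap)
  ultimately show ?thesis by simp
qed

text \<open>Up to a convention of sign this is the modular derivation of the bracket.\<close>

lemma divergence_derivation: "is_derivation (\<lambda>f. divergence (br f))"
proof -
  define t where "t i = divergence (br (pvar i))" for i
  have "divergence (br f) = (\<Sum>i\<in>UNIV. pderiv_var i f * t i)" for f
    unfolding t_def by (rule divergence_br)
  moreover have "(\<Sum>i\<in>UNIV. pm_scale c (pderiv_var i f) * t i)
      = pm_scale c (\<Sum>i\<in>UNIV. pderiv_var i f * t i)" for c f
    by (simp add: pm.scale_sum_right pm_scale_mult_left)
  ultimately show ?thesis
    by (simp add: is_derivation_def pderiv_var_add pderiv_var_scale pderiv_var_mult
        sum_distrib_left sum_distrib_right sum.distrib ring_distribs mult_ac)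
qed

end

text \<open>The duality sees the module only through this formula. The coefficients a_ij enter at
  the very end, when the divergence of \<open>br (pvar i)\<close> is computed.\<close>

locale unimodular_twist = cpoly_bracket br
  for br :: "'n::finite cpoly \<Rightarrow> 'n cpoly \<Rightarrow> 'n cpoly" +
  fixes mbr :: "'n cpoly \<Rightarrow> 'n cpoly \<Rightarrow> 'n cpoly"
  assumes mbr_eq: "mbr m f = - br f m + divergence (br f) * m"
begin

lemma mbr_derivation: "is_derivation (mbr m)"
proof -
  have eq: "mbr m = (\<lambda>f. - br f m + divergence (br f) * m)" by (auto simp: mbr_eq)
  show ?thesis
    using br_derivation_left[of m] divergence_derivation unfolding eq
    by (simp add: is_derivation_def algebra_simps pm.scale_right_diff_distrib pm_scale_mult_right)
qed

section \<open>Alternating identities for n + 1 polynomials\<close>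

context
  fixes cs :: "'n cpoly list" and v T
  assumes len: "length cs = Suc CARD('n)"
  defines "v \<equiv> \<lambda>p. jacobian (nths cs (- {p}))"
    and "T \<equiv> \<lambda>i j. (-1) ^ (i + j) * jacobian (br (cs ! i) (cs ! j) # nths cs (- {i, j}))"
begin

text \<open>This is \<open>jacobian_derivation\<close> for the derivation {c_p, .}. Moving the
  modified row to the front turns each summand into a term T, up to a sign.\<close>

lemma br_jacobian:
  assumes p: "p < Suc CARD('n)"
  shows "(-1) ^ p * br (cs ! p) (v p) = - (\<Sum>q<p. T q p) - (\<Sum>q\<in>{Suc p..<Suc CARD('n)}. T p q)
    - (-1) ^ p * divergence (br (cs ! p)) * v p"
proof -
  let ?n = "CARD('n)"
  let ?d = "nths cs (- {p})"
  define J where "J r = (-1) ^ p * jacobian (?d[r := br (cs ! p) (?d ! r)])" for r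
  have ld: "length ?d = ?n" using p len by (simp add: length_nths_delete)
  have J: "J r = (-1) ^ p * (-1) ^ r * jacobian (br (cs ! p) (?d ! r) # nths ?d (- {r}))" if "r < ?n" for r
    unfolding J_def using that ld by (simp add: jacobian_front)
  \<comment> \<open>Before position p the indices agree with those of cs. The minus sign comes from
    skewness, since T has the smaller index first in the bracket.\<close>
  have "J r = - T r p" if "r < p" for r
  proof -
    have "r < ?n" using that p by simp
    have "jacobian (br (cs ! p) (cs ! r) # nths cs (- {r, p}))
      = jacobian ((br (cs ! r) (cs ! p) # nths cs (- {r, p}))[0 := pm_scale (-1) (br (cs ! r) (cs ! p))])"
      by (subst br_skew) (simp add: pm.scale_minus_left[of 1, simplified])
    also have "\<dots> = - jacobian (br (cs ! r) (cs ! p) # nths cs (- {r, p}))"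
      by (subst jacobian_update_scale) (use that p len in \<open>auto simp: length_nths_delete2\<close>)
    finally show ?thesis
      using that \<open>r < ?n\<close> J[OF \<open>r < ?n\<close>] len
      by (simp add: nth_nths_delete T_def nths_delete2 power_add mult_ac)
  qed
  \<comment> \<open>From p on, position r of the shortened list is position Suc r of cs, and this
    shift accounts for the minus sign.\<close>
  moreover have "J r = - T p (Suc r)" if "p \<le> r" "r < ?n" for r
    using that J[OF that(2)] len nths_delete2'[of p "Suc r" cs]
    by (simp add: nth_nths_delete T_def power_add mult_ac)
  moreover have "{..<?n} = {..<p} \<union> {p..<?n}" using p by auto
  then have "(\<Sum>r<?n. J r) = (\<Sum>r<p. J r) + (\<Sum>r\<in>{p..<?n}. J r)"
    by (metis finite_lessThan finite_atLeastLessThan ivl_disj_int_one(2) sum.union_disjoint)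
  ultimately have "(\<Sum>r<?n. J r) = - (\<Sum>q<p. T q p) - (\<Sum>r\<in>{p..<?n}. T p (Suc r))"
    by (simp add: sum_negf)
  also have "(\<Sum>r\<in>{p..<?n}. T p (Suc r)) = (\<Sum>q\<in>{Suc p..<Suc ?n}. T p q)"
    by (simp only: sum.shift_bounds_Suc_ivl)
  finally have "(\<Sum>r<?n. J r) = - (\<Sum>q<p. T q p) - (\<Sum>q\<in>{Suc p..<Suc ?n}. T p q)" .
  moreover have "(-1) ^ p * br (cs ! p) (v p) = (\<Sum>r<?n. J r) - (-1) ^ p * divergence (br (cs ! p)) * v p"
    unfolding v_def jacobian_derivation[OF ld br_derivation] J_def
    by (simp add: algebra_simps sum_distrib_left)
  ultimately show ?thesis by simp
qed

text \<open>Applying \<partial>_j to the relation for \<partial>_i expresses \<open>S i j\<close> by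
  second derivatives of the polynomials, so it is symmetric in i and j. The sum in question pairs it
  with the skew matrix of the {X_i, X_j}.\<close>

lemma sum_br_jacobian: "(\<Sum>p<Suc CARD('n). (-1) ^ p * br (cs ! p) (v p)) = 0"
proof -
  let ?I = "{..<Suc CARD('n)}"
  \<comment> \<open>The sign gets a name so that it is carried along as a constant that commutes
    with the partial derivatives.\<close>
  define X :: "nat \<Rightarrow> 'n cpoly" where "X p = (-1) ^ p" for p
  have X0: "pderiv_var j (X p * f) = X p * pderiv_var j f" for j p f
    unfolding X_def by (induction p) (auto simp: is_derivationD(6)[OF is_derivation_pderiv_var])
  define S where "S i j = (\<Sum>p\<in>?I. X p * pderiv_var i (cs ! p) * pderiv_var j (v p))" for i j
  define S' where "S' i j = (\<Sum>p\<in>?I. X p * pderiv_var j (pderiv_var i (cs ! p)) * v p)" for i j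
  have "pderiv_var j (\<Sum>p\<in>?I. X p * pderiv_var i (cs ! p) * v p) = 0" for i j
    using jacobian_relation_pderiv[OF len, of i]
    by (simp add: X_def v_def is_derivationD(4)[OF is_derivation_pderiv_var] del: sum.lessThan_Suc)
  then have S: "S i j = - S' i j" for i j
    unfolding is_derivationD(8)[OF is_derivation_pderiv_var] mult.assoc X0
    unfolding pderiv_var_mult
    by (simp add: S_def S'_def distrib_left sum.distrib mult.assoc eq_neg_iff_add_eq_0 add.commute del: sum.lessThan_Suc)
  have sym: "S' i j = S' j i" for i j
    by (simp add: S'_def pderiv_var_commute[of i j])
  have "(\<Sum>p\<in>?I. X p * br (cs ! p) (v p))
    = (\<Sum>p\<in>?I. \<Sum>i\<in>UNIV. \<Sum>j\<in>UNIV. br (pvar i) (pvar j) * (X p * pderiv_var i (cs ! p) * pderiv_var j (v p)))"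
  proof (intro sum.cong refl)
    fix p
    have "br (cs ! p) (v p) = (\<Sum>i\<in>UNIV. \<Sum>j\<in>UNIV. pderiv_var i (cs ! p) * (pderiv_var j (v p) * br (pvar i) (pvar j)))"
      by (subst derivation_expand[OF br_derivation_left], subst derivation_expand[OF br_derivation])
        (simp add: sum_distrib_left)
    then show "X p * br (cs ! p) (v p)
      = (\<Sum>i\<in>UNIV. \<Sum>j\<in>UNIV. br (pvar i) (pvar j) * (X p * pderiv_var i (cs ! p) * pderiv_var j (v p)))"
      by (simp add: sum_distrib_left mult_ac)
  qed
  also have "\<dots> = (\<Sum>i\<in>UNIV. \<Sum>j\<in>UNIV. br (pvar i) (pvar j) * S i j)"
    unfolding S_def sum_distrib_left by (subst sum.swap, intro sum.cong refl, rule sum.swap)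
  finally have eq: "(\<Sum>p\<in>?I. X p * br (cs ! p) (v p)) = (\<Sum>i\<in>UNIV. \<Sum>j\<in>UNIV. br (pvar i) (pvar j) * S i j)" .
  have "(\<Sum>i\<in>UNIV. \<Sum>j\<in>UNIV. br (pvar i) (pvar j) * S i j) = 0" (is "?Z = 0")
  proof (rule cpoly_add_self_eq_0)
    have "?Z = (\<Sum>j\<in>UNIV. \<Sum>i\<in>UNIV. br (pvar i) (pvar j) * S i j)" by (rule sum.swap)
    also have "\<dots> = (\<Sum>j\<in>UNIV. \<Sum>i\<in>UNIV. - (br (pvar j) (pvar i) * S j i))"
      by (intro sum.cong refl) (subst br_skew, simp add: S sym)
    also have "\<dots> = - ?Z" by (simp add: sum_negf)
    finally show "?Z + ?Z = 0" by (simp only: eq_neg_iff_add_eq_0)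
  qed
  then show ?thesis using eq by (simp add: X_def)
qed

text \<open>Inserting \<open>br_jacobian\<close> into \<open>sum_br_jacobian\<close> counts every
  pair twice, once from each of its two members. The divergence terms vanish by
  \<open>jacobian_relation\<close>, as the divergence of {f, .} is a derivation in f.\<close>

lemma sum_pairs_jacobian: "(\<Sum>j<Suc CARD('n). \<Sum>i<j. T i j) = 0"
proof (rule cpoly_add_self_eq_0)
  let ?N = "Suc CARD('n)"
  have "0 = (\<Sum>p<?N. (-1) ^ p * br (cs ! p) (v p))" by (simp only: sum_br_jacobian)
  also have "\<dots> = - (\<Sum>p<?N. \<Sum>q<p. T q p) - (\<Sum>p<?N. \<Sum>q\<in>{Suc p..<?N}. T p q)
      - (\<Sum>p<?N. (-1) ^ p * divergence (br (cs ! p)) * v p)"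
    by (simp add: br_jacobian sum_subtractf sum_negf del: sum.lessThan_Suc cong: sum.cong_simp)
  also have "(\<Sum>p<?N. (-1) ^ p * divergence (br (cs ! p)) * v p) = 0"
    unfolding v_def by (rule jacobian_relation[OF len divergence_derivation])
  also have "(\<Sum>p<?N. \<Sum>q\<in>{Suc p..<?N}. T p q) = (\<Sum>j<?N. \<Sum>i<j. T i j)"
    using sum_triangle_swap[where T = T and k = 0 and N = ?N] by (simp only: atLeast0LessThan)
  finally show "(\<Sum>j<?N. \<Sum>i<j. T i j) + (\<Sum>j<?N. \<Sum>i<j. T i j) = 0"
    by (simp add: algebra_simps del: sum.lessThan_Suc)
qed

text \<open>The module bracket is a derivation in its second argument, so its alternating sum over
  all n + 1 positions is zero, and the part below k is minus the part from k on. The latter is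
  rewritten by \<open>br_jacobian\<close>.\<close>

lemma jacobian_duality_concat:
  assumes "k \<le> Suc CARD('n)"
  shows "(\<Sum>i<k. (-1) ^ i * (mbr m (cs ! i) * v i)) + m * (\<Sum>j<k. \<Sum>i<j. T i j)
    = (\<Sum>i\<in>{k..<Suc CARD('n)}. (-1) ^ i * br (cs ! i) (m * v i))
      + m * (\<Sum>j\<in>{k..<Suc CARD('n)}. \<Sum>i\<in>{k..<j}. T i j)"
proof -
  let ?N = "Suc CARD('n)"
  have split: "(\<Sum>i<?N. f i) = (\<Sum>i<k. f i) + (\<Sum>i\<in>{k..<?N}. f i)" for f :: "nat \<Rightarrow> 'n cpoly"
  proof -
    have "{..<?N} = {..<k} \<union> {k..<?N}" using assms by auto
    then show ?thesis
      by (metis finite_lessThan finite_atLeastLessThan ivl_disj_int_one(2) sum.union_disjoint)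
  qed
  have "(\<Sum>i<?N. (-1) ^ i * (mbr m (cs ! i) * v i)) = 0"
    using jacobian_relation[OF len mbr_derivation] by (simp add: v_def mult.assoc)
  then have "(\<Sum>i<k. (-1) ^ i * (mbr m (cs ! i) * v i))
      = (\<Sum>i\<in>{k..<?N}. - ((-1) ^ i * (mbr m (cs ! i) * v i)))"
    unfolding split by (simp add: sum_negf eq_neg_iff_add_eq_0)
  also have "\<dots> = (\<Sum>i\<in>{k..<?N}. (-1) ^ i * br (cs ! i) (m * v i)
      + m * (\<Sum>q<i. T q i) + m * (\<Sum>q\<in>{Suc i..<?N}. T i q))"
  proof (intro sum.cong refl)
    fix i assume "i \<in> {k..<?N}"
    then have *: "(-1) ^ i * br (cs ! i) (v i) = - (\<Sum>q<i. T q i) - (\<Sum>q\<in>{Suc i..<?N}. T i q)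
      - (-1) ^ i * divergence (br (cs ! i)) * v i" by (intro br_jacobian) simp
    have "(-1) ^ i * br (cs ! i) (m * v i) = (-1) ^ i * br (cs ! i) m * v i + m * ((-1) ^ i * br (cs ! i) (v i))"
      by (simp add: is_derivationD[OF br_derivation] algebra_simps)
    \<comment> \<open>The divergence produced by \<open>br_jacobian\<close> is cancelled by the
      twist in \<open>mbr_eq\<close>.\<close>
    then show "- ((-1) ^ i * (mbr m (cs ! i) * v i)) = (-1) ^ i * br (cs ! i) (m * v i)
      + m * (\<Sum>q<i. T q i) + m * (\<Sum>q\<in>{Suc i..<?N}. T i q)"
      unfolding * mbr_eq by (simp add: algebra_simps)
  qed
  also have "\<dots> = (\<Sum>i\<in>{k..<?N}. (-1) ^ i * br (cs ! i) (m * v i))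
      + m * (\<Sum>i\<in>{k..<?N}. \<Sum>q<i. T q i) + m * (\<Sum>j\<in>{k..<?N}. \<Sum>i\<in>{k..<j}. T i j)"
    by (simp only: sum.distrib sum_triangle_swap[symmetric] sum_distrib_left)
  finally have "(\<Sum>i<k. (-1) ^ i * (mbr m (cs ! i) * v i)) + m * (\<Sum>j<k. \<Sum>i<j. T i j)
    = (\<Sum>i\<in>{k..<?N}. (-1) ^ i * br (cs ! i) (m * v i))
      + m * ((\<Sum>j<k. \<Sum>i<j. T i j) + (\<Sum>i\<in>{k..<?N}. \<Sum>q<i. T q i))
      + m * (\<Sum>j\<in>{k..<?N}. \<Sum>i\<in>{k..<j}. T i j)"
    by (simp add: algebra_simps)
  \<comment> \<open>The pairs below k and the pairs whose larger member is at least k are all pairs,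
    so the middle term is zero.\<close>
  then show ?thesis using sum_pairs_jacobian unfolding split by simp
qed

end

text \<open>The previous identity for the concatenated list, arranged so that the left side has the
  shape of the boundary in \<open>as\<close> and the right side that of the coboundary in
  \<open>bs\<close>.\<close>

lemma jacobian_duality:
  assumes len: "length as + length bs = Suc CARD('n)"
  shows "(\<Sum>i<length as. (-1) ^ i * (mbr m (as ! i) * jacobian (nths as (- {i}) @ bs)))
      + (\<Sum>j<length as. \<Sum>i<j. (-1) ^ (i + j)
          * (m * jacobian ((br (as ! i) (as ! j) # nths as (- {i, j})) @ bs)))
    = (-1) ^ length as * ((\<Sum>i<length bs. (-1) ^ i * br (bs ! i) (m * jacobian (as @ nths bs (- {i}))))
      + (\<Sum>j<length bs. \<Sum>i<j. (-1) ^ (i + j)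
          * (m * jacobian (as @ br (bs ! i) (bs ! j) # nths bs (- {i, j})))))"
proof -
  let ?cs = "as @ bs" and ?k = "length as"
  have lcs: "length ?cs = Suc CARD('n)" and k: "?k \<le> Suc CARD('n)"
    and lbs: "length bs = Suc CARD('n) - ?k" using len by auto
  define T where "T i j = (-1) ^ (i + j) * jacobian (br (?cs ! i) (?cs ! j) # nths ?cs (- {i, j}))" for i j
  have a: "(\<Sum>i<?k. (-1) ^ i * (mbr m (as ! i) * jacobian (nths as (- {i}) @ bs)))
    = (\<Sum>i<?k. (-1) ^ i * (mbr m (?cs ! i) * jacobian (nths ?cs (- {i}))))"
    by (intro sum.cong refl) (simp add: nths_delete_append1 nth_append)
  have b: "(\<Sum>j<?k. \<Sum>i<j. (-1) ^ (i + j) * (m * jacobian ((br (as ! i) (as ! j) # nths as (- {i, j})) @ bs)))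
    = m * (\<Sum>j<?k. \<Sum>i<j. T i j)"
    unfolding sum_distrib_left
    by (intro sum.cong refl)
      (simp add: T_def nths_delete2 nths_delete_append1 nth_append length_nths_delete mult_ac)
  have c: "(-1) ^ ?k * (\<Sum>i<length bs. (-1) ^ i * br (bs ! i) (m * jacobian (as @ nths bs (- {i}))))
    = (\<Sum>i\<in>{?k..<Suc CARD('n)}. (-1) ^ i * br (?cs ! i) (m * jacobian (nths ?cs (- {i}))))"
    unfolding sum.atLeastLessThan_shift_0[of _ ?k] sum_distrib_left lbs
    by (intro sum.cong) (auto simp: nths_delete_append2 power_add mult_ac)
  \<comment> \<open>Shifting both i and j by k changes the sign exponent by an even number. The
    factor (-1)^k comes from moving the bracket past the k entries of \<open>as\<close>.\<close>
  have "(-1) ^ ?k * ((-1) ^ (i + j) * (m * jacobian (as @ br (bs ! i) (bs ! j) # nths bs (- {i, j}))))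
    = m * T (?k + i) (?k + j)" if ij: "i < j" "j < length bs" for i j
  proof -
    have "nths ?cs (- {?k + i, ?k + j}) = as @ nths bs (- {i, j})"
      using ij by (simp add: nths_delete2 nths_delete_append2)
    moreover have "jacobian (as @ br (bs ! i) (bs ! j) # nths bs (- {i, j}))
      = (-1) ^ ?k * jacobian (br (bs ! i) (bs ! j) # as @ nths bs (- {i, j}))"
      by (rule jacobian_move) (use ij len in \<open>simp add: length_nths_delete2\<close>)
    ultimately show ?thesis by (simp add: T_def power_add mult_ac)
  qed
  then have d: "(-1) ^ ?k * (\<Sum>j<length bs. \<Sum>i<j. (-1) ^ (i + j)
          * (m * jacobian (as @ br (bs ! i) (bs ! j) # nths bs (- {i, j}))))
    = m * (\<Sum>j\<in>{?k..<Suc CARD('n)}. \<Sum>i\<in>{?k..<j}. T i j)"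
    unfolding sum.atLeastLessThan_shift_0[of _ ?k] sum_distrib_left lbs[symmetric]
    by (intro sum.cong) (auto simp: atLeast0LessThan sum_distrib_left)
  show ?thesis
    unfolding distrib_left c d a b
    using jacobian_duality_concat[OF lcs k, of m] by (simp only: T_def)
qed

end

section \<open>Modules given by generators and relations\<close>

lemma mk_module_sel [simp]:
  "carrier (mk_module V z p s) = V" "zero (mk_module V z p s) = z"
  "add (mk_module V z p s) = p" "module.smult (mk_module V z p s) = s"
  by (simp_all add: mk_module_def)

text \<open>The coset of f modulo the relations. It does not involve the set X of generators, which
  matters only for membership in the carrier.\<close>

definition rel_class :: "('x \<Rightarrow>\<^sub>0 'k::comm_ring_1) set \<Rightarrow> ('x \<Rightarrow>\<^sub>0 'k) \<Rightarrow> ('x \<Rightarrow>\<^sub>0 'k) set" where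
  "rel_class S f = (\<lambda>n. n + f) ` pm.span S"

lemma mem_rel_class: "h \<in> rel_class S f \<longleftrightarrow> h - f \<in> pm.span S"
  unfolding rel_class_def by (auto intro!: image_eqI[of _ _ "h - f"])

lemma rel_class_eq_iff: "rel_class S f = rel_class S g \<longleftrightarrow> f - g \<in> pm.span S"
proof
  assume "rel_class S f = rel_class S g"
  then show "f - g \<in> pm.span S" using pm.span_zero[of S] by (metis diff_self mem_rel_class)
next
  assume *: "f - g \<in> pm.span S"
  have "h - f = (h - g) - (f - g)" "h - g = (h - f) + (f - g)" for h by simp_all
  then show "rel_class S f = rel_class S g"
    unfolding set_eq_iff mem_rel_class using * pm.span_add pm.span_diff by metis
qed

lemma rel_class_eqI: "f - g \<in> S \<Longrightarrow> rel_class S f = rel_class S g"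
  by (simp add: rel_class_eq_iff pm.span_base)

lemma free_module_simps [simp]:
  "carrier (free_module X) = {f. Poly_Mapping.keys f \<subseteq> X}"
  "zero (free_module X) = 0" "add (free_module X) = (+)" "module.smult (free_module X) = pm_scale"
  by (simp_all add: free_module_def)

lemma free_module_coset: "pm.span S +>\<^bsub>free_module X\<^esub> f = rel_class S f"
  by (auto simp: a_r_coset_def' rel_class_def)

lemma generator_class_conv: "generator_class X S x = rel_class S (gen x)"
  by (simp add: generator_class_def free_module_coset)

lemma presented_module_carrier:
  "carrier (presented_module X S) = rel_class S ` {f. Poly_Mapping.keys f \<subseteq> X}"
  by (auto simp: presented_module_def quotient_module_def A_RCOSETS_def' free_module_coset)

lemma presented_module_zero: "zero (presented_module X S) = rel_class S 0"
  by (simp add: presented_module_def quotient_module_def rel_class_def)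

lemma presented_module_add:
  "rel_class S f \<oplus>\<^bsub>presented_module X S\<^esub> rel_class S g = rel_class S (f + g)"
proof (rule Set.set_eqI, rule iffI)
  have sum_conv: "h \<in> rel_class S f \<oplus>\<^bsub>presented_module X S\<^esub> rel_class S g
      \<longleftrightarrow> (\<exists>u\<in>rel_class S f. \<exists>v\<in>rel_class S g. h = u + v)" for h
    by (simp add: presented_module_def quotient_module_def set_add_def')
  fix h
  show "h \<in> rel_class S (f + g)" if h: "h \<in> rel_class S f \<oplus>\<^bsub>presented_module X S\<^esub> rel_class S g"
  proof -
    obtain u v where *: "h = u + v" "u - f \<in> pm.span S" "v - g \<in> pm.span S"
      using h sum_conv by (auto simp: mem_rel_class)
    then have "(u - f) + (v - g) \<in> pm.span S" by (intro pm.span_add)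
    then show ?thesis using * by (simp add: mem_rel_class algebra_simps)
  qed
  show "h \<in> rel_class S f \<oplus>\<^bsub>presented_module X S\<^esub> rel_class S g" if "h \<in> rel_class S (f + g)"
  proof -
    have "h - g \<in> rel_class S f" "g \<in> rel_class S g"
      using that by (simp_all add: mem_rel_class pm.span_zero algebra_simps)
    moreover have "h = h - g + g" by (rule diff_add_cancel[symmetric])
    ultimately show ?thesis unfolding sum_conv by blast
  qed
qed

lemma presented_module_smult:
  "c \<odot>\<^bsub>presented_module X S\<^esub> rel_class S f = rel_class S (pm_scale c f)"
proof (rule Set.set_eqI, rule iffI)
  have smult_conv: "h \<in> c \<odot>\<^bsub>presented_module X S\<^esub> rel_class S f
      \<longleftrightarrow> (\<exists>n\<in>pm.span S. \<exists>u\<in>rel_class S f. h = n + pm_scale c u)" for h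
    by (simp add: presented_module_def quotient_module_def set_add_def')
  fix h
  show "h \<in> rel_class S (pm_scale c f)" if h: "h \<in> c \<odot>\<^bsub>presented_module X S\<^esub> rel_class S f"
  proof -
    obtain n u where *: "n \<in> pm.span S" "u \<in> rel_class S f" "h = n + pm_scale c u"
      using h unfolding smult_conv by (elim bexE)
    then have "u - f \<in> pm.span S" by (simp only: mem_rel_class)
    then have "n + pm_scale c (u - f) \<in> pm.span S"
      by (rule pm.span_add[OF *(1) pm.span_scale])
    moreover have "h - pm_scale c f = n + pm_scale c (u - f)"
      unfolding *(3) by (simp add: pm.scale_right_diff_distrib)
    ultimately show ?thesis by (simp only: mem_rel_class)
  qed
  show "h \<in> c \<odot>\<^bsub>presented_module X S\<^esub> rel_class S f" if "h \<in> rel_class S (pm_scale c f)"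
  proof -
    have "h - pm_scale c f \<in> pm.span S" "f \<in> rel_class S f"
      using that by (simp_all add: mem_rel_class pm.span_zero)
    moreover have "h = h - pm_scale c f + pm_scale c f" by (rule diff_add_cancel[symmetric])
    ultimately show ?thesis unfolding smult_conv by blast
  qed
qed

lemmas presented_module_simps = presented_module_zero presented_module_add presented_module_smult

lemma presented_module_closed:
  assumes "C \<in> carrier (presented_module X S)"
  shows "D \<in> carrier (presented_module X S) \<Longrightarrow> C \<oplus>\<^bsub>presented_module X S\<^esub> D \<in> carrier (presented_module X S)"
    and "c \<odot>\<^bsub>presented_module X S\<^esub> C \<in> carrier (presented_module X S)"
proof -
  obtain f where f: "C = rel_class S f" "Poly_Mapping.keys f \<subseteq> X"
    using assms by (auto simp: presented_module_carrier)
  show "C \<oplus>\<^bsub>presented_module X S\<^esub> D \<in> carrier (presented_module X S)"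
    if D: "D \<in> carrier (presented_module X S)"
  proof -
    obtain g where g: "D = rel_class S g" "Poly_Mapping.keys g \<subseteq> X"
      using D by (auto simp: presented_module_carrier)
    have "Poly_Mapping.keys (f + g) \<subseteq> X" using f g keys_add[of f g] by blast
    then show ?thesis by (simp add: f g presented_module_add presented_module_carrier)
  qed
  have "Poly_Mapping.keys (pm_scale c f) \<subseteq> X" using f keys_pm_scale[of c f] by blast
  then show "c \<odot>\<^bsub>presented_module X S\<^esub> C \<in> carrier (presented_module X S)"
    by (simp add: f presented_module_smult presented_module_carrier)
qed

lemma generator_class_closed: "x \<in> X \<Longrightarrow> generator_class X S x \<in> carrier (presented_module X S)"
  by (auto simp: generator_class_conv presented_module_carrier)

lemma presented_module_zero_closed: "zero (presented_module X S) \<in> carrier (presented_module X S)"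
  by (auto simp: presented_module_carrier presented_module_simps)

lemma presented_module_zero_smult:
  "C \<in> carrier (presented_module X S) \<Longrightarrow> 0 \<odot>\<^bsub>presented_module X S\<^esub> C = zero (presented_module X S)"
  by (auto simp: presented_module_carrier presented_module_simps)

text \<open>Supplies the laws by which the finite sums in \<open>boundary_value\<close> are
  computed.\<close>

lemma abelian_monoid_presented_module: "abelian_monoid (presented_module X S)"
proof (rule abelian_monoidI)
  fix C D assume "C \<in> carrier (presented_module X S)" "D \<in> carrier (presented_module X S)"
  then show "C \<oplus>\<^bsub>presented_module X S\<^esub> D \<in> carrier (presented_module X S)"
    by (rule presented_module_closed)
qed (auto simp: presented_module_carrier presented_module_simps add_ac)

lemma presented_module_induct [consumes 1, case_names zero gen add smult]:
  assumes C: "C \<in> carrier (presented_module X S)"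
    and zero: "Q (zero (presented_module X S))"
    and gen: "\<And>x. x \<in> X \<Longrightarrow> Q (generator_class X S x)"
    and add: "\<And>C D. C \<in> carrier (presented_module X S) \<Longrightarrow> D \<in> carrier (presented_module X S)
      \<Longrightarrow> Q C \<Longrightarrow> Q D \<Longrightarrow> Q (C \<oplus>\<^bsub>presented_module X S\<^esub> D)"
    and smult: "\<And>c C. C \<in> carrier (presented_module X S) \<Longrightarrow> Q C \<Longrightarrow> Q (c \<odot>\<^bsub>presented_module X S\<^esub> C)"
  shows "Q C"
proof -
  let ?P = "presented_module X S"
  obtain f where f: "Poly_Mapping.keys f \<subseteq> X" "C = rel_class S f"
    using C by (auto simp: presented_module_carrier)
  have "rel_class S f \<in> carrier ?P \<and> Q (rel_class S f)"
  proof (induction f rule: poly_mapping_additive_induct)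
    case 1
    then show ?case using zero presented_module_zero_closed[of X S] by (simp add: presented_module_zero)
  next
    case (2 x a)
    then have x: "x \<in> X" using f by auto
    have "rel_class S (Poly_Mapping.single x a) = a \<odot>\<^bsub>?P\<^esub> generator_class X S x"
      by (simp add: generator_class_conv presented_module_smult)
    then show ?case
      using smult[OF generator_class_closed[OF x] gen[OF x], of a]
        presented_module_closed(2)[OF generator_class_closed[OF x], of S a] by simp
  next
    case (3 g h)
    then show ?case
      using add[of "rel_class S g" "rel_class S h"]
        presented_module_closed(1)[of "rel_class S g" X S "rel_class S h"]
      by (simp add: presented_module_add)
  qed
  then show ?thesis using f by simp
qed

section \<open>Linear functionals on presented modules\<close>

definition lin_ext :: "('x \<Rightarrow> 'k) \<Rightarrow> ('x \<Rightarrow>\<^sub>0 'k::comm_ring_1) \<Rightarrow> 'k" where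
  "lin_ext h f = (\<Sum>x\<in>Poly_Mapping.keys f. Poly_Mapping.lookup f x * h x)"

lemma lin_ext_superset:
  "finite F \<Longrightarrow> Poly_Mapping.keys f \<subseteq> F \<Longrightarrow> lin_ext h f = (\<Sum>x\<in>F. Poly_Mapping.lookup f x * h x)"
  unfolding lin_ext_def by (intro sum.mono_neutral_left) (auto simp: in_keys_iff)

lemma lin_ext_zero [simp]: "lin_ext h 0 = 0"
  by (simp add: lin_ext_def)

lemma lin_ext_single [simp]: "lin_ext h (Poly_Mapping.single x a) = a * h x"
  by (subst lin_ext_superset[of "{x}"]) auto

lemma lin_ext_add [simp]: "lin_ext h (f + g) = lin_ext h f + lin_ext h g"
proof -
  let ?F = "Poly_Mapping.keys f \<union> Poly_Mapping.keys g"
  have "Poly_Mapping.keys (f + g) \<subseteq> ?F" by (rule keys_add)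
  then show ?thesis by (simp add: lin_ext_superset[of ?F] lookup_add distrib_right sum.distrib)
qed

lemma lin_ext_scale [simp]: "lin_ext h (pm_scale c f) = c * lin_ext h f"
  by (subst lin_ext_superset[of "Poly_Mapping.keys f"])
    (auto simp: keys_pm_scale lin_ext_def sum_distrib_left mult.assoc)

lemma lin_ext_uminus [simp]: "lin_ext h (- f) = - lin_ext h f"
  using lin_ext_add[of h f "- f"] by (simp add: eq_neg_iff_add_eq_0 add.commute)

lemma lin_ext_diff [simp]: "lin_ext h (f - g) = lin_ext h f - lin_ext h g"
  using lin_ext_add[of h f "- g"] by simp

lemma lin_ext_sum: "lin_ext h (sum f F) = (\<Sum>i\<in>F. lin_ext h (f i))"
  by (induction F rule: infinite_finite_induct) auto

text \<open>The universal property of a presented module with the ring itself as target. The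
  representative is arbitrary; the value is independent of it once \<open>lin_ext h\<close> vanishes
  on the relations.\<close>

definition class_ext :: "('x \<Rightarrow> 'k) \<Rightarrow> ('x \<Rightarrow>\<^sub>0 'k::comm_ring_1) set \<Rightarrow> 'k" where
  "class_ext h C = lin_ext h (SOME f. f \<in> C)"

lemma class_ext_rel_class:
  assumes "\<And>s. s \<in> S \<Longrightarrow> lin_ext h s = 0"
  shows "class_ext h (rel_class S f) = lin_ext h f"
proof -
  have "lin_ext h n = 0" if "n \<in> pm.span S" for n
    using that by (induction rule: pm.span_induct_alt) (auto simp: assms)
  moreover have "(SOME g. g \<in> rel_class S f) \<in> rel_class S f"
    by (rule someI[of _ f]) (simp add: mem_rel_class pm.span_zero)
  ultimately have "lin_ext h ((SOME g. g \<in> rel_class S f) - f) = 0"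
    by (simp only: mem_rel_class)
  then show ?thesis by (simp add: class_ext_def)
qed

lemma class_ext_linear:
  assumes "\<And>s. s \<in> S \<Longrightarrow> lin_ext h s = 0" "C \<in> carrier (presented_module X S)"
  shows "D \<in> carrier (presented_module X S)
      \<Longrightarrow> class_ext h (C \<oplus>\<^bsub>presented_module X S\<^esub> D) = class_ext h C + class_ext h D"
    and "class_ext h (c \<odot>\<^bsub>presented_module X S\<^esub> C) = c * class_ext h C"
  using assms(2) by (auto simp: presented_module_carrier presented_module_simps class_ext_rel_class assms(1))

lemma class_ext_gen:
  assumes "\<And>s. s \<in> S \<Longrightarrow> lin_ext h s = 0"
  shows "class_ext h (generator_class X S x) = h x"
  by (simp add: generator_class_conv class_ext_rel_class assms)

lemma class_ext_zero:
  assumes "\<And>s. s \<in> S \<Longrightarrow> lin_ext h s = 0"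
  shows "class_ext h (zero (presented_module X S)) = 0"
  by (simp add: presented_module_zero class_ext_rel_class assms)

section \<open>Tensor products and exterior powers\<close>

lemma tensor_conv: "tensor V W x y = rel_class (tensor_relations V W) (gen (x, y))"
  by (simp add: tensor_def generator_class_conv)

lemma tensor_relationsI:
  assumes "x \<in> carrier V" "y \<in> carrier W"
  shows "x' \<in> carrier V \<Longrightarrow> gen (x \<oplus>\<^bsub>V\<^esub> x', y) - gen (x, y) - gen (x', y) \<in> tensor_relations V W"
    and "y' \<in> carrier W \<Longrightarrow> gen (x, y \<oplus>\<^bsub>W\<^esub> y') - gen (x, y) - gen (x, y') \<in> tensor_relations V W"
    and "gen (r \<odot>\<^bsub>V\<^esub> x, y) - pm_scale r (gen (x, y)) \<in> tensor_relations V W"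
    and "gen (x, r \<odot>\<^bsub>W\<^esub> y) - pm_scale r (gen (x, y)) \<in> tensor_relations V W"
  unfolding tensor_relations_def using assms by blast+

lemma tensor_linear:
  assumes "x \<in> carrier V" "y \<in> carrier W"
  shows "x' \<in> carrier V \<Longrightarrow> tensor V W (x \<oplus>\<^bsub>V\<^esub> x') y = tensor V W x y \<oplus>\<^bsub>tensor_product V W\<^esub> tensor V W x' y"
    and "y' \<in> carrier W \<Longrightarrow> tensor V W x (y \<oplus>\<^bsub>W\<^esub> y') = tensor V W x y \<oplus>\<^bsub>tensor_product V W\<^esub> tensor V W x y'"
    and "tensor V W (r \<odot>\<^bsub>V\<^esub> x) y = r \<odot>\<^bsub>tensor_product V W\<^esub> tensor V W x y"
    and "tensor V W x (r \<odot>\<^bsub>W\<^esub> y) = r \<odot>\<^bsub>tensor_product V W\<^esub> tensor V W x y"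
  unfolding tensor_conv tensor_product_def presented_module_simps
  by (rule rel_class_eqI, use assms tensor_relationsI[OF assms] in \<open>simp only: diff_diff_eq[symmetric]\<close>)+

lemma tensor_closed:
  "x \<in> carrier V \<Longrightarrow> y \<in> carrier W \<Longrightarrow> tensor V W x y \<in> carrier (tensor_product V W)"
  unfolding tensor_def tensor_product_def by (rule generator_class_closed) simp

lemma wedge_conv:
  "int (length xs) = k \<Longrightarrow> wedge V xs = rel_class (exterior_relations V k) (gen xs)"
  by (auto simp: wedge_def generator_class_conv)

lemma wedge_closed: "xs \<in> tuples (carrier V) k \<Longrightarrow> wedge V xs \<in> carrier (exterior_power V k)"
  using generator_class_closed[of xs "tuples (carrier V) k" "exterior_relations V k"]
  by (auto simp: wedge_def exterior_power_def tuples_def)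

lemma wedge_linear:
  assumes "xs \<in> tuples (carrier V) k" "i < length xs" "x \<in> carrier V"
  shows "y \<in> carrier V \<Longrightarrow> wedge V (xs[i := x \<oplus>\<^bsub>V\<^esub> y])
      = wedge V (xs[i := x]) \<oplus>\<^bsub>exterior_power V k\<^esub> wedge V (xs[i := y])"
    and "wedge V (xs[i := r \<odot>\<^bsub>V\<^esub> x]) = r \<odot>\<^bsub>exterior_power V k\<^esub> wedge V (xs[i := x])"
proof -
  have k: "int (length xs) = k" using assms by (simp add: tuples_def)
  show "wedge V (xs[i := x \<oplus>\<^bsub>V\<^esub> y])
      = wedge V (xs[i := x]) \<oplus>\<^bsub>exterior_power V k\<^esub> wedge V (xs[i := y])" if "y \<in> carrier V"
  proof -
    have "gen (xs[i := x \<oplus>\<^bsub>V\<^esub> y]) - gen (xs[i := x]) - gen (xs[i := y]) \<in> exterior_relations V k"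
      unfolding exterior_relations_def using assms that by blast
    then have "gen (xs[i := x \<oplus>\<^bsub>V\<^esub> y]) - (gen (xs[i := x]) + gen (xs[i := y])) \<in> exterior_relations V k"
      by (simp add: diff_diff_eq)
    then show ?thesis
      using k by (simp add: wedge_conv[of _ k] exterior_power_def presented_module_simps rel_class_eqI)
  qed
  have "gen (xs[i := r \<odot>\<^bsub>V\<^esub> x]) - pm_scale r (gen (xs[i := x])) \<in> exterior_relations V k"
    unfolding exterior_relations_def using assms by blast
  then show "wedge V (xs[i := r \<odot>\<^bsub>V\<^esub> x]) = r \<odot>\<^bsub>exterior_power V k\<^esub> wedge V (xs[i := x])"
    using k by (simp only: wedge_conv[of _ k] exterior_power_def presented_module_simps rel_class_eqI length_list_update)
qed

lemma wedge_not_distinct: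
  assumes "xs \<in> tuples (carrier V) k" "\<not> distinct xs"
  shows "wedge V xs = \<zero>\<^bsub>exterior_power V k\<^esub>"
proof -
  have "gen xs \<in> exterior_relations V k" unfolding exterior_relations_def using assms by blast
  then show ?thesis
    using assms by (simp add: tuples_def wedge_conv[of _ k] exterior_power_def presented_module_simps rel_class_eqI)
qed

text \<open>The relations only annihilate lists with a repeated entry. Antisymmetry follows by
  polarization: put the sum c of the two entries into both slots and expand.\<close>

lemma wedge_swap:
  fixes V :: "('k::comm_ring_1, 'v) module"
  assumes xs: "xs \<in> tuples (carrier V) k" and ij: "i < j" "j < length xs"
    and V: "\<And>x y. x \<in> carrier V \<Longrightarrow> y \<in> carrier V \<Longrightarrow> x \<oplus>\<^bsub>V\<^esub> y \<in> carrier V"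
  shows "wedge V (xs[i := xs ! j, j := xs ! i]) = (-1) \<odot>\<^bsub>exterior_power V k\<^esub> wedge V xs"
proof -
  let ?S = "exterior_relations V k"
  define w :: "'v \<Rightarrow> 'v \<Rightarrow> 'v list \<Rightarrow>\<^sub>0 'k"
    where "w a b = gen (xs[i := a, j := b])" for a b
  let ?a = "xs ! i" and ?b = "xs ! j"
  let ?c = "?a \<oplus>\<^bsub>V\<^esub> ?b"
  have upd: "xs[i := a] \<in> tuples (carrier V) k" "xs[j := a] \<in> tuples (carrier V) k"
    if "a \<in> carrier V" for a
    using xs that set_update_subset_insert[of xs _ a] by (auto simp: tuples_def in_lists_conv_set)
  have ab: "?a \<in> carrier V" "?b \<in> carrier V" "?c \<in> carrier V"
    using xs ij V by (auto simp: tuples_def in_lists_conv_set)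
  have 1: "w ?c z - w ?a z - w ?b z \<in> pm.span ?S" if "z \<in> carrier V" for z
  proof -
    have "gen (xs[j := z, i := ?c]) - gen (xs[j := z, i := ?a]) - gen (xs[j := z, i := ?b]) \<in> ?S"
      unfolding exterior_relations_def using upd(2)[OF that] ab ij by fastforce
    moreover have "w a z = gen (xs[j := z, i := a])" for a
      using ij by (simp add: w_def list_update_swap[of i j])
    ultimately show ?thesis by (simp only: pm.span_base)
  qed
  have 2: "w z ?c - w z ?a - w z ?b \<in> pm.span ?S" if "z \<in> carrier V" for z
  proof -
    have "gen (xs[i := z, j := ?c]) - gen (xs[i := z, j := ?a]) - gen (xs[i := z, j := ?b]) \<in> ?S"
      unfolding exterior_relations_def using upd(1)[OF that] ab ij by fastforce
    then show ?thesis by (simp add: w_def pm.span_base)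
  qed
  have 3: "w z z \<in> pm.span ?S" if "z \<in> carrier V" for z
  proof -
    have "xs[i := z, j := z] \<in> tuples (carrier V) k"
      using upd(1)[OF that] that set_update_subset_insert[of "xs[i := z]" j z]
      by (auto simp: tuples_def in_lists_conv_set)
    moreover have "\<not> distinct (xs[i := z, j := z])"
      using ij nth_eq_iff_index_eq[of "xs[i := z, j := z]" i j] by (auto simp: nth_list_update)
    ultimately have "gen (xs[i := z, j := z]) \<in> ?S" unfolding exterior_relations_def by blast
    then show ?thesis by (simp add: w_def pm.span_base)
  qed
  \<comment> \<open>Every summand on the right is an additivity relation or has equal entries in the
    two slots.\<close>
  have "w ?b ?a - pm_scale (-1) (w ?a ?b) = w ?c ?c - (w ?c ?c - w ?a ?c - w ?b ?c)
      - (w ?a ?c - w ?a ?a - w ?a ?b) - (w ?b ?c - w ?b ?a - w ?b ?b) - w ?a ?a - w ?b ?b"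
    by (simp add: pm.scale_minus_left)
  also have "\<dots> \<in> pm.span ?S"
    by (intro pm.span_diff 1 2 3 ab)
  finally have "rel_class ?S (w ?b ?a) = rel_class ?S (pm_scale (-1) (w ?a ?b))"
    by (simp only: rel_class_eq_iff)
  then show ?thesis
    using xs by (simp add: w_def wedge_conv[of _ k] tuples_def exterior_power_def presented_module_simps)
qed

section \<open>Differential forms on affine space\<close>

lemma kaehler_d_conv: "kaehler_d sc a = rel_class (kaehler_relations sc) (gen a)"
  by (simp add: kaehler_d_def generator_class_conv)

lemma kaehler_d_add: "kaehler_d sc (a + b) = kaehler_d sc a \<oplus>\<^bsub>kaehler sc\<^esub> kaehler_d sc b"
proof -
  have "gen (a + b) - gen a - gen b \<in> kaehler_relations sc" unfolding kaehler_relations_def by blast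
  then show ?thesis
    by (simp add: kaehler_d_conv kaehler_def presented_module_simps rel_class_eqI diff_diff_eq)
qed

lemma kaehler_d_scale: "kaehler_d sc (sc c a) = sc c 1 \<odot>\<^bsub>kaehler sc\<^esub> kaehler_d sc a"
proof -
  have "gen (sc c a) - pm_scale (sc c 1) (gen a) \<in> kaehler_relations sc"
    unfolding kaehler_relations_def by blast
  then show ?thesis
    by (simp only: kaehler_d_conv kaehler_def presented_module_simps rel_class_eqI)
qed

lemma kaehler_d_mult: "kaehler_d sc (a * b)
  = (a \<odot>\<^bsub>kaehler sc\<^esub> kaehler_d sc b) \<oplus>\<^bsub>kaehler sc\<^esub> (b \<odot>\<^bsub>kaehler sc\<^esub> kaehler_d sc a)"
proof -
  have "gen (a * b) - pm_scale a (gen b) - pm_scale b (gen a) \<in> kaehler_relations sc"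
    unfolding kaehler_relations_def by blast
  then show ?thesis
    by (simp only: kaehler_d_conv kaehler_def presented_module_simps rel_class_eqI diff_diff_eq)
qed

lemma kaehler_d_closed: "kaehler_d sc a \<in> carrier (kaehler sc)"
  unfolding kaehler_d_def kaehler_def by (rule generator_class_closed) simp

lemmas kaehler_closed = presented_module_closed[where X = UNIV and S = "kaehler_relations _", folded kaehler_def]

text \<open>The differentials of the variables generate all 1-forms, by the Leibniz rule.\<close>

lemma kaehler_induct [consumes 1, case_names var add smult]:
  fixes x :: "('n cpoly \<Rightarrow>\<^sub>0 'n cpoly) set"
  assumes x: "x \<in> carrier (kaehler pm_scale)"
    and var: "\<And>j. Q (kaehler_d pm_scale (pvar j))"
    and add: "\<And>x y. x \<in> carrier (kaehler pm_scale) \<Longrightarrow> y \<in> carrier (kaehler pm_scale)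
      \<Longrightarrow> Q x \<Longrightarrow> Q y \<Longrightarrow> Q (x \<oplus>\<^bsub>kaehler pm_scale\<^esub> y)"
    and smult: "\<And>r x. x \<in> carrier (kaehler pm_scale) \<Longrightarrow> Q x \<Longrightarrow> Q (r \<odot>\<^bsub>kaehler pm_scale\<^esub> x)"
  shows "Q x"
proof -
  let ?K = "kaehler pm_scale :: ('n cpoly, ('n cpoly \<Rightarrow>\<^sub>0 'n cpoly) set) module"
  let ?d = "kaehler_d pm_scale :: 'n cpoly \<Rightarrow> _"
  have zero: "0 \<odot>\<^bsub>?K\<^esub> y = \<zero>\<^bsub>?K\<^esub>" if "y \<in> carrier ?K" for y
    using that unfolding kaehler_def by (rule presented_module_zero_smult)
  \<comment> \<open>Zero is 0 times the differential of any variable.\<close>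
  have Q0: "Q (\<zero>\<^bsub>?K\<^esub>)"
    using smult[OF kaehler_d_closed var, of 0 undefined] by (simp add: zero kaehler_d_closed)
  have d: "Q (?d a)" for a
  proof (induction a rule: cpoly_induct)
    case one
    \<comment> \<open>The Leibniz relation at a = b = 1, which gives d1 = 0.\<close>
    have "- gen 1 \<in> kaehler_relations (pm_scale :: complex \<Rightarrow> 'n cpoly \<Rightarrow> _)"
      unfolding kaehler_relations_def
      by (auto intro!: exI[of _ 1])
    then have "rel_class (kaehler_relations (pm_scale :: complex \<Rightarrow> 'n cpoly \<Rightarrow> _)) 0 = ?d 1"
      unfolding kaehler_d_conv by (intro rel_class_eqI) simp
    then show ?case using Q0 by (simp add: kaehler_def presented_module_zero)
  qed (simp_all add: kaehler_d_add kaehler_d_mult kaehler_d_scale var add smult kaehler_d_closed kaehler_closed)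
  show ?thesis
    using x unfolding kaehler_def
  proof (induction rule: presented_module_induct)
    case zero
    then show ?case using Q0 by (simp add: kaehler_def)
  next
    case (gen a)
    then show ?case using d[of a] by (simp add: kaehler_d_def)
  qed (simp_all add: add smult flip: kaehler_def)
qed

text \<open>The coefficients of a 1-form with respect to the dX_j. They are well defined because a
  partial derivative respects the Kaehler relations.\<close>

definition class_gradient :: "('n cpoly \<Rightarrow>\<^sub>0 'n cpoly) set \<Rightarrow> 'n \<Rightarrow> 'n cpoly" where
  "class_gradient x j = class_ext (pderiv_var j) x"

lemma pderiv_var_kaehler_relations:
  "s \<in> kaehler_relations pm_scale \<Longrightarrow> lin_ext (pderiv_var j) s = 0"
  by (auto simp: kaehler_relations_def pderiv_var_add pderiv_var_mult pderiv_var_scale mult.commute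
    simp flip: pm_scale_conv_mult)

lemma class_gradient_add:
  "x \<in> carrier (kaehler pm_scale) \<Longrightarrow> y \<in> carrier (kaehler pm_scale)
    \<Longrightarrow> class_gradient (x \<oplus>\<^bsub>kaehler pm_scale\<^esub> y) = (\<lambda>j. class_gradient x j + class_gradient y j)"
  unfolding class_gradient_def kaehler_def
  by (rule ext) (rule class_ext_linear(1)[OF pderiv_var_kaehler_relations])

lemma class_gradient_smult:
  "x \<in> carrier (kaehler pm_scale)
    \<Longrightarrow> class_gradient (r \<odot>\<^bsub>kaehler pm_scale\<^esub> x) = (\<lambda>j. r * class_gradient x j)"
  unfolding class_gradient_def kaehler_def
  by (rule ext) (rule class_ext_linear(2)[OF pderiv_var_kaehler_relations])

lemma class_gradient_d: "class_gradient (kaehler_d pm_scale a) = gradient a"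
  unfolding class_gradient_def gradient_def kaehler_d_def
  by (rule ext) (rule class_ext_gen[OF pderiv_var_kaehler_relations])

abbreviation poly_module :: "('n cpoly, 'n cpoly) module" where
  "poly_module \<equiv> action_module (*)"

abbreviation poly_forms where
  "poly_forms k \<equiv> kaehler_forms (pm_scale :: complex \<Rightarrow> 'n cpoly \<Rightarrow> 'n cpoly) k"

abbreviation poly_chains where
  "poly_chains k \<equiv> chain_module (pm_scale :: complex \<Rightarrow> 'n cpoly \<Rightarrow> 'n cpoly) (*) k"

abbreviation poly_tensors where
  "poly_tensors k \<equiv> tensor_product (poly_module :: ('n cpoly, 'n cpoly) module) (poly_forms k)"

lemma poly_module_simps [simp]:
  "carrier poly_module = UNIV" "zero poly_module = 0" "add poly_module = (+)"
  "module.smult poly_module = (\<lambda>r m. m * r)"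
  by (simp_all add: action_module_def)

lemma poly_chains_simps [simp]:
  "carrier (poly_chains k) = carrier (poly_tensors k)" "zero (poly_chains k) = zero (poly_tensors k)"
  "add (poly_chains k) = add (poly_tensors k)"
  "module.smult (poly_chains k) = (\<lambda>c x. pm_scale c 1 \<odot>\<^bsub>poly_tensors k\<^esub> x)"
  by (simp_all add: chain_module_def restrict_scalars_def)

lemma abelian_monoid_poly_chains: "abelian_monoid (poly_chains k)"
proof -
  interpret abelian_monoid "poly_tensors k"
    unfolding tensor_product_def by (rule abelian_monoid_presented_module)
  show ?thesis by (rule abelian_monoidI) (simp_all add: a_ac)
qed

lemma poly_tensors_closed:
  assumes "x \<in> carrier (poly_tensors k)"
  shows "y \<in> carrier (poly_tensors k) \<Longrightarrow> x \<oplus>\<^bsub>poly_tensors k\<^esub> y \<in> carrier (poly_tensors k)"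
    and "r \<odot>\<^bsub>poly_tensors k\<^esub> x \<in> carrier (poly_tensors k)"
  using assms presented_module_closed unfolding tensor_product_def by blast+

lemma poly_tensors_zero_smult:
  "x \<in> carrier (poly_tensors k) \<Longrightarrow> 0 \<odot>\<^bsub>poly_tensors k\<^esub> x = \<zero>\<^bsub>poly_tensors k\<^esub>"
  unfolding tensor_product_def by (rule presented_module_zero_smult)

abbreviation d_wedge :: "'n cpoly list \<Rightarrow> _" where
  "d_wedge as \<equiv> wedge (kaehler pm_scale) (map (kaehler_d pm_scale) as)"

lemma d_wedge_closed: "int (length as) = k \<Longrightarrow> d_wedge as \<in> carrier (poly_forms k)"
  unfolding kaehler_forms_def by (rule wedge_closed) (auto simp: tuples_def kaehler_d_closed)

lemma elementary_chain_conv: "int (length as) = k \<Longrightarrow>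
  elementary_chain pm_scale (*) m as = tensor poly_module (poly_forms k) m (d_wedge as)"
  by (auto simp: elementary_chain_def)

lemma elementary_chain_closed: "int (length as) = k \<Longrightarrow>
  elementary_chain pm_scale (*) m as \<in> carrier (poly_tensors k)"
  by (simp add: elementary_chain_conv tensor_closed d_wedge_closed)

section \<open>Spanning by forms in the variables\<close>

text \<open>The chain with coefficient \<open>\<mu> I\<close> at dX_I. Values of \<mu> at sets of
  other sizes are ignored, and in degrees below 0 or above n the sum is empty.\<close>

definition normal_chain where
  "normal_chain k \<mu> = rel_class (tensor_relations poly_module (poly_forms k))
     (\<Sum>I | int (card I) = k. gen (\<mu> I, d_wedge (map pvar (list_of I))))"
  for \<mu> :: "'n::finite set \<Rightarrow> 'n cpoly"

context
  fixes k :: int and S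
  assumes S: "S = tensor_relations (poly_module :: ('n::finite cpoly, _) module) (poly_forms k)"
begin

lemma d_wedge_list_of_closed:
  "int (card I) = k \<Longrightarrow> d_wedge (map pvar (list_of I)) \<in> carrier (poly_forms k)" for I :: "'n set"
  by (rule d_wedge_closed) (simp add: list_of)

text \<open>The additivity relation for 0 + 0 is minus this generator.\<close>

lemma gen_zero_in_span: "w \<in> carrier (poly_forms k) \<Longrightarrow> gen (0, w) \<in> pm.span S"
proof -
  assume "w \<in> carrier (poly_forms k)"
  then have "gen (0 + 0, w) - gen (0, w) - gen (0, w) \<in> S"
    unfolding S using tensor_relationsI(1)[of 0 poly_module w "poly_forms k" 0] by (simp only: poly_module_simps UNIV_I)
  then have "- (- gen (0, w)) \<in> pm.span S" by (intro pm.span_neg pm.span_base) simp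
  then show ?thesis by simp
qed

lemma normal_chain_add:
  "normal_chain k \<mu> \<oplus>\<^bsub>poly_tensors k\<^esub> normal_chain k \<nu> = normal_chain k (\<lambda>I. \<mu> I + \<nu> I)"
  for \<mu> :: "'n set \<Rightarrow> 'n cpoly"
proof -
  let ?w = "\<lambda>I :: 'n set. d_wedge (map pvar (list_of I))"
  have "(\<Sum>I | int (card I) = k. gen (\<mu> I + \<nu> I, ?w I) - gen (\<mu> I, ?w I) - gen (\<nu> I, ?w I)) \<in> pm.span S"
  proof (rule pm.span_sum, rule pm.span_base)
    fix I assume "I \<in> {I :: 'n set. int (card I) = k}"
    then have "?w I \<in> carrier (poly_forms k)" by (intro d_wedge_list_of_closed) simp
    then show "gen (\<mu> I + \<nu> I, ?w I) - gen (\<mu> I, ?w I) - gen (\<nu> I, ?w I) \<in> S"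
      unfolding S using tensor_relationsI(1)[of "\<mu> I" poly_module "?w I" "poly_forms k" "\<nu> I"]
      by (simp only: poly_module_simps UNIV_I)
  qed
  then have "rel_class S (\<Sum>I | int (card I) = k. gen (\<mu> I + \<nu> I, ?w I))
    = rel_class S ((\<Sum>I | int (card I) = k. gen (\<mu> I, ?w I)) + (\<Sum>I | int (card I) = k. gen (\<nu> I, ?w I)))"
    by (simp add: rel_class_eq_iff sum_subtractf diff_diff_eq sum.distrib)
  then show ?thesis
    unfolding normal_chain_def tensor_product_def presented_module_add S by simp
qed

lemma normal_chain_smult: "r \<odot>\<^bsub>poly_tensors k\<^esub> normal_chain k \<mu> = normal_chain k (\<lambda>I. \<mu> I * r)"
  for \<mu> :: "'n set \<Rightarrow> 'n cpoly"
proof -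
  let ?w = "\<lambda>I :: 'n set. d_wedge (map pvar (list_of I))"
  have "(\<Sum>I | int (card I) = k. gen (\<mu> I * r, ?w I) - pm_scale r (gen (\<mu> I, ?w I))) \<in> pm.span S"
  proof (rule pm.span_sum, rule pm.span_base)
    fix I assume "I \<in> {I :: 'n set. int (card I) = k}"
    then have "?w I \<in> carrier (poly_forms k)" by (intro d_wedge_list_of_closed) simp
    then show "gen (\<mu> I * r, ?w I) - pm_scale r (gen (\<mu> I, ?w I)) \<in> S"
      unfolding S using tensor_relationsI(3)[of "\<mu> I" poly_module "?w I" "poly_forms k" r]
      by (simp only: poly_module_simps UNIV_I)
  qed
  then have "rel_class S (\<Sum>I | int (card I) = k. gen (\<mu> I * r, ?w I))
    = rel_class S (pm_scale r (\<Sum>I | int (card I) = k. gen (\<mu> I, ?w I)))"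
    by (simp only: rel_class_eq_iff sum_subtractf pm.scale_sum_right)
  then show ?thesis
    unfolding normal_chain_def tensor_product_def presented_module_smult S by simp
qed

lemma normal_chain_zero: "normal_chain k (\<lambda>I :: 'n set. 0) = \<zero>\<^bsub>poly_tensors k\<^esub>"
  unfolding normal_chain_def tensor_product_def presented_module_zero S[symmetric] rel_class_eq_iff diff_zero
  by (rule pm.span_sum, rule gen_zero_in_span, rule d_wedge_list_of_closed) simp

lemma normal_chain_single:
  assumes "int (card I) = k"
  shows "normal_chain k (\<lambda>J :: 'n set. if J = I then m else 0)
    = tensor poly_module (poly_forms k) m (d_wedge (map pvar (list_of I)))"
proof -
  let ?w = "\<lambda>I :: 'n set. d_wedge (map pvar (list_of I))"
  have "(\<Sum>J | int (card J) = k. gen (if J = I then m else 0, ?w J) :: _ \<Rightarrow>\<^sub>0 'n cpoly)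
    = gen (m, ?w I) + (\<Sum>J \<in> {J. int (card J) = k} - {I}. gen (if J = I then m else 0, ?w J))"
    using assms by (subst sum.remove[of _ I]) auto
  moreover have "(\<Sum>J \<in> {J. int (card J) = k} - {I}. gen (if J = I then m else 0, ?w J)) \<in> pm.span S"
    using gen_zero_in_span d_wedge_list_of_closed by (intro pm.span_sum) (simp del: map_map)
  ultimately have "(\<Sum>J | int (card J) = k. gen (if J = I then m else 0, ?w J)) - gen (m, ?w I) \<in> pm.span S"
    by (simp only: add_diff_cancel_left')
  then show ?thesis
    by (simp only: normal_chain_def tensor_conv S[symmetric] rel_class_eq_iff)
qed

text \<open>With a repeated variable the form is zero. Otherwise the variables are sorted into the
  chosen order by transpositions.\<close>

lemma tensor_var_forms_normal:
  assumes "int (length is) = k"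
  shows "\<exists>\<mu>. tensor poly_module (poly_forms k) m (d_wedge (map pvar is)) = normal_chain k (\<mu> :: 'n set \<Rightarrow> _)"
proof (cases "distinct is")
  case False
  have "\<not> distinct (map (kaehler_d pm_scale) (map pvar is :: 'n cpoly list))"
    using False by (simp add: distinct_map)
  then have w: "d_wedge (map pvar is :: 'n cpoly list) = \<zero>\<^bsub>poly_forms k\<^esub>"
    unfolding kaehler_forms_def using assms
    by (intro wedge_not_distinct) (auto simp: tuples_def kaehler_d_closed)
  have "\<zero>\<^bsub>poly_forms k\<^esub> = 0 \<odot>\<^bsub>poly_forms k\<^esub> d_wedge (map pvar is :: 'n cpoly list)"
    unfolding w by (simp add: kaehler_forms_def exterior_power_def presented_module_simps)
  then have "tensor poly_module (poly_forms k) m (d_wedge (map pvar is))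
    = 0 \<odot>\<^bsub>poly_tensors k\<^esub> tensor poly_module (poly_forms k) m (d_wedge (map pvar is :: 'n cpoly list))"
    using assms by (metis tensor_linear(4) UNIV_I d_wedge_closed length_map poly_module_simps(1) w)
  also have "\<dots> = normal_chain k (\<lambda>I :: 'n set. 0)"
    using assms by (simp add: poly_tensors_zero_smult tensor_closed d_wedge_closed normal_chain_zero del: map_map)
  finally show ?thesis by blast
next
  case True
  have "mset is = mset (list_of (set is))"
    using True by (simp add: list_of flip: set_eq_iff_mset_eq_distinct)
  \<comment> \<open>Quantifying over m makes the property stable under transpositions, since the
    sign is absorbed by passing from m to -m.\<close>
  then have "\<forall>m. \<exists>\<mu>. tensor poly_module (poly_forms k) m (d_wedge (map pvar is)) = normal_chain k (\<mu> :: 'n set \<Rightarrow> _)"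
  proof (rule swap_closed_mset[where Q = "\<lambda>is. \<forall>m. \<exists>\<mu>. tensor poly_module (poly_forms k) m
      (d_wedge (map pvar is)) = normal_chain k (\<mu> :: 'n set \<Rightarrow> _)"])
    have "int (card (set is)) = k" using True assms by (simp add: distinct_card)
    then show "\<forall>m. \<exists>\<mu>. tensor poly_module (poly_forms k) m (d_wedge (map pvar (list_of (set is))))
      = normal_chain k (\<mu> :: 'n set \<Rightarrow> _)"
      by (metis normal_chain_single)
  next
    fix zs :: "'n list" and i j
    assume *: "length zs = length (list_of (set is))" "i < j" "j < length zs"
      "\<forall>m. \<exists>\<mu>. tensor poly_module (poly_forms k) m (d_wedge (map pvar zs)) = normal_chain k (\<mu> :: 'n set \<Rightarrow> _)"
    let ?zs = "map (kaehler_d pm_scale) (map pvar zs :: 'n cpoly list)"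
    have len: "int (length zs) = k" using * assms True by (simp add: list_of distinct_card)
    have "d_wedge (map pvar (zs[i := zs ! j, j := zs ! i]) :: 'n cpoly list)
      = wedge (kaehler pm_scale) (?zs[i := ?zs ! j, j := ?zs ! i])"
      using * by (simp add: map_update)
    also have "\<dots> = (-1) \<odot>\<^bsub>poly_forms k\<^esub> d_wedge (map pvar zs)"
      unfolding kaehler_forms_def
      by (rule wedge_swap) (use * len in \<open>auto simp: tuples_def kaehler_d_closed kaehler_closed\<close>)
    finally have w: "d_wedge (map pvar (zs[i := zs ! j, j := zs ! i]) :: 'n cpoly list)
      = (-1) \<odot>\<^bsub>poly_forms k\<^esub> d_wedge (map pvar zs)" .
    have "tensor poly_module (poly_forms k) m (d_wedge (map pvar (zs[i := zs ! j, j := zs ! i])))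
      = tensor poly_module (poly_forms k) (- m) (d_wedge (map pvar zs))" for m :: "'n cpoly"
      unfolding w using len tensor_linear(3)[of m poly_module "d_wedge (map pvar zs)" "poly_forms k" "-1"]
      by (simp add: tensor_linear(4) d_wedge_closed del: map_map)
    then show "\<forall>m. \<exists>\<mu>. tensor poly_module (poly_forms k) m (d_wedge (map pvar (zs[i := zs ! j, j := zs ! i])))
      = normal_chain k (\<mu> :: 'n set \<Rightarrow> _)"
      using *(4) by simp
  qed
  then show ?thesis by blast
qed

text \<open>Multilinearity replaces the 1-forms by differentials of variables one slot at a time.
  Scalars that come out of a slot move into m, hence again the quantifier over m.\<close>

lemma tensor_wedge_normal:
  assumes "xs \<in> tuples (carrier (kaehler pm_scale)) k"
  shows "\<exists>\<mu>. tensor poly_module (poly_forms k) m (wedge (kaehler pm_scale) xs) = normal_chain k (\<mu> :: 'n set \<Rightarrow> _)"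
proof -
  let ?K = "kaehler pm_scale :: ('n cpoly, ('n cpoly \<Rightarrow>\<^sub>0 'n cpoly) set) module"
  define Q where "Q xs \<longleftrightarrow> (\<forall>m. \<exists>\<mu>. tensor poly_module (poly_forms k) m (wedge ?K xs)
    = normal_chain k (\<mu> :: 'n set \<Rightarrow> _))" for xs
  have "Q xs"
  proof (rule lists_extend[where B = "range (\<lambda>j. kaehler_d pm_scale (pvar j))" and V = "carrier ?K" and k = "length xs"])
    fix zs :: "('n cpoly \<Rightarrow>\<^sub>0 'n cpoly) set list"
    assume "zs \<in> lists (range (\<lambda>j. kaehler_d pm_scale (pvar j)))" "length zs = length xs"
    then obtain "is" where zs: "zs = map (kaehler_d pm_scale) (map pvar is)" "length is = length xs"
      by (metis (no_types, lifting) ex_map_conv in_listsD length_map map_map rangeE comp_def)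
    then show "Q zs"
      using assms unfolding Q_def zs(1) by (intro allI tensor_var_forms_normal) (simp add: tuples_def)
  next
    fix zs i x
    assume zs: "zs \<in> lists (carrier ?K)" "length zs = length xs" "i < length xs" "x \<in> carrier ?K"
      and base: "\<And>b. b \<in> range (\<lambda>j. kaehler_d pm_scale (pvar j)) \<Longrightarrow> Q (zs[i := b])"
    have tup: "zs \<in> tuples (carrier ?K) k" and i: "i < length zs" using zs assms by (auto simp: tuples_def)
    have cl: "wedge ?K (zs[i := x]) \<in> carrier (poly_forms k)" if "x \<in> carrier ?K" for x
      unfolding kaehler_forms_def
      by (rule wedge_closed) (use tup that set_update_subset_insert[of zs i x] in \<open>auto simp: tuples_def in_lists_conv_set\<close>)
    show "Q (zs[i := x])"
      using zs(4)
    proof (induction rule: kaehler_induct)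
      case (var j)
      then show ?case by (intro base) simp
    next
      case (add x y)
      show ?case
        unfolding Q_def
      proof
        fix m
        obtain \<mu> \<nu> where "tensor poly_module (poly_forms k) m (wedge ?K (zs[i := x])) = normal_chain k (\<mu> :: 'n set \<Rightarrow> _)"
          "tensor poly_module (poly_forms k) m (wedge ?K (zs[i := y])) = normal_chain k (\<nu> :: 'n set \<Rightarrow> _)"
          using add unfolding Q_def by blast
        moreover have "wedge ?K (zs[i := x \<oplus>\<^bsub>?K\<^esub> y])
          = wedge ?K (zs[i := x]) \<oplus>\<^bsub>poly_forms k\<^esub> wedge ?K (zs[i := y])"
          unfolding kaehler_forms_def by (rule wedge_linear(1)[OF tup i add(1,2)])
        ultimately have "tensor poly_module (poly_forms k) m (wedge ?K (zs[i := x \<oplus>\<^bsub>?K\<^esub> y]))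
          = normal_chain k (\<lambda>I. \<mu> I + \<nu> I)"
          using add by (simp add: tensor_linear(2) cl normal_chain_add)
        then show "\<exists>\<mu>. tensor poly_module (poly_forms k) m (wedge ?K (zs[i := x \<oplus>\<^bsub>?K\<^esub> y])) = normal_chain k (\<mu> :: 'n set \<Rightarrow> _)"
          by blast
      qed
    next
      case (smult r x)
      have w: "wedge ?K (zs[i := r \<odot>\<^bsub>?K\<^esub> x]) = r \<odot>\<^bsub>poly_forms k\<^esub> wedge ?K (zs[i := x])"
        unfolding kaehler_forms_def by (rule wedge_linear(2)[OF tup i smult(1)])
      have "tensor poly_module (poly_forms k) m (wedge ?K (zs[i := r \<odot>\<^bsub>?K\<^esub> x]))
        = tensor poly_module (poly_forms k) (m * r) (wedge ?K (zs[i := x]))" for m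
        unfolding w using tensor_linear(3)[of m poly_module "wedge ?K (zs[i := x])" "poly_forms k" r] smult(1)
        by (simp add: tensor_linear(4) cl)
      then show ?case using smult(2) unfolding Q_def by simp
    qed
  qed (use assms in \<open>auto simp: tuples_def kaehler_d_closed\<close>)
  then show ?thesis unfolding Q_def by blast
qed

lemma tensor_normal:
  assumes "w \<in> carrier (poly_forms k)"
  shows "\<forall>m. \<exists>\<mu>. tensor poly_module (poly_forms k) m w = normal_chain k (\<mu> :: 'n set \<Rightarrow> _)"
  using assms
proof (induction rule: presented_module_induct[where X = "tuples (carrier (kaehler pm_scale)) k"
    and S = "exterior_relations (kaehler pm_scale) k", folded exterior_power_def kaehler_forms_def,
    consumes 1, case_names zero gen add smult])
  case zero
  have w0: "\<zero>\<^bsub>poly_forms k\<^esub> \<in> carrier (poly_forms k)"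
    unfolding kaehler_forms_def exterior_power_def by (rule presented_module_zero_closed)
  have "\<zero>\<^bsub>poly_forms k\<^esub> = 0 \<odot>\<^bsub>poly_forms k\<^esub> \<zero>\<^bsub>poly_forms k\<^esub>"
    by (simp add: kaehler_forms_def exterior_power_def presented_module_simps)
  then have "tensor poly_module (poly_forms k) m \<zero>\<^bsub>poly_forms k\<^esub> = normal_chain k (\<lambda>I :: 'n set. 0)" for m
  proof -
    have "tensor poly_module (poly_forms k) m (0 \<odot>\<^bsub>poly_forms k\<^esub> \<zero>\<^bsub>poly_forms k\<^esub>)
      = 0 \<odot>\<^bsub>poly_tensors k\<^esub> tensor poly_module (poly_forms k) m \<zero>\<^bsub>poly_forms k\<^esub>"
      using w0 by (intro tensor_linear(4)) simp_all
    also have "\<dots> = \<zero>\<^bsub>poly_tensors k\<^esub>"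
      using w0 by (intro poly_tensors_zero_smult tensor_closed) simp_all
    finally show ?thesis by (simp add: normal_chain_zero flip: \<open>_ = 0 \<odot>\<^bsub>poly_forms k\<^esub> _\<close>)
  qed
  then show ?case by blast
next
  case (gen xs)
  then have "generator_class (tuples (carrier (kaehler pm_scale)) k) (exterior_relations (kaehler pm_scale) k) xs
    = wedge (kaehler pm_scale) xs"
    by (auto simp: wedge_def tuples_def)
  then show ?case using tensor_wedge_normal[OF gen] by simp
next
  case (add w w')
  show ?case
  proof
    fix m
    obtain \<mu> \<nu> where "tensor poly_module (poly_forms k) m w = normal_chain k (\<mu> :: 'n set \<Rightarrow> _)"
      "tensor poly_module (poly_forms k) m w' = normal_chain k (\<nu> :: 'n set \<Rightarrow> _)"
      using add(3,4) by blast
    then have "tensor poly_module (poly_forms k) m (w \<oplus>\<^bsub>poly_forms k\<^esub> w') = normal_chain k (\<lambda>I. \<mu> I + \<nu> I)"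
      using add(1,2) by (simp add: tensor_linear(2) normal_chain_add)
    then show "\<exists>\<mu>. tensor poly_module (poly_forms k) m (w \<oplus>\<^bsub>poly_forms k\<^esub> w') = normal_chain k (\<mu> :: 'n set \<Rightarrow> _)"
      by blast
  qed
next
  case (smult r w)
  have "tensor poly_module (poly_forms k) m (r \<odot>\<^bsub>poly_forms k\<^esub> w) = tensor poly_module (poly_forms k) (m * r) w" for m
    using tensor_linear(3)[of m poly_module w "poly_forms k" r] smult(1) by (simp add: tensor_linear(4))
  then show ?case using smult(2) by simp
qed

text \<open>Existence of the normal form. That a chain determines its coefficients follows later,
  from the values of \<open>star\<close> on variables.\<close>

lemma poly_tensors_normal:
  assumes "x \<in> carrier (poly_tensors k)"
  shows "\<exists>\<mu>. x = normal_chain k (\<mu> :: 'n set \<Rightarrow> _)"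
  using assms
proof (induction rule: presented_module_induct[where X = "carrier poly_module \<times> carrier (poly_forms k)"
    and S = "tensor_relations poly_module (poly_forms k)", folded tensor_product_def, consumes 1, case_names zero gen add smult])
  case zero
  show ?case using normal_chain_zero by (intro exI) (rule sym)
next
  case (gen x)
  obtain m w where x: "x = (m, w)" "w \<in> carrier (poly_forms k)" using gen by auto
  then show ?case using tensor_normal[of w] by (auto simp: tensor_def)
next
  case (add C D)
  then obtain \<mu> \<nu> where "C = normal_chain k (\<mu> :: 'n set \<Rightarrow> _)" "D = normal_chain k (\<nu> :: 'n set \<Rightarrow> _)"
    by blast
  then show ?case using normal_chain_add by blast
next
  case (smult r C)
  then obtain \<mu> where "C = normal_chain k (\<mu> :: 'n set \<Rightarrow> _)" by blast
  then show ?case using normal_chain_smult by blast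
qed

end

section \<open>Contraction with the volume form\<close>

text \<open>There is no case for scalars, because a coefficient can be absorbed into m. Additive
  statements can thus be tested on elementary chains.\<close>

lemma poly_chains_induct [consumes 1, case_names zero elem add]:
  fixes x :: "('n::finite cpoly, 'n cpoly) poisson_chain"
  assumes x: "x \<in> carrier (poly_tensors k)"
    and zero: "Q \<zero>\<^bsub>poly_tensors k\<^esub>"
    and elem: "\<And>m as. int (length as) = k \<Longrightarrow> Q (elementary_chain pm_scale (*) m as)"
    and add: "\<And>x y. x \<in> carrier (poly_tensors k) \<Longrightarrow> y \<in> carrier (poly_tensors k)
      \<Longrightarrow> Q x \<Longrightarrow> Q y \<Longrightarrow> Q (x \<oplus>\<^bsub>poly_tensors k\<^esub> y)"
  shows "Q x"
proof -
  let ?S = "tensor_relations (poly_module :: ('n cpoly, _) module) (poly_forms k)"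
  let ?g = "\<lambda>\<mu> I. gen (\<mu> I, d_wedge (map pvar (list_of I))) :: _ \<Rightarrow>\<^sub>0 'n cpoly"
  obtain \<mu> :: "'n set \<Rightarrow> 'n cpoly" where \<mu>: "x = normal_chain k \<mu>"
    using poly_tensors_normal[OF refl x] by blast
  have "rel_class ?S (\<Sum>I\<in>F. ?g \<mu> I) \<in> carrier (poly_tensors k) \<and> Q (rel_class ?S (\<Sum>I\<in>F. ?g \<mu> I))"
    if "finite F" "F \<subseteq> {I. int (card I) = k}" for F
    using that
  proof (induction F)
    case empty
    have "rel_class ?S 0 = \<zero>\<^bsub>poly_tensors k\<^esub>" "\<zero>\<^bsub>poly_tensors k\<^esub> \<in> carrier (poly_tensors k)"
      unfolding tensor_product_def by (rule presented_module_zero[symmetric], rule presented_module_zero_closed)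
    then show ?case using zero by simp
  next
    case (insert I F)
    let ?e = "elementary_chain pm_scale (*) (\<mu> I) (map pvar (list_of I))"
    have len: "int (length (map pvar (list_of I) :: 'n cpoly list)) = k" using insert by (simp add: list_of)
    have "rel_class ?S (\<Sum>J\<in>insert I F. ?g \<mu> J) = rel_class ?S (?g \<mu> I + (\<Sum>J\<in>F. ?g \<mu> J))"
      using insert by simp
    also have "\<dots> = ?e \<oplus>\<^bsub>poly_tensors k\<^esub> rel_class ?S (\<Sum>J\<in>F. ?g \<mu> J)"
      unfolding elementary_chain_conv[OF len] tensor_conv tensor_product_def presented_module_add ..
    finally have *: "rel_class ?S (\<Sum>J\<in>insert I F. ?g \<mu> J) = ?e \<oplus>\<^bsub>poly_tensors k\<^esub> rel_class ?S (\<Sum>J\<in>F. ?g \<mu> J)" .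
    have e: "?e \<in> carrier (poly_tensors k)" by (rule elementary_chain_closed[OF len])
    have IH: "rel_class ?S (\<Sum>J\<in>F. ?g \<mu> J) \<in> carrier (poly_tensors k)" "Q (rel_class ?S (\<Sum>J\<in>F. ?g \<mu> J))"
      using insert by simp_all
    show ?case
      unfolding * using poly_tensors_closed(1)[OF e IH(1)] add[OF e IH(1) elem[OF len] IH(2)] by blast
  qed
  from this[of "{I. int (card I) = k}"] show ?thesis
    unfolding \<mu> normal_chain_def by simp
qed

text \<open>The coefficient of x_1 \<and> ... \<and> x_k \<and> db_1 \<and> ... \<and> db_(n-k) with
  respect to the volume form.\<close>

definition form_det :: "'n::finite cpoly list \<Rightarrow> ('n cpoly \<Rightarrow>\<^sub>0 'n cpoly) set list \<Rightarrow> 'n cpoly" where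
  "form_det bs xs = list_det (map class_gradient xs @ map gradient bs)"

definition tensor_det :: "'n::finite cpoly list
    \<Rightarrow> 'n cpoly \<times> (('n cpoly \<Rightarrow>\<^sub>0 'n cpoly) set list \<Rightarrow>\<^sub>0 'n cpoly) set \<Rightarrow> 'n cpoly" where
  "tensor_det bs = (\<lambda>(m, w). m * class_ext (form_det bs) w)"

text \<open>Contraction of a chain with the volume form \<open>dX\<^sub>1 \<and> \<dots> \<and> dX\<^sub>n\<close>.\<close>

definition star :: "int \<Rightarrow> ('n::finite cpoly, 'n cpoly) poisson_chain \<Rightarrow> 'n cpoly list \<Rightarrow> 'n cpoly" where
  "star k c bs = (if int (length bs) = int CARD('n) - k then class_ext (tensor_det bs) c else 0)"

context
  fixes k :: int and bs :: "'n::finite cpoly list"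
  assumes bs: "int (length bs) = int CARD('n) - k"
begin

lemma form_det_relations:
  assumes "s \<in> exterior_relations (kaehler pm_scale) k"
  shows "lin_ext (form_det bs) s = 0"
proof -
  let ?K = "kaehler pm_scale :: ('n cpoly, ('n cpoly \<Rightarrow>\<^sub>0 'n cpoly) set) module"
  have upd: "map class_gradient (xs[i := x]) @ map gradient bs
    = (map class_gradient xs @ map gradient bs)[i := class_gradient x]"
    if "i < length xs" for xs :: "('n cpoly \<Rightarrow>\<^sub>0 'n cpoly) set list" and i x
    using that by (simp add: map_update list_update_append1)
  have len: "length (map class_gradient xs @ map gradient bs) = CARD('n)" "length xs \<le> CARD('n)"
    if "xs \<in> tuples (carrier ?K) k" for xs
    using that bs by (auto simp: tuples_def)
  consider xs i x y where "s = gen (xs[i := x \<oplus>\<^bsub>?K\<^esub> y]) - gen (xs[i := x]) - gen (xs[i := y])"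
      "xs \<in> tuples (carrier ?K) k" "i < length xs" "x \<in> carrier ?K" "y \<in> carrier ?K"
    | xs i r x where "s = gen (xs[i := r \<odot>\<^bsub>?K\<^esub> x]) - pm_scale r (gen (xs[i := x]))"
      "xs \<in> tuples (carrier ?K) k" "i < length xs" "x \<in> carrier ?K"
    | xs where "s = gen xs" "xs \<in> tuples (carrier ?K) k" "\<not> distinct xs"
    using assms unfolding exterior_relations_def by blast
  then show ?thesis
  proof cases
    case 1
    then show ?thesis
      using len[OF 1(2)]
      by (simp add: form_det_def upd class_gradient_add list_det_add del: map_append length_append length_map)
  next
    case 2
    then show ?thesis
      using len[OF 2(2)]
      by (simp add: form_det_def upd class_gradient_smult list_det_scale del: map_append length_append length_map)
  next
    case 3
    then obtain i j where "i \<noteq> j" "i < length xs" "j < length xs" "xs ! i = xs ! j"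
      by (auto simp: distinct_conv_nth)
    then have "form_det bs xs = 0"
      unfolding form_det_def using len(2)[OF 3(2)]
      by (intro list_det_eq_0[of i j]) (auto simp: nth_append)
    then show ?thesis using 3 by simp
  qed
qed

lemma tensor_det_relations:
  assumes "s \<in> tensor_relations poly_module (poly_forms k)"
  shows "lin_ext (tensor_det bs) s = 0"
proof -
  have add: "class_ext (form_det bs) (w \<oplus>\<^bsub>poly_forms k\<^esub> w') = class_ext (form_det bs) w + class_ext (form_det bs) w'"
    if "w \<in> carrier (poly_forms k)" "w' \<in> carrier (poly_forms k)" for w w'
    unfolding kaehler_forms_def exterior_power_def
    by (rule class_ext_linear(1)[OF form_det_relations that[unfolded kaehler_forms_def exterior_power_def]])
  have smult: "class_ext (form_det bs) (r \<odot>\<^bsub>poly_forms k\<^esub> w) = r * class_ext (form_det bs) w"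
    if "w \<in> carrier (poly_forms k)" for r w
    unfolding kaehler_forms_def exterior_power_def
    by (rule class_ext_linear(2)[OF form_det_relations that[unfolded kaehler_forms_def exterior_power_def]])
  show ?thesis
    using assms unfolding tensor_relations_def poly_module_simps
    by (elim UnE CollectE exE conjE; hypsubst)
      (simp_all add: tensor_det_def add smult distrib_left distrib_right mult.left_commute mult.commute)
qed

lemma star_add:
  "x \<in> carrier (poly_tensors k) \<Longrightarrow> y \<in> carrier (poly_tensors k)
    \<Longrightarrow> star k (x \<oplus>\<^bsub>poly_tensors k\<^esub> y) bs = star k x bs + star k y bs"
  using bs unfolding star_def tensor_product_def
  by (simp add: class_ext_linear(1)[OF tensor_det_relations])

lemma star_smult:
  "x \<in> carrier (poly_tensors k) \<Longrightarrow> star k (r \<odot>\<^bsub>poly_tensors k\<^esub> x) bs = r * star k x bs"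
  using bs unfolding star_def tensor_product_def
  by (simp add: class_ext_linear(2)[OF tensor_det_relations])

lemma star_zero: "star k \<zero>\<^bsub>poly_tensors k\<^esub> bs = 0"
  using bs unfolding star_def tensor_product_def
  by (simp add: class_ext_zero[OF tensor_det_relations])

lemma class_ext_d_wedge:
  "int (length as) = k \<Longrightarrow> class_ext (form_det bs) (d_wedge as) = jacobian (as @ bs)"
  unfolding wedge_def
  by (subst class_ext_gen)
    (auto intro: form_det_relations simp: form_det_def jacobian_def class_gradient_d comp_def)

lemma star_elementary:
  assumes "int (length as) = k"
  shows "star k (elementary_chain pm_scale (*) m as) bs = m * jacobian (as @ bs)"
  using bs assms unfolding star_def elementary_chain_conv[OF assms] tensor_def
  by (subst class_ext_gen[OF tensor_det_relations]) (simp_all add: tensor_det_def class_ext_d_wedge)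

lemma star_normal:
  "star k (normal_chain k \<mu>) bs = (\<Sum>I | int (card I) = k. \<mu> I * jacobian (map pvar (list_of I) @ bs))"
proof -
  have "star k (normal_chain k \<mu>) bs = (\<Sum>I | int (card I) = k. tensor_det bs (\<mu> I, d_wedge (map pvar (list_of I))))"
    using bs unfolding star_def normal_chain_def
    by (simp add: class_ext_rel_class[OF tensor_det_relations] lin_ext_sum)
  also have "\<dots> = (\<Sum>I | int (card I) = k. \<mu> I * jacobian (map pvar (list_of I) @ bs))"
    by (rule sum.cong) (auto simp: tensor_det_def class_ext_d_wedge list_of simp del: map_map)
  finally show ?thesis .
qed

end

lemma star_wrong_length: "int (length bs) \<noteq> int CARD('n) - k \<Longrightarrow> star k c bs = 0"
  for bs :: "'n::finite cpoly list"
  by (simp add: star_def)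

section \<open>Multiderivations and their values on variables\<close>

lemma skew_multiderivations_add:
  assumes "P \<in> skew_multiderivations pm_scale l" "Q \<in> skew_multiderivations pm_scale l"
  shows "(\<lambda>fs. P fs + Q fs :: 'n cpoly) \<in> skew_multiderivations pm_scale l"
  using assms unfolding skew_multiderivations_def by (auto simp: algebra_simps pm.scale_right_distrib)

lemma skew_multiderivations_scale:
  assumes "P \<in> skew_multiderivations pm_scale l"
  shows "(\<lambda>fs. pm_scale c (P fs) :: 'n cpoly) \<in> skew_multiderivations pm_scale l"
proof -
  have "pm_scale c (pm_scale d f) = pm_scale d (pm_scale c f)" for d and f :: "'n cpoly"
    by (simp add: mult.commute)
  then show ?thesis
    using assms unfolding skew_multiderivations_def
    by (auto simp: pm.scale_right_distrib pm_scale_mult_left[symmetric] pm_scale_mult_right[symmetric]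
      simp del: pm.scale_scale)
qed

lemma skew_multiderivations_elementary:
  fixes m :: "'n::finite cpoly"
  assumes "int (length as) = k"
  shows "(\<lambda>bs. if int (length bs) = int CARD('n) - k then m * jacobian (as @ bs) else 0)
    \<in> skew_multiderivations pm_scale (int CARD('n) - k)"
proof -
  have upd: "as @ bs[i := a] = (as @ bs)[length as + i := a]" for bs i and a :: "'n cpoly"
    by (simp add: list_update_append)
  have "jacobian (as @ bs[i := bs ! j, j := bs ! i]) = - jacobian (as @ bs)"
    if "int (length bs) = int CARD('n) - k" "i < j" "j < length bs" for bs i j
    using jacobian_swap[of "as @ bs" "length as + i" "length as + j"] that assms
    by (simp add: list_update_append nth_append)
  then show ?thesis
    unfolding skew_multiderivations_def using assms
    by (auto simp: upd jacobian_update_add jacobian_update_mult jacobian_update_scale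
      pm_scale_mult_right algebra_simps)
qed

lemma star_in_skew_multiderivations:
  fixes x :: "('n::finite cpoly, 'n cpoly) poisson_chain"
  assumes "x \<in> carrier (poly_tensors k)"
  shows "star k x \<in> skew_multiderivations pm_scale (int CARD('n) - k)"
  using assms
proof (induction rule: poly_chains_induct)
  case zero
  have "star k \<zero>\<^bsub>poly_tensors k\<^esub> = (\<lambda>bs :: 'n cpoly list. 0)"
    by (rule ext) (metis star_zero star_wrong_length)
  then show ?case by (simp add: skew_multiderivations_def)
next
  case (elem m as)
  have "star k (elementary_chain pm_scale (*) m as)
    = (\<lambda>bs. if int (length bs) = int CARD('n) - k then m * jacobian (as @ bs) else 0)"
    using elem by (auto simp: star_elementary star_wrong_length)
  then show ?case using skew_multiderivations_elementary[OF elem] by simp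
next
  case (add x y)
  have "star k (x \<oplus>\<^bsub>poly_tensors k\<^esub> y) = (\<lambda>bs. star k x bs + star k y bs)"
  proof
    fix bs :: "'n cpoly list"
    show "star k (x \<oplus>\<^bsub>poly_tensors k\<^esub> y) bs = star k x bs + star k y bs"
      using star_add[OF _ add(1,2)] star_wrong_length[of bs k]
      by (cases "int (length bs) = int CARD('n) - k") simp_all
  qed
  then show ?case using skew_multiderivations_add[OF add(3,4)] by simp
qed

text \<open>In each slot P is a derivation, so \<open>derivation_expand\<close> reduces to lists of
  variables. Skewness then reduces distinct variables to the chosen order.\<close>

lemma skew_multiderivations_ext:
  fixes P :: "'n::finite cpoly list \<Rightarrow> 'n cpoly"
  assumes P: "P \<in> skew_multiderivations pm_scale l"
    and vars: "\<And>J :: 'n set. int (card J) = l \<Longrightarrow> P (map pvar (list_of J)) = 0"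
  shows "P fs = 0"
proof (cases "int (length fs) = l")
  case False
  then show ?thesis using P by (simp add: skew_multiderivations_def)
next
  case True
  have add: "P (fs[i := a + b]) = P (fs[i := a]) + P (fs[i := b])"
    and scale: "P (fs[i := pm_scale c a]) = pm_scale c (P (fs[i := a]))"
    and mult: "P (fs[i := a * b]) = P (fs[i := a]) * b + a * P (fs[i := b])"
    if "int (length fs) = l" "i < length fs" for fs i a b c
    using P that by (simp_all add: skew_multiderivations_def)
  have swap: "P (fs[i := fs ! j, j := fs ! i]) = - P fs"
    if "int (length fs) = l" "i < j" "j < length fs" for fs i j
    using P that by (simp add: skew_multiderivations_def)
  have base: "P (map pvar is) = 0" if len: "int (length is) = l" for "is" :: "'n list"
  proof (cases "distinct is")
    case True
    have "mset is = mset (list_of (set is))"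
      using True by (simp add: list_of flip: set_eq_iff_mset_eq_distinct)
    then show ?thesis
    proof (rule swap_closed_mset[where Q = "\<lambda>is. P (map pvar is) = 0"])
      show "P (map pvar (list_of (set is))) = 0" using True len by (intro vars) (simp add: distinct_card)
      fix zs :: "'n list" and i j
      assume "length zs = length (list_of (set is))" "i < j" "j < length zs" "P (map pvar zs) = 0"
      then show "P (map pvar (zs[i := zs ! j, j := zs ! i])) = 0"
        using swap[of "map pvar zs" i j] len True by (simp add: map_update list_of distinct_card)
    qed
  next
    case False
    then obtain i j where ij: "i < j" "j < length is" "is ! i = is ! j"
      by (metis distinct_conv_nth linorder_neqE_nat)
    then have "(map pvar is)[i := map pvar is ! j, j := map pvar is ! i] = (map pvar is :: 'n cpoly list)"
      by (metis length_map list_update_id nth_map order_less_trans)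
    \<comment> \<open>Exchanging two equal entries changes nothing but the sign, so the value is
      zero.\<close>
    then have "P (map pvar is) = - P (map pvar is)"
      using swap[of "map pvar is" i j] ij len by simp
    then show ?thesis by (metis cpoly_add_self_eq_0 eq_neg_iff_add_eq_0)
  qed
  show ?thesis
  proof (rule lists_extend[where B = "range pvar" and V = UNIV and k = "length fs" and xs = fs])
    fix zs :: "'n cpoly list" assume "zs \<in> lists (range pvar)" "length zs = length fs"
    then obtain "is" where "zs = map pvar is" "length is = length fs"
      by (metis (no_types, lifting) ex_map_conv in_listsD length_map rangeE)
    then show "P zs = 0" using base True by simp
  next
    fix zs :: "'n cpoly list" and i x
    assume *: "length zs = length fs" "i < length fs" "\<And>b. b \<in> range pvar \<Longrightarrow> P (zs[i := b]) = 0"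
    have len: "int (length zs) = l" "i < length zs" using * True by simp_all
    have "is_derivation (\<lambda>f. P (zs[i := f]))"
      using add[OF len] scale[OF len] mult[OF len] by (simp add: is_derivation_def)
    from derivation_expand[OF this, of x] show "P (zs[i := x]) = 0" using *(3) by simp
  qed auto
qed

section \<open>Bijectivity of the contraction\<close>

lemma card_Compl: "card (- J) = CARD('n) - card J" for J :: "'n::finite set"
  by (simp add: Compl_eq_Diff_UNIV card_Diff_subset)

text \<open>The sizes add up to n, so sets that are not complementary overlap and give two equal
  rows. For complementary sets the value is a sign that depends on \<open>list_of\<close>; only its
  square is fixed.\<close>

lemma jacobian_disjoint_square:
  fixes I J :: "'n::finite set"
  assumes "int (card I) = int CARD('n) - int (card J)"
  shows "jacobian (map pvar (list_of I) @ map pvar (list_of J)) * jacobian (map pvar (list_of I) @ map pvar (list_of J))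
    = (if I = - J then 1 else 0)"
    and "I \<noteq> - J \<Longrightarrow> jacobian (map pvar (list_of I) @ map pvar (list_of J)) = 0"
proof -
  let ?l = "list_of I @ list_of J"
  show 0: "jacobian (map pvar (list_of I) @ map pvar (list_of J)) = 0" if "I \<noteq> - J"
  proof -
    have "I \<inter> J \<noteq> {}"
    proof
      assume "I \<inter> J = {}"
      then have "I \<subseteq> - J" by blast
      moreover have "card (- J) = card I" using assms by (simp add: card_Compl)
      ultimately show False using that card_subset_eq[of "- J" I] by simp
    qed
    then have "\<not> distinct (map pvar (list_of I) @ map pvar (list_of J) :: 'n cpoly list)"
      by (auto simp: list_of)
    then show ?thesis using assms by (intro jacobian_not_distinct) (simp_all add: list_of)
  qed
  have "jacobian (map pvar (list_of I) @ map pvar (list_of J)) * jacobian (map pvar (list_of I) @ map pvar (list_of J)) = 1"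
    if "I = - J"
    using jacobian_vars_square[of ?l] that by (simp add: list_of)
  then show "jacobian (map pvar (list_of I) @ map pvar (list_of J)) * jacobian (map pvar (list_of I) @ map pvar (list_of J))
    = (if I = - J then 1 else 0)" using 0 by simp
qed

text \<open>Evaluation on the variables of J singles out the coefficient at the complement of J, up
  to a sign.\<close>

lemma star_normal_vars:
  fixes J :: "'n::finite set"
  assumes J: "int (card J) = int CARD('n) - k"
  shows "star k (normal_chain k \<mu>) (map pvar (list_of J))
    = \<mu> (- J) * jacobian (map pvar (list_of (- J)) @ map pvar (list_of J))"
proof -
  have cJ: "int (card (- J)) = k" using J card_mono[of UNIV J] by (simp add: card_Compl of_nat_diff)
  have "star k (normal_chain k \<mu>) (map pvar (list_of J))
    = (\<Sum>I | int (card I) = k. \<mu> I * jacobian (map pvar (list_of I) @ map pvar (list_of J)))"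
    using J by (intro star_normal) (simp add: list_of)
  also have "\<dots> = (\<Sum>I\<in>{- J}. \<mu> I * jacobian (map pvar (list_of I) @ map pvar (list_of J)))"
    using J cJ by (intro sum.mono_neutral_right) (auto simp: jacobian_disjoint_square(2))
  finally show ?thesis by simp
qed

lemma normal_chain_closed: "normal_chain k \<mu> \<in> carrier (poly_tensors k)"
  for \<mu> :: "'n::finite set \<Rightarrow> 'n cpoly"
proof -
  let ?g = "\<lambda>I. gen (\<mu> I, d_wedge (map pvar (list_of I))) :: _ \<Rightarrow>\<^sub>0 'n cpoly"
  have "Poly_Mapping.keys (\<Sum>I | int (card I) = k. ?g I) \<subseteq> UNIV \<times> carrier (poly_forms k)"
  proof
    fix p assume "p \<in> Poly_Mapping.keys (\<Sum>I | int (card I) = k. ?g I)"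
    then obtain I where I: "int (card I) = k" "Poly_Mapping.lookup (?g I) p \<noteq> 0"
      unfolding in_keys_iff lookup_sum by (metis (mono_tags, lifting) mem_Collect_eq sum.neutral)
    then have "p = (\<mu> I, d_wedge (map pvar (list_of I)))"
      by (metis lookup_single_not_eq)
    then show "p \<in> UNIV \<times> carrier (poly_forms k)"
      using d_wedge_list_of_closed[OF refl I(1)] by simp
  qed
  then show ?thesis
    by (auto simp: normal_chain_def tensor_product_def presented_module_carrier simp del: map_map)
qed

lemma bij_betw_star:
  "bij_betw (star k :: ('n::finite cpoly, 'n cpoly) poisson_chain \<Rightarrow> _) (carrier (poly_tensors k))
    (skew_multiderivations pm_scale (int CARD('n) - k))"
proof (rule bij_betwI')
  fix x y :: "('n cpoly, 'n cpoly) poisson_chain"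
  assume xy: "x \<in> carrier (poly_tensors k)" "y \<in> carrier (poly_tensors k)"
  obtain \<mu> \<nu> :: "'n set \<Rightarrow> 'n cpoly" where n: "x = normal_chain k \<mu>" "y = normal_chain k \<nu>"
    using poly_tensors_normal[OF refl xy(1)] poly_tensors_normal[OF refl xy(2)] by blast
  show "star k x = star k y \<longleftrightarrow> x = y"
  proof
    assume eq: "star k x = star k y"
    have \<mu>\<nu>: "\<mu> I = \<nu> I" if "int (card I) = k" for I
    proof -
      have J: "int (card (- I)) = int CARD('n) - k" using that card_mono[of UNIV I]
        by (simp add: card_Compl of_nat_diff)
      let ?j = "jacobian (map pvar (list_of I) @ map pvar (list_of (- I)))"
      have "\<mu> I * ?j = \<nu> I * ?j"
        using star_normal_vars[OF J, of \<mu>] star_normal_vars[OF J, of \<nu>] eq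
        unfolding n double_compl by argo
      \<comment> \<open>The sign \<open>?j\<close> is its own inverse, so multiplying by it again
        isolates the coefficients.\<close>
      then have "\<mu> I * (?j * ?j) = \<nu> I * (?j * ?j)" by (simp only: mult.assoc[symmetric])
      moreover have "?j * ?j = 1"
        using jacobian_disjoint_square(1)[of I "- I"] that J by simp
      ultimately show ?thesis by simp
    qed
    show "x = y"
      unfolding n normal_chain_def
      by (rule arg_cong[where f = "rel_class _"], rule sum.cong) (simp_all only: mem_Collect_eq \<mu>\<nu>)
  qed simp
next
  fix x :: "('n cpoly, 'n cpoly) poisson_chain"
  assume "x \<in> carrier (poly_tensors k)"
  then show "star k x \<in> skew_multiderivations pm_scale (int CARD('n) - k)"
    by (rule star_in_skew_multiderivations)
next
  fix P :: "'n cpoly list \<Rightarrow> 'n cpoly"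
  assume P: "P \<in> skew_multiderivations pm_scale (int CARD('n) - k)"
  \<comment> \<open>The value of P on the complementary variables, times the sign that evaluation
    will produce once more; the two signs cancel.\<close>
  define \<mu> where "\<mu> I = P (map pvar (list_of (- I))) * jacobian (map pvar (list_of I) @ map pvar (list_of (- I)))" for I :: "'n set"
  let ?x = "normal_chain k \<mu>"
  have x: "?x \<in> carrier (poly_tensors k)"
    by (rule normal_chain_closed)
  \<comment> \<open>The difference is again a multiderivation, so it is enough that it vanishes on
    variables.\<close>
  have "(\<lambda>fs. star k ?x fs + pm_scale (-1) (P fs)) \<in> skew_multiderivations pm_scale (int CARD('n) - k)"
    by (intro skew_multiderivations_add skew_multiderivations_scale P star_in_skew_multiderivations x)
  then have "star k ?x fs + pm_scale (-1) (P fs) = 0" for fs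
  proof (rule skew_multiderivations_ext)
    fix J :: "'n set" assume J: "int (card J) = int CARD('n) - k"
    have cJ: "int (card (- J)) = int CARD('n) - int (card J)"
      using card_mono[of UNIV J] by (simp add: card_Compl of_nat_diff)
    show "star k ?x (map pvar (list_of J)) + pm_scale (-1) (P (map pvar (list_of J))) = 0"
      using jacobian_disjoint_square(1)[OF cJ]
      by (simp add: star_normal_vars[OF J] \<mu>_def mult.assoc pm.scale_minus_left)
  qed
  then have "star k ?x fs = P fs" for fs by (simp add: pm.scale_minus_left)
  then have "P = star k ?x" by auto
  then show "\<exists>x\<in>carrier (poly_tensors k). P = star k x" using x by blast
qed

section \<open>The isomorphism of complexes\<close>

text \<open>Only the map in the middle degree is needed, provided that it matches boundaries and
  cycles as sets. In this form a map that commutes with the differentials only up to sign is good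
  enough.\<close>

lemma homology_module_iso:
  assumes lin: "linear_map V V' \<phi>" and bij: "bij_betw \<phi> (carrier V) (carrier V')"
    and closed: "\<And>x y. x \<in> carrier V \<Longrightarrow> y \<in> carrier V \<Longrightarrow> x \<oplus>\<^bsub>V\<^esub> y \<in> carrier V"
      "\<And>c x. x \<in> carrier V \<Longrightarrow> c \<odot>\<^bsub>V\<^esub> x \<in> carrier V"
    and sub: "f ` carrier U \<subseteq> carrier V" and im: "\<phi> ` f ` carrier U = f' ` carrier U'"
    and ker: "\<And>x. x \<in> carrier V \<Longrightarrow> g x = \<zero>\<^bsub>W\<^esub> \<longleftrightarrow> g' (\<phi> x) = \<zero>\<^bsub>W'\<^esub>"
  shows "isomorphic_modules (homology_module U f V g W) (homology_module U' f' V' g' W')"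
proof -
  let ?N = "f ` carrier U" and ?N' = "f' ` carrier U'"
  let ?H = "homology_module U f V g W" and ?H' = "homology_module U' f' V' g' W'"
  let ?Z = "{x \<in> carrier V. g x = \<zero>\<^bsub>W\<^esub>}" and ?Z' = "{x \<in> carrier V'. g' x = \<zero>\<^bsub>W'\<^esub>}"
  define coset where "coset x = (\<lambda>n. n \<oplus>\<^bsub>V\<^esub> x) ` ?N" for x
  define coset' where "coset' x = (\<lambda>n. n \<oplus>\<^bsub>V'\<^esub> x) ` ?N'" for x
  have add: "\<phi> (x \<oplus>\<^bsub>V\<^esub> y) = \<phi> x \<oplus>\<^bsub>V'\<^esub> \<phi> y" if "x \<in> carrier V" "y \<in> carrier V" for x y
    using lin that by (simp add: linear_map_def)
  have smult: "\<phi> (c \<odot>\<^bsub>V\<^esub> x) = c \<odot>\<^bsub>V'\<^esub> \<phi> x" if "x \<in> carrier V" for c x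
    using lin that by (simp add: linear_map_def)
  have setadd: "\<phi> ` (\<Union>h\<in>S. \<Union>k\<in>T. {h \<oplus>\<^bsub>V\<^esub> k}) = (\<Union>h\<in>\<phi> ` S. \<Union>k\<in>\<phi> ` T. {h \<oplus>\<^bsub>V'\<^esub> k})"
    if "S \<subseteq> carrier V" "T \<subseteq> carrier V" for S T
    unfolding image_UN UN_extend_simps(10)[symmetric]
    by (intro SUP_cong refl) (use that add in auto)
  have H: "carrier ?H = coset ` ?Z" "add ?H = (\<lambda>S T. \<Union>h\<in>S. \<Union>k\<in>T. {h \<oplus>\<^bsub>V\<^esub> k})"
    "module.smult ?H = (\<lambda>c S. \<Union>h\<in>?N. \<Union>k\<in>(\<lambda>x. c \<odot>\<^bsub>V\<^esub> x) ` S. {h \<oplus>\<^bsub>V\<^esub> k})"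
    by (auto simp: homology_module_def quotient_module_def A_RCOSETS_def' a_r_coset_def' set_add_def' coset_def)
  have H': "carrier ?H' = coset' ` ?Z'" "add ?H' = (\<lambda>S T. \<Union>h\<in>S. \<Union>k\<in>T. {h \<oplus>\<^bsub>V'\<^esub> k})"
    "module.smult ?H' = (\<lambda>c S. \<Union>h\<in>?N'. \<Union>k\<in>(\<lambda>x. c \<odot>\<^bsub>V'\<^esub> x) ` S. {h \<oplus>\<^bsub>V'\<^esub> k})"
    by (auto simp: homology_module_def quotient_module_def A_RCOSETS_def' a_r_coset_def' set_add_def' coset'_def)
  have sub_V: "S \<subseteq> carrier V" if "S \<in> carrier ?H" for S
    using that sub closed(1) by (auto simp: H coset_def)
  have image_coset: "\<phi> ` coset x = coset' (\<phi> x)" if "x \<in> carrier V" for x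
    unfolding coset_def coset'_def im[symmetric] image_image
    by (intro image_cong refl) (use sub that add in auto)
  have image_Z: "\<phi> ` ?Z = ?Z'"
    using bij ker by (force simp: bij_betw_def)
  have carrier: "(\<lambda>S. \<phi> ` S) ` carrier ?H = carrier ?H'"
    unfolding H H' image_Z[symmetric] image_image by (intro image_cong refl) (simp add: image_coset)
  have "linear_map ?H ?H' (\<lambda>S. \<phi> ` S)"
    unfolding linear_map_def
  proof (intro conjI ballI allI)
    show "(\<lambda>S. \<phi> ` S) \<in> carrier ?H \<rightarrow> carrier ?H'" using carrier by blast
  next
    fix S T assume "S \<in> carrier ?H" "T \<in> carrier ?H"
    then show "\<phi> ` (S \<oplus>\<^bsub>?H\<^esub> T) = \<phi> ` S \<oplus>\<^bsub>?H'\<^esub> \<phi> ` T"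
      unfolding H(2) H'(2) by (intro setadd sub_V)
  next
    fix c S assume S: "S \<in> carrier ?H"
    have image_smult: "\<phi> ` (\<lambda>x. c \<odot>\<^bsub>V\<^esub> x) ` S = (\<lambda>x. c \<odot>\<^bsub>V'\<^esub> x) ` \<phi> ` S"
      unfolding image_image by (intro image_cong refl) (use sub_V[OF S] smult in auto)
    have smult_sub: "(\<lambda>x. c \<odot>\<^bsub>V\<^esub> x) ` S \<subseteq> carrier V" using sub_V[OF S] closed(2) by auto
    show "\<phi> ` (c \<odot>\<^bsub>?H\<^esub> S) = c \<odot>\<^bsub>?H'\<^esub> \<phi> ` S"
      unfolding H(3) H'(3) setadd[OF sub smult_sub] im image_smult ..
  qed
  moreover have "inj_on (\<lambda>S. \<phi> ` S) (carrier ?H)"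
    using inj_on_image_eq_iff[of \<phi> "carrier V"] bij sub_V by (intro inj_onI) (auto simp: bij_betw_def)
  ultimately show ?thesis
    unfolding isomorphic_modules_def bij_betw_def using carrier by blast
qed

lemma star_add_fun:
  assumes "x \<in> carrier (poly_tensors k)" "y \<in> carrier (poly_tensors k)"
  shows "star k (x \<oplus>\<^bsub>poly_tensors k\<^esub> y) = (\<lambda>bs. star k x bs + star k y bs)"
proof
  fix bs
  show "star k (x \<oplus>\<^bsub>poly_tensors k\<^esub> y) bs = star k x bs + star k y bs"
    using star_add[OF _ assms] star_wrong_length[of bs k]
    by (cases "int (length bs) = int CARD('a) - k") simp_all
qed

lemma star_smult_fun:
  assumes "x \<in> carrier (poly_tensors k)"
  shows "star k (pm_scale c 1 \<odot>\<^bsub>poly_tensors k\<^esub> x) = (\<lambda>bs. pm_scale c (star k x bs))"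
proof
  fix bs
  show "star k (pm_scale c 1 \<odot>\<^bsub>poly_tensors k\<^esub> x) bs = pm_scale c (star k x bs)"
    using star_smult[OF _ assms] star_wrong_length[of bs k]
    by (cases "int (length bs) = int CARD('a) - k") (simp_all flip: pm_scale_conv_mult)
qed

lemma star_zero_fun: "star k \<zero>\<^bsub>poly_tensors k\<^esub> = (\<lambda>bs. 0)"
  by (rule ext) (metis star_zero star_wrong_length)

lemma poly_tensors_zero_closed: "\<zero>\<^bsub>poly_tensors k\<^esub> \<in> carrier (poly_tensors k)"
  unfolding tensor_product_def by (rule presented_module_zero_closed)

lemma star_inj:
  assumes "x \<in> carrier (poly_tensors k)" "y \<in> carrier (poly_tensors k)" "star k x = star k y"
  shows "x = y"
  using bij_betw_star[of k] assms by (auto simp: bij_betw_def inj_on_def)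

lemma pm_scale_sign: "pm_scale ((-1) ^ i) f = (-1) ^ i * (f :: 'n cpoly)"
  by (induction i arbitrary: f) (simp_all add: pm.scale_minus_left)

lemma star_finsum:
  fixes h :: "nat \<Rightarrow> ('n::finite cpoly, 'n cpoly) poisson_chain"
  assumes bs: "int (length bs) = int CARD('n) - k" and "finite F"
    and h: "\<And>i. i \<in> F \<Longrightarrow> h i \<in> carrier (poly_tensors k)"
  shows "star k (\<Oplus>\<^bsub>poly_chains k\<^esub>i\<in>F. h i) bs = (\<Sum>i\<in>F. star k (h i) bs)"
  using \<open>finite F\<close> h
proof (induction F)
  case empty
  interpret C: abelian_monoid "poly_chains k :: (complex, ('n cpoly, 'n cpoly) poisson_chain) module"
    by (rule abelian_monoid_poly_chains)
  show ?case using bs by (simp add: star_zero)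
next
  case (insert i F)
  interpret C: abelian_monoid "poly_chains k :: (complex, ('n cpoly, 'n cpoly) poisson_chain) module"
    by (rule abelian_monoid_poly_chains)
  have "h \<in> F \<rightarrow> carrier (poly_chains k)" "h i \<in> carrier (poly_chains k)" using insert by auto
  then have "(\<Oplus>\<^bsub>poly_chains k\<^esub>i\<in>insert i F. h i) = h i \<oplus>\<^bsub>poly_tensors k\<^esub> (\<Oplus>\<^bsub>poly_chains k\<^esub>i\<in>F. h i)"
    "(\<Oplus>\<^bsub>poly_chains k\<^esub>i\<in>F. h i) \<in> carrier (poly_tensors k)"
    using C.finsum_insert[OF insert(1,2)] C.finsum_closed by auto
  then show ?case using insert bs by (simp add: star_add)
qed

section \<open>Comparison of boundary and coboundary\<close>

context cpoly_bracket
begin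

lemma coboundary_add:
  "poisson_coboundary br (\<lambda>bs. P bs + Q bs) fs = poisson_coboundary br P fs + poisson_coboundary br Q fs"
  by (simp add: poisson_coboundary_def is_derivationD[OF br_derivation] distrib_left sum.distrib)

lemma coboundary_scale:
  "poisson_coboundary br (\<lambda>bs. pm_scale c (P bs)) fs = pm_scale c (poisson_coboundary br P fs)"
  by (simp add: poisson_coboundary_def is_derivationD[OF br_derivation] pm.scale_right_distrib
    pm.scale_sum_right pm_scale_mult_right)

lemma coboundary_zero: "poisson_coboundary br (\<lambda>bs. 0) fs = 0"
  by (simp add: poisson_coboundary_def is_derivationD[OF br_derivation])

end

context unimodular_twist
begin

abbreviation bdry where
  "bdry m as \<equiv> boundary_value pm_scale br (*) mbr m as"

lemma boundary_value_closed:
  assumes k: "int (length as) = k"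
  shows "bdry m as \<in> carrier (poly_tensors (k - 1))"
proof -
  interpret C: abelian_monoid "poly_chains (k - 1) :: (complex, ('n cpoly, 'n cpoly) poisson_chain) module"
    by (rule abelian_monoid_poly_chains)
  have 1: "elementary_chain pm_scale (*) x (nths as (- {i})) \<in> carrier (poly_tensors (k - 1))"
    if "i < length as" for x i
    using that k by (intro elementary_chain_closed) (simp add: length_nths_delete of_nat_diff)
  have 2: "elementary_chain pm_scale (*) x (y # nths as (- {i, j})) \<in> carrier (poly_tensors (k - 1))"
    if "i < j" "j < length as" for x y i j
    using that k by (intro elementary_chain_closed) (simp add: length_nths_delete2 of_nat_diff)
  show ?thesis
    unfolding boundary_value_def Let_def k poly_chains_simps(1)[symmetric]
    by (intro C.a_closed C.finsum_closed Pi_I) (auto intro!: poly_tensors_closed(2) 1 2)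
qed

text \<open>Evaluated on a list of length n - k + 1, this is \<open>jacobian_duality\<close> term by
  term.\<close>

lemma star_boundary_value:
  assumes k: "int (length as) = k"
  shows "star (k - 1) (bdry m as) = (\<lambda>bs. (-1) ^ length as *
    poisson_coboundary br (star k (elementary_chain pm_scale (*) m as)) bs)"
proof
  fix bs :: "'n cpoly list"
  let ?e = "elementary_chain pm_scale (*)"
  show "star (k - 1) (bdry m as) bs = (-1) ^ length as * poisson_coboundary br (star k (?e m as)) bs"
  proof (cases "int (length bs) = int CARD('n) - (k - 1)")
    case True
    interpret C: abelian_monoid "poly_chains (k - 1) :: (complex, ('n cpoly, 'n cpoly) poisson_chain) module"
      by (rule abelian_monoid_poly_chains)
    have len: "length as + length bs = Suc CARD('n)" using True k by simp
    have l1: "int (length (nths as (- {i}))) = k - 1" if "i < length as" for i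
      using that k by (simp add: length_nths_delete of_nat_diff)
    have l2: "int (length (y # nths as (- {i, j}))) = k - 1" if "i < j" "j < length as" for y i j
      using that k by (simp add: length_nths_delete2 of_nat_diff)
    define s1 where "s1 i = (-1) ^ i \<odot>\<^bsub>poly_chains (k - 1)\<^esub> ?e (mbr m (as ! i)) (nths as (- {i}))" for i
    define s2 where "s2 i j = (-1) ^ (i + j) \<odot>\<^bsub>poly_chains (k - 1)\<^esub>
      ?e m (br (as ! i) (as ! j) # nths as (- {i, j}))" for i j
    have c1: "s1 i \<in> carrier (poly_tensors (k - 1))" if "i < length as" for i
      unfolding s1_def poly_chains_simps
      by (intro poly_tensors_closed(2) elementary_chain_closed l1 that)
    have c2: "s2 i j \<in> carrier (poly_tensors (k - 1))" if "i < j" "j < length as" for i j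
      unfolding s2_def poly_chains_simps
      by (intro poly_tensors_closed(2) elementary_chain_closed l2 that)
    have S1: "star (k - 1) (s1 i) bs = (-1) ^ i * (mbr m (as ! i) * jacobian (nths as (- {i}) @ bs))"
      if "i < length as" for i
      using l1[OF that] True
      by (simp add: s1_def star_smult elementary_chain_closed star_elementary pm_scale_sign)
    have S2: "star (k - 1) (s2 i j) bs = (-1) ^ (i + j)
      * (m * jacobian ((br (as ! i) (as ! j) # nths as (- {i, j})) @ bs))" if "i < j" "j < length as" for i j
      using l2[OF that] True
      by (simp add: s2_def star_smult elementary_chain_closed star_elementary pm_scale_sign)
    have c2': "(\<Oplus>\<^bsub>poly_chains (k - 1)\<^esub>i\<in>{..<j}. s2 i j) \<in> carrier (poly_tensors (k - 1))"
      if "j < length as" for j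
      using C.finsum_closed[of "\<lambda>i. s2 i j" "{..<j}"] c2 that by auto
    have c1'': "(\<Oplus>\<^bsub>poly_chains (k - 1)\<^esub>i\<in>{..<length as}. s1 i) \<in> carrier (poly_tensors (k - 1))"
      using C.finsum_closed[of s1 "{..<length as}"] c1 by auto
    have c2'': "(\<Oplus>\<^bsub>poly_chains (k - 1)\<^esub>j\<in>{..<length as}. \<Oplus>\<^bsub>poly_chains (k - 1)\<^esub>i\<in>{..<j}. s2 i j)
      \<in> carrier (poly_tensors (k - 1))"
      using C.finsum_closed[of "\<lambda>j. \<Oplus>\<^bsub>poly_chains (k - 1)\<^esub>i\<in>{..<j}. s2 i j" "{..<length as}"] c2' by auto
    have "bdry m as = (\<Oplus>\<^bsub>poly_chains (k - 1)\<^esub>i\<in>{..<length as}. s1 i) \<oplus>\<^bsub>poly_tensors (k - 1)\<^esub>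
      (\<Oplus>\<^bsub>poly_chains (k - 1)\<^esub>j\<in>{..<length as}. \<Oplus>\<^bsub>poly_chains (k - 1)\<^esub>i\<in>{..<j}. s2 i j)"
      by (simp only: boundary_value_def Let_def k s1_def s2_def poly_chains_simps(3))
    then have "star (k - 1) (bdry m as) bs = (\<Sum>i<length as. star (k - 1) (s1 i) bs)
      + (\<Sum>j<length as. star (k - 1) (\<Oplus>\<^bsub>poly_chains (k - 1)\<^esub>i\<in>{..<j}. s2 i j) bs)"
    proof -
      have "star (k - 1) (\<Oplus>\<^bsub>poly_chains (k - 1)\<^esub>i\<in>{..<length as}. s1 i) bs = (\<Sum>i<length as. star (k - 1) (s1 i) bs)"
        by (rule star_finsum) (use True c1 in auto)
      moreover have "star (k - 1) (\<Oplus>\<^bsub>poly_chains (k - 1)\<^esub>j\<in>{..<length as}. \<Oplus>\<^bsub>poly_chains (k - 1)\<^esub>i\<in>{..<j}. s2 i j) bs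
          = (\<Sum>j<length as. star (k - 1) (\<Oplus>\<^bsub>poly_chains (k - 1)\<^esub>i\<in>{..<j}. s2 i j) bs)"
        by (rule star_finsum) (use True c2' in auto)
      ultimately show ?thesis
        using star_add[OF True c1'' c2''] \<open>bdry m as = _\<close> by simp
    qed
    also have "(\<Sum>j<length as. star (k - 1) (\<Oplus>\<^bsub>poly_chains (k - 1)\<^esub>i\<in>{..<j}. s2 i j) bs)
      = (\<Sum>j<length as. \<Sum>i<j. star (k - 1) (s2 i j) bs)"
      using True c2 by (intro sum.cong refl star_finsum) auto
    also have "(\<Sum>i<length as. star (k - 1) (s1 i) bs) + (\<Sum>j<length as. \<Sum>i<j. star (k - 1) (s2 i j) bs)
      = (\<Sum>i<length as. (-1) ^ i * (mbr m (as ! i) * jacobian (nths as (- {i}) @ bs)))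
      + (\<Sum>j<length as. \<Sum>i<j. (-1) ^ (i + j)
          * (m * jacobian ((br (as ! i) (as ! j) # nths as (- {i, j})) @ bs)))"
      by (intro arg_cong2[where f = "(+)"] sum.cong refl S1 S2) auto
    also have "\<dots> = (-1) ^ length as * ((\<Sum>i<length bs. (-1) ^ i * br (bs ! i) (m * jacobian (as @ nths bs (- {i}))))
      + (\<Sum>j<length bs. \<Sum>i<j. (-1) ^ (i + j)
          * (m * jacobian (as @ br (bs ! i) (bs ! j) # nths bs (- {i, j})))))"
      by (rule jacobian_duality[OF len])
    also have "(\<Sum>i<length bs. (-1) ^ i * br (bs ! i) (m * jacobian (as @ nths bs (- {i}))))
      = (\<Sum>i<length bs. (-1) ^ i * br (bs ! i) (star k (?e m as) (nths bs (- {i}))))"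
      by (rule sum.cong) (use k len in \<open>auto simp: star_elementary length_nths_delete\<close>)
    also have "(\<Sum>j<length bs. \<Sum>i<j. (-1) ^ (i + j)
          * (m * jacobian (as @ br (bs ! i) (bs ! j) # nths bs (- {i, j}))))
      = (\<Sum>j<length bs. \<Sum>i<j. (-1) ^ (i + j) * star k (?e m as) (br (bs ! i) (bs ! j) # nths bs (- {i, j})))"
      by (intro sum.cong refl) (use k len in \<open>auto simp: star_elementary length_nths_delete2\<close>)
    finally show ?thesis by (simp only: poisson_coboundary_def)
  next
    case False
    \<comment> \<open>If bs does not have length n - k + 1, all arguments in the coboundary have the
      wrong length too, so both sides are zero.\<close>
    have "star k (?e m as) (nths bs (- {i})) = 0" if "i < length bs" for i
      using that False by (intro star_wrong_length) (simp add: length_nths_delete of_nat_diff)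
    moreover have "star k (?e m as) (y # nths bs (- {i, j})) = 0" if "i < j" "j < length bs" for i j y
      using that False by (intro star_wrong_length) (simp add: length_nths_delete2 of_nat_diff)
    ultimately have "poisson_coboundary br (star k (?e m as)) bs = 0"
      by (simp add: poisson_coboundary_def is_derivationD[OF br_derivation])
    then show ?thesis using False by (simp add: star_wrong_length)
  qed
qed

text \<open>It supplies the values of the boundary map constructed next. For negative k the exponent
  \<open>nat k\<close> is 0, which is harmless because there are no nonzero chains.\<close>

lemma signed_coboundary_in_image:
  assumes "x \<in> carrier (poly_tensors k)"
  shows "\<exists>y\<in>carrier (poly_tensors (k - 1)). star (k - 1) y
    = (\<lambda>bs. (-1) ^ nat k * poisson_coboundary br (star k x) bs)"
  using assms
proof (induction rule: poly_chains_induct)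
  case zero
  show ?case
    by (rule bexI[OF _ poly_tensors_zero_closed]) (simp add: star_zero_fun coboundary_zero)
next
  case (elem m as)
  then have "nat k = length as" by simp
  then show ?case
    using star_boundary_value[OF elem, of m] boundary_value_closed[OF elem, of m] by (intro bexI) simp_all
next
  case (add x y)
  then obtain x' y' where "x' \<in> carrier (poly_tensors (k - 1))" "y' \<in> carrier (poly_tensors (k - 1))"
    "star (k - 1) x' = (\<lambda>bs. (-1) ^ nat k * poisson_coboundary br (star k x) bs)"
    "star (k - 1) y' = (\<lambda>bs. (-1) ^ nat k * poisson_coboundary br (star k y) bs)" by blast
  then show ?case
    using add(1,2) poly_tensors_closed(1)
    by (intro bexI[of _ "x' \<oplus>\<^bsub>poly_tensors (k - 1)\<^esub> y'"])
      (simp_all add: star_add_fun coboundary_add distrib_left)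
qed

text \<open>The choice in the definition of the boundary is meaningful only if a suitable map
  exists. It is obtained by transporting the signed coboundary along the injective map
  \<open>star\<close>.\<close>

lemma poisson_boundary_spec:
  "linear_map (poly_chains k) (poly_chains (k - 1)) (poisson_boundary pm_scale br (*) mbr k)"
  "int (length as) = k \<Longrightarrow>
    poisson_boundary pm_scale br (*) mbr k (elementary_chain pm_scale (*) m as) = bdry m as"
proof -
  \<comment> \<open>The preimage under \<open>star\<close> of the signed coboundary. Injectivity of
    \<open>star\<close> makes it linear and forces the prescribed values on elementary
    chains.\<close>
  define D where "D x = (SOME y. y \<in> carrier (poly_tensors (k - 1)) \<and> star (k - 1) y
    = (\<lambda>bs. (-1) ^ nat k * poisson_coboundary br (star k x) bs))" for x
  have D: "D x \<in> carrier (poly_tensors (k - 1))"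
    "star (k - 1) (D x) = (\<lambda>bs. (-1) ^ nat k * poisson_coboundary br (star k x) bs)"
    if "x \<in> carrier (poly_tensors k)" for x
    using someI_ex[OF signed_coboundary_in_image[OF that, unfolded Bex_def]] by (simp_all add: D_def)
  have "linear_map (poly_chains k) (poly_chains (k - 1)) D"
    unfolding linear_map_def poly_chains_simps
  proof (intro conjI ballI allI Pi_I D(1))
    fix x y :: "('n cpoly, 'n cpoly) poisson_chain"
    assume xy: "x \<in> carrier (poly_tensors k)" "y \<in> carrier (poly_tensors k)"
    note cl = poly_tensors_closed(1)[OF xy]
    show "D (x \<oplus>\<^bsub>poly_tensors k\<^esub> y) = D x \<oplus>\<^bsub>poly_tensors (k - 1)\<^esub> D y"
      by (rule star_inj[where k = "k - 1"])
        (simp_all add: xy cl D star_add_fun poly_tensors_closed coboundary_add distrib_left)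
  next
    fix c and x :: "('n cpoly, 'n cpoly) poisson_chain"
    assume x: "x \<in> carrier (poly_tensors k)"
    note cl = poly_tensors_closed(2)[OF x]
    show "D (pm_scale c 1 \<odot>\<^bsub>poly_tensors k\<^esub> x) = pm_scale c 1 \<odot>\<^bsub>poly_tensors (k - 1)\<^esub> D x"
      by (rule star_inj[where k = "k - 1"])
        (simp_all add: x cl D star_smult_fun poly_tensors_closed coboundary_scale pm_scale_mult_right)
  qed
  moreover have "D (elementary_chain pm_scale (*) m as) = bdry m as" if "int (length as) = k" for m as
  proof (rule star_inj)
    show "star (k - 1) (D (elementary_chain pm_scale (*) m as)) = star (k - 1) (bdry m as)"
      unfolding D(2)[OF elementary_chain_closed[OF that]] star_boundary_value[OF that] using that by auto
  qed (simp_all add: that D elementary_chain_closed boundary_value_closed)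
  ultimately have "\<exists>D. linear_map (poly_chains k) (poly_chains (k - 1)) D \<and>
    (\<forall>m as. int (length as) = k \<longrightarrow> D (elementary_chain pm_scale (*) m as) = bdry m as)" by blast
  from someI_ex[OF this] show
    "linear_map (poly_chains k) (poly_chains (k - 1)) (poisson_boundary pm_scale br (*) mbr k)"
    "int (length as) = k \<Longrightarrow>
      poisson_boundary pm_scale br (*) mbr k (elementary_chain pm_scale (*) m as) = bdry m as"
    unfolding poisson_boundary_def by blast+
qed

lemma poisson_boundary_closed:
  "x \<in> carrier (poly_tensors k) \<Longrightarrow> poisson_boundary pm_scale br (*) mbr k x \<in> carrier (poly_tensors (k - 1))"
  using poisson_boundary_spec(1)[of k] by (auto simp: linear_map_def)

lemma star_poisson_boundary:
  assumes "x \<in> carrier (poly_tensors k)"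
  shows "star (k - 1) (poisson_boundary pm_scale br (*) mbr k x)
    = (\<lambda>bs. (-1) ^ nat k * poisson_coboundary br (star k x) bs)"
  using assms
proof (induction rule: poly_chains_induct)
  let ?D = "poisson_boundary pm_scale br (*) mbr k"
  note lin = poisson_boundary_spec(1)[of k, unfolded linear_map_def poly_chains_simps]
  {
    case zero
    \<comment> \<open>Linearity for the scalar 0, which gives that the boundary of zero is
      zero.\<close>
    have "?D (pm_scale 0 1 \<odot>\<^bsub>poly_tensors k\<^esub> \<zero>\<^bsub>poly_tensors k\<^esub>)
      = pm_scale 0 1 \<odot>\<^bsub>poly_tensors (k - 1)\<^esub> ?D \<zero>\<^bsub>poly_tensors k\<^esub>"
      using lin poly_tensors_zero_closed by blast
    then have "?D \<zero>\<^bsub>poly_tensors k\<^esub> = \<zero>\<^bsub>poly_tensors (k - 1)\<^esub>"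
      using poisson_boundary_closed[OF poly_tensors_zero_closed]
      by (simp add: poly_tensors_zero_smult poly_tensors_zero_closed)
    then show ?case by (simp add: star_zero_fun coboundary_zero)
  next
    case (elem m as)
    then show ?case by (auto simp: poisson_boundary_spec(2) star_boundary_value)
  next
    case (add x y)
    have "?D (x \<oplus>\<^bsub>poly_tensors k\<^esub> y) = ?D x \<oplus>\<^bsub>poly_tensors (k - 1)\<^esub> ?D y"
      using lin add(1,2) by blast
    then show ?case
      using add by (simp add: star_add_fun poisson_boundary_closed coboundary_add distrib_left)
  }
qed

theorem poisson_duality:
  "isomorphic_modules (poisson_homology pm_scale br (*) mbr k)
     (poisson_cohomology pm_scale br (int CARD('n) - k))"
  unfolding poisson_homology_def poisson_cohomology_def
proof (rule homology_module_iso[where \<phi> = "star k"])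
  let ?C = "\<lambda>k. poly_chains k :: (complex, ('n cpoly, 'n cpoly) poisson_chain) module"
  let ?D = "poisson_boundary pm_scale br (*) mbr"
  let ?X = "\<lambda>l. skew_multiderivations pm_scale l :: ('n cpoly list \<Rightarrow> 'n cpoly) set"
  show "linear_map (?C k) (cochain_module pm_scale (int CARD('n) - k)) (star k)"
    unfolding linear_map_def cochain_module_def
    by (auto simp: star_add_fun star_smult_fun intro!: star_in_skew_multiderivations)
  show "bij_betw (star k) (carrier (?C k)) (carrier (cochain_module pm_scale (int CARD('n) - k)))"
    using bij_betw_star[of k] by (simp add: cochain_module_def)
  show "x \<oplus>\<^bsub>?C k\<^esub> y \<in> carrier (?C k)"
    if "x \<in> carrier (?C k)" "y \<in> carrier (?C k)" for x y
    using that by (simp add: poly_tensors_closed)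
  show "c \<odot>\<^bsub>?C k\<^esub> x \<in> carrier (?C k)" if "x \<in> carrier (?C k)" for c x
    using that by (simp add: poly_tensors_closed)
  show "?D (k + 1) ` carrier (?C (k + 1)) \<subseteq> carrier (?C k)"
    using poisson_boundary_closed[of _ "k + 1"] by auto
  show "?D k x = \<zero>\<^bsub>?C (k - 1)\<^esub>
      \<longleftrightarrow> poisson_coboundary br (star k x) = \<zero>\<^bsub>cochain_module pm_scale (int CARD('n) - k + 1)\<^esub>"
    if "x \<in> carrier (?C k)" for x
  proof -
    have x: "x \<in> carrier (poly_tensors k)" using that by simp
    have "?D k x = \<zero>\<^bsub>poly_tensors (k - 1)\<^esub> \<longleftrightarrow> star (k - 1) (?D k x) = (\<lambda>bs. 0)"
      using star_inj[OF poisson_boundary_closed[OF x] poly_tensors_zero_closed] by (auto simp: star_zero_fun)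
    also have "\<dots> \<longleftrightarrow> (\<forall>bs. pm_scale ((-1) ^ nat k) (poisson_coboundary br (star k x) bs) = 0)"
      by (simp add: star_poisson_boundary[OF x] fun_eq_iff pm_scale_sign)
    also have "\<dots> \<longleftrightarrow> (\<forall>bs. poisson_coboundary br (star k x) bs = 0)"
      by (metis (no_types, opaque_lifting) left_minus_one_mult_self mult_zero_right pm_scale_sign)
    finally show ?thesis by (simp add: cochain_module_def fun_eq_iff)
  qed
  show "star k ` ?D (k + 1) ` carrier (?C (k + 1))
    = poisson_coboundary br ` carrier (cochain_module pm_scale (int CARD('n) - k - 1))"
  proof -
    \<comment> \<open>The sign by which \<open>star\<close> fails to commute with the differential
      arriving from degree k + 1.\<close>
    define c :: complex where "c = (-1) ^ nat (k + 1)"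
    have l: "int CARD('n) - k - 1 = int CARD('n) - (k + 1)" by simp
    have D: "star k (?D (k + 1) x) fs = poisson_coboundary br (\<lambda>bs. pm_scale c (star (k + 1) x bs)) fs"
      if "x \<in> carrier (poly_tensors (k + 1))" for x fs
      unfolding coboundary_scale using star_poisson_boundary[OF that] by (simp add: c_def pm_scale_sign)
    have cc: "c * c = 1" by (simp add: c_def)
    have surj: "star (k + 1) ` carrier (poly_tensors (k + 1)) = ?X (int CARD('n) - (k + 1))"
      by (rule bij_betw_imp_surj_on) (rule bij_betw_star)
    \<comment> \<open>As c squares to 1, scaling by c permutes the multiderivations, so the sign
      does not change the set of coboundaries.\<close>
    have "(\<lambda>P bs. pm_scale c (P bs)) ` ?X (int CARD('n) - (k + 1)) = ?X (int CARD('n) - (k + 1))"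
    proof (intro equalityI subsetI)
      fix P assume "P \<in> ?X (int CARD('n) - (k + 1))"
      then show "P \<in> (\<lambda>P bs. pm_scale c (P bs)) ` ?X (int CARD('n) - (k + 1))"
        by (intro image_eqI[of _ _ "\<lambda>bs. pm_scale c (P bs)"]) (auto simp: cc skew_multiderivations_scale)
    qed (auto intro: skew_multiderivations_scale)
    then have "poisson_coboundary br ` ?X (int CARD('n) - (k + 1))
      = poisson_coboundary br ` (\<lambda>P bs. pm_scale c (P bs)) ` ?X (int CARD('n) - (k + 1))"
      by (simp only:)
    also have "\<dots> = (\<lambda>x. poisson_coboundary br (\<lambda>bs. pm_scale c (star (k + 1) x bs))) ` carrier (poly_tensors (k + 1))"
      unfolding surj[symmetric] image_image ..
    also have "\<dots> = (\<lambda>x. star k (?D (k + 1) x)) ` carrier (poly_tensors (k + 1))"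
      by (intro image_cong refl ext) (simp only: D)
    finally show ?thesis unfolding l by (simp add: cochain_module_def image_image)
  qed
qed

end

section \<open>The quadratic bracket with coefficients a_ij\<close>

lemma derivation_of_int: "is_derivation D \<Longrightarrow> D (of_int c * f) = of_int c * D f"
proof -
  assume D: "is_derivation D"
  have "D (of_nat n) = 0" for n by (induction n) (simp_all add: is_derivationD[OF D])
  then have "D (of_int c) = 0" by (cases c rule: int_diff_cases) (simp add: is_derivationD[OF D])
  then show ?thesis by (simp add: is_derivationD[OF D])
qed

hide_const (open) Transposition.transpose

theorem theorem3p4p2:
  fixes A :: "int ^ 'n ^ 'n"
    and br mbr :: "'n cpoly \<Rightarrow> 'n cpoly \<Rightarrow> 'n cpoly"
    and k :: nat
  assumes "transpose A = - A"
    and "poisson_algebra pm_scale br"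
    and "\<And>i j. br (pvar i) (pvar j) = of_int (A $ i $ j) * pvar i * pvar j"
    and "poisson_module pm_scale br pm_scale (*) mbr"
    and "\<And>m i. mbr m (pvar i) = - br (pvar i) m + of_int (\<Sum>l\<in>UNIV. A $ i $ l) * pvar i * m"
  shows "isomorphic_modules
           (poisson_homology pm_scale br (*) mbr (int k))
           (poisson_cohomology pm_scale br (int CARD('n) - int k))"
proof -
  interpret P: poisson_algebra pm_scale br by fact
  interpret M: poisson_module pm_scale br pm_scale "(*)" mbr by fact
  interpret B: cpoly_bracket br
  proof
    show "is_derivation (br f)" for f
      by (simp add: is_derivation_def P.br_add_right P.br_scale_right P.br_leibniz)
    show "br f g = - br g f" for f g
    proof -
      have "br f f + br f g + (br g f + br g g) = 0"
        using P.br_self[of "f + g"] unfolding P.br_add_left unfolding P.br_add_right .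
      then show ?thesis by (simp only: P.br_self add_0_left add_0_right eq_neg_iff_add_eq_0)
    qed
  qed
  have diag: "A $ i $ i = 0" for i
  proof -
    have "transpose A $ i $ i = (- A) $ i $ i" by (simp only: assms(1))
    then show ?thesis by (simp add: Finite_Cartesian_Product.transpose_def)
  qed
  \<comment> \<open>For j different from i the derivative of a_ij X_i X_j by X_j is a_ij X_i. For j
    = i it would have an extra factor 2, but skewness makes the diagonal entry zero.\<close>
  have div: "divergence (br (pvar i)) = of_int (\<Sum>l\<in>UNIV. A $ i $ l) * pvar i" for i
  proof -
    have "pderiv_var j (br (pvar i) (pvar j)) = of_int (A $ i $ j) * pvar i" for j
      unfolding assms(3) mult.assoc derivation_of_int[OF is_derivation_pderiv_var]
      by (simp add: pderiv_var_mult pderiv_var_pvar diag)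
    then show ?thesis by (simp add: divergence_def sum_distrib_right)
  qed
  interpret unimodular_twist br mbr
  proof
    fix m f
    \<comment> \<open>The module axiom for products makes the bracket a derivation in its second
      argument, so its values on variables determine it. The divergence is a derivation as well, and
      the formula extends from variables to all f.\<close>
    have "is_derivation (mbr m)"
      by (simp add: is_derivation_def M.mbr_add_right M.mbr_scale_right M.mbr_mult mult.commute)
    then have "mbr m f = (\<Sum>i\<in>UNIV. pderiv_var i f * mbr m (pvar i))" by (rule derivation_expand)
    also have "\<dots> = - (\<Sum>i\<in>UNIV. pderiv_var i f * br (pvar i) m)
        + (\<Sum>i\<in>UNIV. pderiv_var i f * divergence (br (pvar i))) * m"
      unfolding assms(5) div[symmetric]
      by (simp add: algebra_simps sum.distrib sum_subtractf sum_distrib_left)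
    also have "\<dots> = - br f m + divergence (br f) * m"
      by (simp only: B.divergence_br[of f] derivation_expand[OF B.br_derivation_left, of f m])
    finally show "mbr m f = - br f m + divergence (br f) * m" .
  qed
  show ?thesis by (rule poisson_duality)
qed

end
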